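(* Let $X=\overline{\Omega}$, where $\Omega$ is an open bounded connected subset of $\mathbb{R}^d$ with negligible boundary, let $Y$ be a compact metric space with a fixed reference measure $m_0$, let $\mu\in\mathcal{P}(X)$ be equivalent to the Lebesgue measure on $X$, and let $c\in\mathcal{C}(X\times Y)$ be such that for every $y\in Y$ the function $c(\cdot,y)$ is differentiable, with $\nabla_xc$ bounded on $X\times Y$. Let $$\mathcal{V}[\nu](y)=f(y,\nu(y))+\mathcal{I}[\nu](y),$$ where $f(y,\cdot)$ is increasing for each $y\in Y$ and satisfies, for some $\alpha>0$ and $C>0$, $$\frac1C(t^\alpha-1)\le f(y,t)\le C(t^\alpha+1)\qquad\text{for all }(y,t)\in Y\times[0,\infty),$$ and where $\mathcal{I}[\nu]\in\mathcal{C}(Y)$ for every $\nu\in\mathcal{P}(Y)$ and $\nu\mapsto\mathcal{I}[\nu]$ is continuous from $\mathcal{P}(Y)$ endowed with the weak-$*$ topology to $(\mathcal{C}(Y),\|\cdot\|_\infty)$. Then there exists at least one Cournot-Nash equilibrium.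
   Context: $\mathcal{P}(Z)$ is the set of Borel probability measures on $Z$ and $\mathcal{C}(Z)$ the set of continuous real functions on $Z$. For $\nu\in\mathcal{P}(Y)$ absolutely continuous with respect to $m_0$, $\nu(y)$ denotes the value at $y$ of the Radon-Nikodym derivative of $\nu$ with respect to $m_0$. The function $f$ is real-valued on $Y\times[0,\infty)$. Set $\mathcal{D}:=\mathcal{P}(Y)\cap L^{1+\alpha}(m_0)$, the set of probability measures on $Y$ with a density in $L^{1+\alpha}(m_0)$. "Equivalent" means mutually absolutely continuous; "negligible" means of zero Lebesgue measure. The cost for an agent of type $x\in X$ of choosing action $y\in Y$ when the distribution of actions is $\nu$ is $c(x,y)+\mathcal{V}[\nu](y)$, and $\mu$ is the distribution of types. A Cournot-Nash equilibrium is a $\gamma\in\mathcal{P}(X\times Y)$ whose first marginal is $\mu$, whose second marginal $\nu$ belongs to $\mathcal{D}$, and for which there exists $\varphi\in\mathcal{C}(X)$ such that $c(x,y)+\mathcal{V}[\nu](y)\ge\varphi(x)$ for all $x\in X$ and $m_0$-a.e. $y\in Y$, and $c(x,y)+\mathcal{V}[\nu](y)=\varphi(x)$ for $\gamma$-a.e. $(x,y)\in X\times Y$.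
   Formalization: The function f is additionally assumed Borel measurable in y and continuous in t, and the reference measure m_0 is assumed to be a finite nonzero Borel measure; without these the claim is false. *)

theory Defs
  imports "HOL-Probability.Probability"
begin

abbreviation borel_on :: "'a::topological_space set \<Rightarrow> 'a measure" where
  "borel_on Z \<equiv> restrict_space borel Z"

definition borel_probs :: "'a::topological_space set \<Rightarrow> 'a measure set" where
  "borel_probs Z = {\<nu>. prob_space \<nu> \<and> sets \<nu> = sets (borel_on Z)}"

text \<open>
  The initial topology on the Borel probability measures on \<open>Z\<close> for the maps
  \<open>\<nu> \<mapsto> \<integral>g d\<nu>\<close>, with \<open>g\<close> ranging over the functions continuous on \<open>Z\<close>. The values of \<open>g\<close>
  outside \<open>Z\<close> do not affect the integral, since every such measure has space \<open>Z\<close>.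
\<close>

definition weak_star :: "'a::topological_space set \<Rightarrow> 'a measure topology" where
  "weak_star Z =
     pullback_topology (borel_probs Z)
       (\<lambda>\<nu>. \<lambda>g\<in>{g. continuous_on Z g}. integral\<^sup>L \<nu> g)
       (product_topology (\<lambda>_. euclideanreal) {g. continuous_on Z g})"

text \<open>The continuous real functions on a compact \<open>Z\<close>, with the topology of the supremum norm.\<close>

definition sup_norm_topology :: "'a::topological_space set \<Rightarrow> ('a \<Rightarrow> real) topology" where
  "sup_norm_topology Z = mtopology_of (cfunspace (top_of_set Z) euclidean_metric)"

definition equivalent_measures :: "'a measure \<Rightarrow> 'a measure \<Rightarrow> bool" where
  "equivalent_measures M N \<longleftrightarrow> absolutely_continuous M N \<and> absolutely_continuous N M"

text \<open>The value \<open>\<nu>(y)\<close> of the Radon-Nikodym derivative of \<open>\<nu>\<close> with respect to \<open>m\<^sub>0\<close>.\<close>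

definition density_at :: "'b measure \<Rightarrow> 'b measure \<Rightarrow> 'b \<Rightarrow> real" where
  "density_at m\<^sub>0 \<nu> y = enn2real (RN_deriv m\<^sub>0 \<nu> y)"

definition admissible :: "'b::topological_space set \<Rightarrow> 'b measure \<Rightarrow> real \<Rightarrow> 'b measure set" where
  "admissible Y m\<^sub>0 \<alpha> =
     {\<nu> \<in> borel_probs Y. absolutely_continuous m\<^sub>0 \<nu> \<and>
        integrable m\<^sub>0 (\<lambda>y. density_at m\<^sub>0 \<nu> y powr (1 + \<alpha>))}"

definition externality ::
  "'b measure \<Rightarrow> ('b \<Rightarrow> real \<Rightarrow> real) \<Rightarrow> ('b measure \<Rightarrow> 'b \<Rightarrow> real) \<Rightarrow> 'b measure \<Rightarrow> 'b \<Rightarrow> real" where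
  "externality m\<^sub>0 f I \<nu> y = f y (density_at m\<^sub>0 \<nu> y) + I \<nu> y"

definition cournot_nash_equilibrium ::
  "'a::topological_space set \<Rightarrow> 'b::topological_space set \<Rightarrow> 'a measure \<Rightarrow> 'b measure \<Rightarrow>
   'b measure set \<Rightarrow> ('a \<Rightarrow> 'b \<Rightarrow> real) \<Rightarrow> ('b measure \<Rightarrow> 'b \<Rightarrow> real) \<Rightarrow> ('a \<times> 'b) measure \<Rightarrow> bool" where
  "cournot_nash_equilibrium X Y \<mu> m\<^sub>0 D c V \<gamma> \<longleftrightarrow>
     \<gamma> \<in> borel_probs (X \<times> Y) \<and>
     distr \<gamma> (borel_on X) fst = \<mu> \<and>
     (\<exists>\<nu>\<in>D. distr \<gamma> (borel_on Y) snd = \<nu> \<and>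
        (\<exists>\<phi>. continuous_on X \<phi> \<and>
           (\<forall>x\<in>X. AE y in m\<^sub>0. c x y + V \<nu> y \<ge> \<phi> x) \<and>
           (AE (x, y) in \<gamma>. c x y + V \<nu> y = \<phi> x)))"

end

theory Submission
  imports Defs "HOL-Complex_Analysis.Great_Picard"
begin

text \<open>
  Since only existence is asked for, Kantorovich duality can be bypassed. A pair of \<open>c\<close>-transforms
  \<open>\<phi>\<close>, \<open>P\<close> is an equilibrium when the density solves \<open>f(y, \<nu>(y)) + I[\<nu>](y) = P(y)\<close> where it is positive
  (and \<open>\<ge> P(y)\<close> elsewhere) and the action plan is concentrated on \<open>\<phi>(x) = P(y) + c(x, y)\<close>. Given \<open>P\<close> and
  \<open>I[\<nu>]\<close>, the density is recovered by inverting \<open>f(y, \<cdot>)\<close>; so after replacing \<open>\<mu>\<close> by finitely many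
  types, discretizing the argument of \<open>I\<close>, choosing actions by the logit rule and adding a small linear
  term to \<open>f\<close>, the only unknowns are one number per type and finitely many weights, and the
  Poincare--Miranda theorem provides a solution.

  In the limit the plans converge weakly and the potentials uniformly (they inherit the modulus of
  continuity of \<open>c\<close>), but the densities \<open>\<nu>\<^sub>n\<close> only converge weakly. The limit density lies almost
  everywhere between \<open>liminf \<nu>\<^sub>n(y)\<close> and \<open>limsup \<nu>\<^sub>n(y)\<close>, and by monotonicity of \<open>f(y, \<cdot>)\<close> every value
  in that interval solves the limit equation.
\<close>

text \<open>Each regularization repairs one defect. Best replies are set-valued at ties, whereas
  logit weights are unique, positive and continuous in the potentials. \<open>f(y, .)\<close> may
  have flat parts, hence no inverse; the linear term provides a Lipschitz one. The density enters
  its own equation through \<open>I\<close>; showing \<open>I\<close> only finitely many atoms makes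
  this loop finite dimensional.

  The box of unknowns reflects willingness to pay: a type accepting the cost \<open>U\<close>
  attracts at least its mass, a type accepting only \<open>- L\<close> at most its mass. These
  constants depend on the noise and on the number of types, so they are lost in the limit. The
  bounds that survive use only that the density has mass one: it is positive somewhere and at most
  twice its mean somewhere, and the oscillation of the potential is controlled by \<open>c\<close>.
  The lower growth bound then gives one bound for all densities, used twice: as the domination in
  the reverse Fatou lemma, and to place the limit density in the required Lebesgue space.\<close>

section \<open>Coding compact metric spaces by compact sets of reals\<close>

text \<open>Base 3 leaves gaps between the sums with digits 0 and 1, so that close sums have equal leading
  digits.\<close>

lemma ternary_digits_eq:
  fixes a b :: "nat \<Rightarrow> real"
  assumes "\<And>k. a k \<in> {0, 1}" "\<And>k. b k \<in> {0, 1}"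
    and "\<bar>(\<Sum>k. a k / 3 ^ k) - (\<Sum>k. b k / 3 ^ k)\<bar> < 1 / (2 * 3 ^ N)" and "k \<le> N"
  shows "a k = b k"
  using assms
proof (induction N arbitrary: a b k)
  have geo: "summable (\<lambda>k. 1 / 3 ^ k :: real)" "(\<Sum>k. 1 / 3 ^ k :: real) = 3 / 2"
    using summable_geometric[of "1/3::real"] suminf_geometric[of "1/3::real"]
    by (simp_all add: power_divide)
  have summ: "summable (\<lambda>k. c k / 3 ^ k)" if "\<And>k. c k \<in> {0, 1}" for c :: "nat \<Rightarrow> real"
  proof (rule summable_comparison_test[OF _ geo(1)])
    have "\<bar>c k\<bar> \<le> 1" for k
      using that[of k] by auto
    then show "\<exists>N. \<forall>n\<ge>N. norm (c n / 3 ^ n) \<le> 1 / 3 ^ n"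
      by (simp add: divide_right_mono)
  qed
  have bounds: "0 \<le> (\<Sum>k. c k / 3 ^ k) \<and> (\<Sum>k. c k / 3 ^ k) \<le> 3 / 2" if "\<And>k. c k \<in> {0, 1}" for c :: "nat \<Rightarrow> real"
  proof
    have c: "0 \<le> c k \<and> c k \<le> 1" for k
      using that[of k] by auto
    show "0 \<le> (\<Sum>k. c k / 3 ^ k)"
      by (rule suminf_nonneg[OF summ[OF that]]) (use c in auto)
    show "(\<Sum>k. c k / 3 ^ k) \<le> 3 / 2"
      unfolding geo(2)[symmetric]
      by (rule suminf_le[OF _ summ[OF that] geo(1)]) (use c in \<open>auto simp: divide_right_mono\<close>)
  qed
  have split: "(\<Sum>k. c k / 3 ^ k) = c 0 + (\<Sum>k. c (Suc k) / 3 ^ k) / 3" if "\<And>k. c k \<in> {0, 1}" for c :: "nat \<Rightarrow> real"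
  proof -
    have "(\<Sum>k. c (Suc k) / 3 ^ k) / 3 = (\<Sum>k. c (Suc k) / 3 ^ k / 3)"
      by (rule suminf_divide[symmetric]) (rule summ, use that in auto)
    then show ?thesis
      using suminf_split_head[OF summ, of c] that by (simp add: field_simps)
  qed
  {
    fix a b :: "nat \<Rightarrow> real"
    assume a: "\<And>k. a k \<in> {0, 1}" and b: "\<And>k. b k \<in> {0, 1}"
      and less: "\<bar>(\<Sum>k. a k / 3 ^ k) - (\<Sum>k. b k / 3 ^ k)\<bar> < 1 / 2"
    note bnd = bounds[of "\<lambda>k. a (Suc k)", OF a] bounds[of "\<lambda>k. b (Suc k)", OF b]
    \<comment> \<open>Tails lie in [0, 3/2], so after division by 3 they shift the sum by at most
      1/2, while different heads are 1 apart.\<close>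
    have "a 0 = b 0"
      using bnd less a[of 0] b[of 0] unfolding split[of a, OF a] split[of b, OF b]
      by (auto simp: abs_if split: if_splits)
  } note head = this
  {
    case 0
    then show ?case
      using head[of a b] by auto
  next
    case (Suc N)
    have "1 / (2 * 3 ^ Suc N) \<le> (1 / 2 :: real)"
      using one_le_power[of "3::real" "Suc N"] by (simp add: divide_simps)
    then have h: "a 0 = b 0"
      using head[of a b] Suc.prems by (smt (verit))
    show ?case
    proof (cases k)
      case 0
      then show ?thesis using h by simp
    next
      case k: (Suc j)
      have "\<bar>(\<Sum>k. a (Suc k) / 3 ^ k) / 3 - (\<Sum>k. b (Suc k) / 3 ^ k) / 3\<bar> < 1 / (2 * 3 ^ Suc N)"
        using Suc.prems(3) h split[of a, OF Suc.prems(1)] split[of b, OF Suc.prems(2)] by simp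
      then have "\<bar>(\<Sum>k. a (Suc k) / 3 ^ k) - (\<Sum>k. b (Suc k) / 3 ^ k)\<bar> < 1 / (2 * 3 ^ N)"
        unfolding diff_divide_distrib[symmetric] abs_divide by (simp add: field_simps)
      then show ?thesis
        using Suc.IH[of "\<lambda>k. a (Suc k)" "\<lambda>k. b (Suc k)" j] Suc.prems k by auto
    qed
  }
qed

text \<open>One \<open>N\<close> serves all points of \<open>Z\<close>: membership in
  \<open>B 0\<close>, ..., \<open>B N\<close> locates every point to within \<open>e\<close>. This
  uniformity is what makes the decoding map uniformly continuous.\<close>

lemma compact_countable_small_cover:
  fixes Z :: "'a::metric_space set"
  assumes "compact Z"
  shows "\<exists>B. (\<forall>k::nat. open (B k)) \<and>
    (\<forall>e>0. \<exists>N. \<forall>z\<in>Z. \<exists>k\<le>N. z \<in> B k \<and> (\<forall>x\<in>B k. \<forall>y\<in>B k. dist x y < e))"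
proof -
  have "\<exists>F. finite F \<and> Z \<subseteq> (\<Union>z\<in>F. ball z (1 / real (Suc m)))" for m
  proof -
    have "\<exists>F\<subseteq>Z. finite F \<and> Z \<subseteq> (\<Union>z\<in>F. ball z (1 / real (Suc m)))"
      by (rule compactE_image[OF assms, of Z "\<lambda>z. ball z (1 / real (Suc m))"]) (auto intro!: centre_in_ball[THEN iffD2])
    then show ?thesis by blast
  qed
  then obtain F where F: "\<And>m. finite (F m)" "\<And>m. Z \<subseteq> (\<Union>z\<in>F m. ball z (1 / real (Suc m)))"
    by metis
  \<comment> \<open>The extra empty set keeps \<open>S\<close> nonempty when \<open>Z\<close> is
    empty, so that \<open>from_nat_into\<close> enumerates exactly \<open>S\<close>.\<close>
  define S where "S = insert {} (\<Union>m. (\<lambda>z. ball z (1 / real (Suc m))) ` F m)"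
  have S: "countable S" "S \<noteq> {}"
    unfolding S_def using F(1) by (auto intro: countable_finite)
  define B where "B = from_nat_into S"
  have range: "range B = S"
    unfolding B_def using S by (simp add: range_from_nat_into)
  show ?thesis
  proof (intro exI[of _ B] conjI allI impI)
    show "open (B k)" for k
    proof -
      have "B k \<in> S" using range by auto
      then show ?thesis by (auto simp: S_def)
    qed
    fix e :: real assume "e > 0"
    then obtain m where m: "2 / e < real (Suc m)"
      using reals_Archimedean2 by (metis less_SucI of_nat_less_iff order_less_trans lessI)
    have "\<exists>k. B k = ball z (1 / real (Suc m))" if "z \<in> F m" for z
    proof -
      have "ball z (1 / real (Suc m)) \<in> S" using that by (auto simp: S_def)
      then show ?thesis using range by (metis imageE)
    qed
    then obtain k where k: "\<And>z. z \<in> F m \<Longrightarrow> B (k z) = ball z (1 / real (Suc m))"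
      by metis
    show "\<exists>N. \<forall>z\<in>Z. \<exists>j\<le>N. z \<in> B j \<and> (\<forall>x\<in>B j. \<forall>y\<in>B j. dist x y < e)"
    proof (rule exI[of _ "Max (k ` F m)"], rule ballI)
      fix z assume "z \<in> Z"
      then obtain c where c: "c \<in> F m" "z \<in> ball c (1 / real (Suc m))"
        using F(2) by blast
      have small: "2 * (1 / real (Suc m)) < e"
        using m \<open>e > 0\<close> by (simp add: field_simps)
      have "dist x y < e" if "x \<in> ball c (1 / real (Suc m))" "y \<in> ball c (1 / real (Suc m))" for x y
        using that small dist_triangle3[of x y c] by (auto simp: dist_commute)
      then show "\<exists>j\<le>Max (k ` F m). z \<in> B j \<and> (\<forall>x\<in>B j. \<forall>y\<in>B j. dist x y < e)"
        using c k[OF c(1)] F(1) by (intro exI[of _ "k c"]) auto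
    qed
  qed
qed

text \<open>Through \<open>s\<close> and \<open>h\<close>, weak compactness reduces to Helly's selection theorem on the real line.\<close>

lemma compact_coded_by_reals:
  fixes Z :: "'a::metric_space set"
  assumes "compact Z"
  shows "\<exists>(K :: real set) s h. compact K \<and> s \<in> borel_measurable (borel_on Z) \<and> s ` Z \<subseteq> K \<and>
    continuous_on K h \<and> h ` K \<subseteq> Z \<and> (\<forall>z\<in>Z. h (s z) = z)"
proof -
  obtain B :: "nat \<Rightarrow> 'a set" where open_B: "\<forall>k. open (B k)" and
    small: "\<forall>e>0. \<exists>N. \<forall>z\<in>Z. \<exists>k\<le>N. z \<in> B k \<and> (\<forall>x\<in>B k. \<forall>y\<in>B k. dist x y < e)"
    using compact_countable_small_cover[OF assms] by blast
  \<comment> \<open>The digits of \<open>s z\<close> record which \<open>B k\<close> contain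
    \<open>z\<close>. The code may jump at the boundary of each \<open>B k\<close>; the regularity
    is all in its inverse, as \<open>close\<close> shows.\<close>
  define s where "s z = (\<Sum>k. indicat_real (B k) z / 3 ^ k)" for z
  have summ: "summable (\<lambda>k. indicat_real (B k) z / 3 ^ k)" for z
  proof (rule summable_comparison_test)
    show "summable (\<lambda>k. 1 / 3 ^ k :: real)"
      using summable_geometric[of "1/3::real"] by (simp add: power_divide)
  qed (auto simp: indicator_def)
  have "s z \<in> {0..3 / 2}" for z
  proof -
    have "s z \<le> (\<Sum>k. 1 / 3 ^ k)"
      unfolding s_def using summable_geometric[of "1/3::real"]
      by (intro suminf_le summ) (auto simp: indicator_def power_divide)
    then show ?thesis
      using suminf_geometric[of "1/3::real"] suminf_nonneg[OF summ, of z] by (simp add: s_def power_divide)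
  qed
  then have s_bdd: "bounded (s ` Z)"
    by (intro bounded_subset[OF bounded_closed_interval[of 0 "3/2"]]) blast
  have close: "\<exists>d>0. \<forall>x\<in>Z. \<forall>y\<in>Z. \<bar>s x - s y\<bar> < d \<longrightarrow> dist x y < e" if "e > 0" for e
  proof -
    obtain N where N: "\<forall>z\<in>Z. \<exists>k\<le>N. z \<in> B k \<and> (\<forall>x\<in>B k. \<forall>y\<in>B k. dist x y < e)"
      using small \<open>e > 0\<close> by blast
    show ?thesis
    proof (intro exI[of _ "1 / (2 * 3 ^ N)"] conjI ballI impI)
      fix x y assume xy: "x \<in> Z" "y \<in> Z" "\<bar>s x - s y\<bar> < 1 / (2 * 3 ^ N)"
      obtain k where k: "k \<le> N" "x \<in> B k" "\<forall>x\<in>B k. \<forall>y\<in>B k. dist x y < e"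
        using N xy(1) by blast
      have "indicat_real (B k) x = indicat_real (B k) y"
        using xy(3) k(1) unfolding s_def
        by (intro ternary_digits_eq[of "\<lambda>k. indicat_real (B k) x" "\<lambda>k. indicat_real (B k) y" N])
          (auto simp: indicator_def)
      then have "y \<in> B k"
        using k(2) by (auto simp: indicator_def split: if_splits)
      then show "dist x y < e" using k by blast
    qed simp
  qed
  have inj: "inj_on s Z"
  proof (rule inj_onI, rule ccontr)
    fix x y assume "x \<in> Z" "y \<in> Z" "s x = s y" "x \<noteq> y"
    then show False using close[of "dist x y"] by (metis abs_zero diff_self less_irrefl zero_less_dist_iff)
  qed
  define g where "g = inv_into Z s"
  have g: "g (s z) = z" if "z \<in> Z" for z
    unfolding g_def using inj that by simp
  have "uniformly_continuous_map (submetric euclidean_metric (s ` Z)) (submetric euclidean_metric Z) g"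
    unfolding uniformly_continuous_map_def
    using close g by (auto simp: Pi_iff dist_real_def abs_minus_commute dist_commute)
  \<comment> \<open>Completeness of \<open>Z\<close> extends the decoding map from the image of
    \<open>s\<close>, which need not be closed, to its closure. That closure is the compact set
    \<open>K\<close>.\<close>
  moreover have "mcomplete_of (submetric euclidean_metric Z)"
  proof -
    have "compact_space (mtopology_of (submetric euclidean_metric Z))"
      using assms by (simp add: mtopology_of_submetric compact_space_subtopology)
    then show ?thesis
      unfolding mcomplete_of_def mtopology_of_def
      by (intro Metric_space.compact_space_imp_mcomplete Metric_space_mspace_mdist)
  qed
  ultimately obtain h where
    h: "uniformly_continuous_map (submetric euclidean_metric (mtopology_of euclidean_metric closure_of (s ` Z)))
         (submetric euclidean_metric Z) h" and hg: "\<And>x. x \<in> s ` Z \<Longrightarrow> h x = g x"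
    using uniformly_continuous_map_extends_to_closure_of by metis
  have "continuous_map (top_of_set (closure (s ` Z))) (top_of_set Z) h"
    using uniformly_continuous_imp_continuous_map[OF h] 
    by (simp add: mtopology_of_submetric)
  then have h': "continuous_on (closure (s ` Z)) h" "h ` closure (s ` Z) \<subseteq> Z"
    by (auto simp: continuous_map_in_subtopology)
  show ?thesis
  proof (intro exI[of _ "closure (s ` Z)"] exI[of _ s] exI[of _ h] conjI)
    show "s \<in> borel_measurable (borel_on Z)"
      unfolding s_def using open_B
      by (intro borel_measurable_suminf borel_measurable_divide measurable_restrict_space1) auto
    show "compact (closure (s ` Z))"
      using s_bdd by (simp add: compact_closure)
    show "s ` Z \<subseteq> closure (s ` Z)"
      by (rule closure_subset)
  qed (use h' hg g in auto)
qed

section \<open>Weak convergence on compact metric spaces\<close>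

lemma borel_probsD:
  assumes "\<nu> \<in> borel_probs Z"
  shows "prob_space \<nu>" "sets \<nu> = sets (borel_on Z)" "space \<nu> = Z"
    and "continuous_on Z g \<Longrightarrow> g \<in> borel_measurable \<nu>"
proof -
  show 1: "prob_space \<nu>" "sets \<nu> = sets (borel_on Z)"
    using assms by (auto simp: borel_probs_def)
  show "space \<nu> = Z"
    using sets_eq_imp_space_eq[OF 1(2)] by (simp add: space_restrict_space)
  assume "continuous_on Z g"
  then show "g \<in> borel_measurable \<nu>"
    using measurable_cong_sets[OF 1(2) refl] borel_measurable_continuous_on_restrict by blast
qed

lemma continuous_on_compact_abs_bound:
  fixes g :: "'a::topological_space \<Rightarrow> real"
  assumes "compact Z" "continuous_on Z g"
  obtains B where "0 \<le> B" "\<And>z. z \<in> Z \<Longrightarrow> \<bar>g z\<bar> \<le> B"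
proof -
  have "bounded (g ` Z)"
    using assms by (intro compact_imp_bounded compact_continuous_image)
  then obtain B where "\<And>z. z \<in> Z \<Longrightarrow> \<bar>g z\<bar> \<le> B"
    by (auto simp: bounded_iff)
  then show ?thesis
    using that[of "max 0 B"] by (auto simp: max.coboundedI2)
qed

lemma integrable_continuous_on_compact:
  fixes g :: "'a::topological_space \<Rightarrow> real"
  assumes "finite_measure \<nu>" "sets \<nu> = sets (borel_on Z)" "compact Z" "continuous_on Z g"
  shows "integrable \<nu> g"
proof -
  interpret finite_measure \<nu> by fact
  obtain B where "\<And>z. z \<in> Z \<Longrightarrow> \<bar>g z\<bar> \<le> B"
    using continuous_on_compact_abs_bound[OF assms(3,4)] by metis
  moreover have "space \<nu> = Z"
    using sets_eq_imp_space_eq[OF assms(2)] by (simp add: space_restrict_space)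
  moreover have "g \<in> borel_measurable \<nu>"
    using measurable_cong_sets[OF assms(2) refl] borel_measurable_continuous_on_restrict[OF assms(4)] by blast
  ultimately show ?thesis
    by (intro integrable_const_bound[of _ B]) auto
qed

lemma integrable_borel_probs:
  fixes g :: "'a::topological_space \<Rightarrow> real"
  assumes "\<nu> \<in> borel_probs Z" "compact Z" "continuous_on Z g"
  shows "integrable \<nu> g"
  using borel_probsD[OF assms(1)] assms(2,3)
  by (intro integrable_continuous_on_compact) (auto simp: prob_space.finite_measure)

text \<open>Boundedness of \<open>K\<close> gives tightness, hence a weakly convergent subsequence;
  closedness of \<open>K\<close> keeps the limit mass inside. Functions continuous on
  \<open>K\<close> alone become admissible test functions by Tietze extension, and the indicator
  hides their values elsewhere.\<close>

lemma real_distributions_weak_compact: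
  fixes M :: "nat \<Rightarrow> real measure"
  assumes K: "compact K" and M: "\<And>n. real_distribution (M n)" "\<And>n. AE x in M n. x \<in> K"
  shows "\<exists>r N. strict_mono r \<and> real_distribution N \<and> (AE x in N. x \<in> K) \<and>
    (\<forall>g::real \<Rightarrow> real. continuous_on K g \<longrightarrow>
      (\<lambda>n. \<integral>x. indicator K x * g x \<partial>M (r n)) \<longlonglongrightarrow> (\<integral>x. indicator K x * g x \<partial>N))"
proof -
  obtain b where b: "\<And>x. x \<in> K \<Longrightarrow> \<bar>x\<bar> \<le> b" 
    using compact_imp_bounded[OF K] by (auto simp: bounded_iff)
  have K_borel [measurable]: "K \<in> sets borel"
    using K by (simp add: compact_imp_closed borel_closed)
  interpret M: real_distribution "M n" for n by fact
  have "tight M"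
    unfolding tight_def
  proof (intro conjI allI impI)
    fix \<epsilon> :: real assume "\<epsilon> > 0"
    have large: "1 - \<epsilon> < measure (M n) {- \<bar>b\<bar> - 1<..\<bar>b\<bar> + 1}" for n
    proof -
    have "AE x in M n. x \<in> {- \<bar>b\<bar> - 1<..\<bar>b\<bar> + 1}"
      using M(2)[of n] by eventually_elim (use b in \<open>force simp: abs_le_iff\<close>)
    then have "measure (M n) {- \<bar>b\<bar> - 1<..\<bar>b\<bar> + 1} = 1"
      by (subst M.prob_eq_1) auto
    with \<open>\<epsilon> > 0\<close> show ?thesis
      by simp
    qed
    show "\<exists>a b. a < b \<and> (\<forall>n. 1 - \<epsilon> < measure (M n) {a<..b})"
      by (rule exI[of _ "- \<bar>b\<bar> - 1"], rule exI[of _ "\<bar>b\<bar> + 1"]) (use large in simp)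
  qed (use M in auto)
  then obtain r N where r: "strict_mono r" and N: "real_distribution N" and wc: "weak_conv_m (M \<circ> id \<circ> r) N"
    using tight_imp_convergent_subsubsequence[of M id] by (auto simp: strict_mono_def)
  interpret N: real_distribution N by fact
  have conv: "(\<lambda>n. integral\<^sup>L (M (r n)) g) \<longlonglongrightarrow> integral\<^sup>L N g"
    if "continuous_on UNIV g" "\<And>x. \<bar>g x\<bar> \<le> B" for g :: "real \<Rightarrow> real" and B
    using weak_conv_imp_integral_bdd_continuous_conv[of "M \<circ> id \<circ> r" N g B] M(1) N wc that
    by (simp add: continuous_on_eq_continuous_at)
  have NK: "AE x in N. x \<in> K"
  proof (cases "K = {}")
    case True
    then show ?thesis using M(2)[of 0] M.AE_contr by force
  next
    case False
    \<comment> \<open>Bounded, continuous and zero exactly on \<open>K\<close>, so its integral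
      detects mass that escapes. The distance to the empty set is 0 by convention, hence the
      separate case above.\<close>
    define g where "g x = min 1 (infdist x K)" for x
    have gc: "continuous_on UNIV g"
      unfolding g_def by (intro continuous_intros)
    have gb: "0 \<le> g x" "\<bar>g x\<bar> \<le> 1" for x
      by (auto simp: g_def infdist_nonneg)
    have "integral\<^sup>L (M n) g = 0" for n
    proof -
      have "AE x in M n. g x = 0"
        using M(2)[of n] by eventually_elim (auto simp: g_def)
      then show ?thesis
        using integral_eq_zero_AE by blast
    qed
    then have "integral\<^sup>L N g = 0"
      using conv[OF gc gb(2)] by (simp add: LIMSEQ_const_iff)
    moreover have "g \<in> borel_measurable N"
      using borel_measurable_continuous_onI[OF gc] by simp
    ultimately have "AE x in N. g x = 0"
      using gb by (subst (asm) integral_nonneg_eq_0_iff_AE) (auto intro!: N.integrable_const_bound[of _ 1])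
    then show ?thesis
    proof eventually_elim
      case (elim x)
      then show ?case
        using False K in_closed_iff_infdist_zero[of K x] by (auto simp: g_def min_def compact_imp_closed split: if_splits)
    qed
  qed
  have "(\<lambda>n. \<integral>x. indicator K x * g x \<partial>M (r n)) \<longlonglongrightarrow> (\<integral>x. indicator K x * g x \<partial>N)" if g: "continuous_on K g" for g :: "real \<Rightarrow> real"
  proof -
    obtain B where B: "0 \<le> B" "\<And>x. x \<in> K \<Longrightarrow> \<bar>g x\<bar> \<le> B"
      using continuous_on_compact_abs_bound[OF K g] by metis
    have "closedin (top_of_set UNIV) K"
      using K by (simp add: compact_imp_closed)
    then obtain g' where g': "continuous_on UNIV g'" "\<And>x. x \<in> K \<Longrightarrow> g' x = g x" "\<And>x. norm (g' x) \<le> B"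
      using Tietze[OF g, of UNIV B] B by auto
    have [measurable]: "g' \<in> borel_measurable borel"
      using g'(1) by (rule borel_measurable_continuous_onI)
    have eq: "(\<integral>x. indicator K x * g x \<partial>L) = integral\<^sup>L L g'"
      if "real_distribution L" and L: "AE x in L. x \<in> K" for L
    proof -
      interpret real_distribution L by fact
      have "(\<integral>x. indicator K x * g x \<partial>L) = (\<integral>x. indicator K x * g' x \<partial>L)"
        using g'(2) by (intro Bochner_Integration.integral_cong) (auto simp: indicator_def)
      also have "\<dots> = integral\<^sup>L L g'"
        using L by (intro integral_cong_AE) auto
      finally show ?thesis .
    qed
    show ?thesis
      using conv[OF g'(1), of B] g'(3) eq[OF M] eq[OF N NK] by simp
  qed
  with r N NK show ?thesis by blast
qed

text \<open>The measures are pushed to \<open>K\<close> by \<open>s\<close> and the limit is brought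
  back by \<open>h\<close>. A test function \<open>g\<close> becomes \<open>g (h x)\<close>, which
  is continuous on \<open>K\<close> although \<open>s\<close> is merely measurable, and
  \<open>h (s z) = z\<close> returns the original integrals.\<close>

lemma borel_probs_weak_compact:
  fixes \<nu> :: "nat \<Rightarrow> 'a::metric_space measure"
  assumes Z: "compact Z" and \<nu>: "\<And>n. \<nu> n \<in> borel_probs Z"
  shows "\<exists>r \<rho>. strict_mono r \<and> \<rho> \<in> borel_probs Z \<and>
    (\<forall>g::'a \<Rightarrow> real. continuous_on Z g \<longrightarrow> (\<lambda>n. integral\<^sup>L (\<nu> (r n)) g) \<longlonglongrightarrow> integral\<^sup>L \<rho> g)"
proof -
  obtain K :: "real set" and s h where K: "compact K" and s: "s \<in> borel_measurable (borel_on Z)" "s ` Z \<subseteq> K"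
    and h: "continuous_on K h" "h ` K \<subseteq> Z" "\<forall>z\<in>Z. h (s z) = z"
    using compact_coded_by_reals[OF Z] by blast
  have K_borel [measurable]: "K \<in> sets borel"
    using K by (simp add: compact_imp_closed borel_closed)
  have s' [measurable]: "s \<in> borel_measurable (\<nu> n)" for n
    using s(1) measurable_cong_sets[OF borel_probsD(2)[OF \<nu>] refl] by blast
  define M where "M n = distr (\<nu> n) borel s" for n
  have "real_distribution (M n)" for n
  proof -
    interpret prob_space "\<nu> n" using \<nu> borel_probsD by blast
    show ?thesis
      unfolding M_def real_distribution_def real_distribution_axioms_def
      by (auto intro!: prob_space_distr)
  qed
  moreover have "AE x in M n. x \<in> K" for n
    unfolding M_def using borel_probsD(3)[OF \<nu>] s(2) by (subst AE_distr_iff) (auto intro!: AE_I2)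
  ultimately obtain r N where r: "strict_mono r" and N: "real_distribution N" "AE x in N. x \<in> K"
    and conv: "\<And>g::real \<Rightarrow> real. continuous_on K g \<Longrightarrow>
      (\<lambda>n. \<integral>x. indicator K x * g x \<partial>M (r n)) \<longlonglongrightarrow> (\<integral>x. indicator K x * g x \<partial>N)"
    using real_distributions_weak_compact[OF K, of M] by metis
  interpret N: real_distribution N by fact
  have hm: "h \<in> measurable (restrict_space N K) (borel_on Z)"
  proof (rule measurable_restrict_space2)
    show "h \<in> space (restrict_space N K) \<rightarrow> Z"
      using h(2) by (auto simp: space_restrict_space)
    have "h \<in> borel_measurable (borel_on K)"
      by (rule borel_measurable_continuous_on_restrict[OF h(1)])
    then show "h \<in> borel_measurable (restrict_space N K)"
      by (simp add: measurable_cong_sets[OF sets_restrict_space_cong[OF N.events_eq_borel] refl])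
  qed
  define \<rho> where "\<rho> = distr (restrict_space N K) (borel_on Z) h"
  have \<rho>: "\<rho> \<in> borel_probs Z"
  proof -
    have "prob_space (restrict_space N K)"
      using N(2) by (intro prob_space_restrict_space) (auto simp: N.emeasure_eq_1_AE)
    then show ?thesis
      unfolding \<rho>_def borel_probs_def using prob_space.prob_space_distr[OF _ hm] by auto
  qed
  have "(\<lambda>n. integral\<^sup>L (\<nu> (r n)) g) \<longlonglongrightarrow> integral\<^sup>L \<rho> g" if g: "continuous_on Z g" for g :: "'a \<Rightarrow> real"
  proof -
    have gh: "continuous_on K (\<lambda>x. g (h x))"
      by (rule continuous_on_compose2[OF g h(1,2)])
    have [measurable]: "(\<lambda>x. indicator K x * g (h x)) \<in> borel_measurable borel"
      using borel_measurable_continuous_on_indicator[OF K_borel gh] by simp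
    have "(\<integral>x. indicator K x * g (h x) \<partial>M n) = (\<integral>z. indicator K (s z) * g (h (s z)) \<partial>\<nu> n)" for n
      unfolding M_def by (subst integral_distr) auto
    also have "\<dots> n = integral\<^sup>L (\<nu> n) g" for n
      using borel_probsD(3)[OF \<nu>] s(2) h(3)
      by (intro Bochner_Integration.integral_cong) (auto simp: indicator_def)
    finally have "(\<integral>x. indicator K x * g (h x) \<partial>M n) = integral\<^sup>L (\<nu> n) g" for n .
    moreover have "(\<integral>x. indicator K x * g (h x) \<partial>N) = integral\<^sup>L \<rho> g"
      unfolding \<rho>_def using hm g
      by (subst integral_distr) (auto simp: integral_restrict_space borel_measurable_continuous_on_restrict)
    ultimately show ?thesis
      using conv[OF gh] by simp
  qed
  with r \<rho> show ?thesis by blast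
qed

text \<open>The index \<open>b\<close> is there because one \<open>g\<close> has to serve two measures at once.\<close>

lemma continuous_approx_indicator:
  fixes L :: "bool \<Rightarrow> 'a::metric_space measure"
  assumes L: "\<And>b. finite_measure (L b)" "\<And>b. sets (L b) = sets (borel_on Z)" and Z: "compact Z"
    and "A \<in> sets (borel_on Z)" "e > 0"
  shows "\<exists>g::'a \<Rightarrow> real. continuous_on Z g \<and> (\<forall>x. 0 \<le> g x) \<and> (\<forall>b. (\<integral>x. \<bar>g x - indicator A x\<bar> \<partial>L b) < e)"
proof -
  interpret finite_measure "L b" for b by fact
  have space: "space (L b) = Z" for b
    using sets_eq_imp_space_eq[OF L(2)] by (simp add: space_restrict_space)
  define G where "G = {A. closed A \<and> A \<subseteq> Z}"
  have "closed Z" using Z by (rule compact_imp_closed)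
  have sets_eq: "sets (borel_on Z) = sigma_sets Z G"
  proof -
    have "sets (borel :: 'a measure) = sigma_sets UNIV {S. closed S}"
      by (simp add: borel_eq_closed)
    then have "sets (borel_on Z) = sigma_sets Z ((\<inter>) Z ` {S. closed S})"
      unfolding sets_restrict_space by (subst restricted_sigma[symmetric]) (auto intro: sigma_sets.Basic \<open>closed Z\<close>)
    also have "(\<inter>) Z ` {S. closed S} = G"
      using \<open>closed Z\<close> by (auto simp: G_def image_iff)
    finally show ?thesis .
  qed
  have int: "integrable (L b) g" if "continuous_on Z g" for g :: "'a \<Rightarrow> real" and b
    by (rule integrable_continuous_on_compact[OF L Z that])
  have ind: "integrable (L b) (indicat_real A)" if "A \<in> sigma_sets Z G" for A b
    using that sets_eq L(2) by (auto simp: integrable_indicator_iff less_top[symmetric])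
  \<comment> \<open>Dynkin's lemma: closed subsets form an intersection-stable generator, and
    approximability passes to complements and countable disjoint unions.\<close>
  let ?P = "\<lambda>A. \<forall>e>0. \<exists>g::'a \<Rightarrow> real. continuous_on Z g \<and> (\<forall>x. 0 \<le> g x) \<and> (\<forall>b. (\<integral>x. \<bar>g x - indicator A x\<bar> \<partial>L b) < e)"
  have "Int_stable G" "G \<subseteq> Pow Z" "A \<in> sigma_sets Z G"
    using assms(4) sets_eq by (auto simp: Int_stable_def G_def)
  then have "?P A"
  proof (induction rule: sigma_sets_induct_disjoint)
    case (basic A)
    then have A: "closed A" "A \<subseteq> Z" by (auto simp: G_def)
    show ?case
    proof (cases "A = {}")
      case True
      then show ?thesis by (intro allI impI exI[of _ "\<lambda>_. 0"]) auto
    next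
      case False
      define g where "g n x = max 0 (1 - real n * infdist x A)" for n x
      have gc: "continuous_on Z (g n)" for n
        unfolding g_def by (intro continuous_intros)
      have lim: "(\<lambda>n. \<integral>x. \<bar>g n x - indicator A x\<bar> \<partial>L b) \<longlonglongrightarrow> (\<integral>x. 0 \<partial>L b)" for b
      proof (rule integral_dominated_convergence[where w = "\<lambda>_. 2"])
        show "AE x in L b. (\<lambda>n. \<bar>g n x - indicator A x\<bar>) \<longlonglongrightarrow> 0"
        proof (rule AE_I2)
          fix x
          have "eventually (\<lambda>n. \<bar>g n x - indicator A x\<bar> = 0) sequentially"
          proof (cases "x \<in> A")
            case True
            then show ?thesis by (simp add: g_def)
          next
            case False
            then have "infdist x A > 0"
              using A \<open>A \<noteq> {}\<close> in_closed_iff_infdist_zero infdist_nonneg[of x A] by fastforce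
            then obtain N where N: "1 < real N * infdist x A"
              using reals_Archimedean3 by blast
            have "1 \<le> real n * infdist x A" if "n \<ge> N" for n
              using N mult_right_mono[of "real N" "real n" "infdist x A"] that infdist_nonneg[of x A] by simp
            then show ?thesis
              using False by (auto simp: g_def eventually_sequentially intro!: exI[of _ N])
          qed
          then show "(\<lambda>n. \<bar>g n x - indicator A x\<bar>) \<longlonglongrightarrow> 0"
            by (rule tendsto_eventually)
        qed
        show "(\<lambda>x. \<bar>g n x - indicator A x\<bar>) \<in> borel_measurable (L b)" for n
          using borel_measurable_integrable[OF int[OF gc]] borel_measurable_integrable[OF ind] basic by auto
        show "AE x in L b. norm \<bar>g n x - indicator A x\<bar> \<le> 2" for n
        proof (rule AE_I2)
          fix x
          have "0 \<le> real n * infdist x A" by (simp add: infdist_nonneg)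
          then show "norm \<bar>g n x - indicator A x\<bar> \<le> 2"
            by (auto simp: g_def indicator_def)
        qed
      qed auto
      show ?thesis
      proof (intro allI impI)
        fix e :: real assume "e > 0"
        then have "eventually (\<lambda>n. \<forall>b. (\<integral>x. \<bar>g n x - indicator A x\<bar> \<partial>L b) < e) sequentially"
          using order_tendstoD(2)[OF lim, where a = e] by (intro eventually_all_finite) auto
        then obtain n where "\<forall>b. (\<integral>x. \<bar>g n x - indicator A x\<bar> \<partial>L b) < e"
          by (auto simp: eventually_sequentially)
        then show "\<exists>g::'a \<Rightarrow> real. continuous_on Z g \<and> (\<forall>x. 0 \<le> g x) \<and> (\<forall>b. (\<integral>x. \<bar>g x - indicator A x\<bar> \<partial>L b) < e)"
          using gc[of n] by (intro exI[of _ "g n"]) (auto simp: g_def)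
      qed
    qed
  next
    case empty
    then show ?case by (intro allI impI exI[of _ "\<lambda>_. 0"]) auto
  next
    case (compl A)
    show ?case
    proof (intro allI impI)
      fix e :: real assume "e > 0"
      then obtain g :: "'a \<Rightarrow> real" where g: "continuous_on Z g" "\<And>b. (\<integral>x. \<bar>g x - indicator A x\<bar> \<partial>L b) < e"
        using compl by blast
      \<comment> \<open>\<open>1 - g\<close> may be negative. Its absolute value is not, and it is
        no farther from an indicator, whose values are nonnegative.\<close>
      have gc: "continuous_on Z (\<lambda>x. \<bar>1 - g x\<bar>)"
        by (intro continuous_intros g)
      have "(\<integral>x. \<bar>\<bar>1 - g x\<bar> - indicator (Z - A) x\<bar> \<partial>L b) \<le> (\<integral>x. \<bar>g x - indicator A x\<bar> \<partial>L b)" for b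
      proof (rule integral_mono)
        show "integrable (L b) (\<lambda>x. \<bar>g x - indicator A x\<bar>)" "integrable (L b) (\<lambda>x. \<bar>\<bar>1 - g x\<bar> - indicator (Z - A) x\<bar>)"
          using int[OF g(1)] int[OF gc] ind[OF compl(1)] ind[OF sigma_sets.Compl[OF compl(1)]]
          by (auto intro!: Bochner_Integration.integrable_diff integrable_abs)
      qed (auto simp: space indicator_def)
      then show "\<exists>g::'a \<Rightarrow> real. continuous_on Z g \<and> (\<forall>x. 0 \<le> g x) \<and> (\<forall>b. (\<integral>x. \<bar>g x - indicator (Z - A) x\<bar> \<partial>L b) < e)"
        using g gc by (intro exI[of _ "\<lambda>x. \<bar>1 - g x\<bar>"]) (auto intro: le_less_trans)
    qed
  next
    case (union A)
    have Am: "A i \<in> sets (L b)" "A i \<in> sigma_sets Z G" for i b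
      using union sets_eq L(2) by auto
    have Um: "(\<Union>i. A i) \<in> sigma_sets Z G" using Am by (auto intro: sigma_sets.Union)
    have sums: "(\<lambda>i. measure (L b) (A i)) sums measure (L b) (\<Union>i. A i)" for b
      using Am union(1) by (intro finite_measure_UNION) auto
    show ?case
    proof (intro allI impI)
      fix e :: real assume "e > 0"
      have "eventually (\<lambda>N. \<forall>b. measure (L b) (\<Union>i. A i) - e / 2 < (\<Sum>i<N. measure (L b) (A i))) sequentially"
        using sums[unfolded sums_def] \<open>e > 0\<close> by (intro eventually_all_finite order_tendstoD(1)) auto
      then obtain N where N: "\<And>b. measure (L b) (\<Union>i. A i) - e / 2 < (\<Sum>i<N. measure (L b) (A i))"
        by (auto simp: eventually_sequentially)
      \<comment> \<open>Half of \<open>e\<close> pays for the union beyond the first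
        \<open>N\<close> sets, in both measures; the other half is shared by the \<open>N\<close>
        approximations. \<open>Suc N\<close> also covers \<open>N = 0\<close>.\<close>
      have "e / (2 * Suc N) > 0" using \<open>e > 0\<close> by simp
      then have "\<exists>g::'a \<Rightarrow> real. continuous_on Z g \<and> (\<forall>x. 0 \<le> g x) \<and>
          (\<forall>b. (\<integral>x. \<bar>g x - indicator (A i) x\<bar> \<partial>L b) < e / (2 * Suc N))" for i
        using union(3) by blast
      then obtain g :: "nat \<Rightarrow> 'a \<Rightarrow> real" where g: "\<And>i. continuous_on Z (g i)" "\<And>i x. 0 \<le> g i x"
        "\<And>i b. (\<integral>x. \<bar>g i x - indicator (A i) x\<bar> \<partial>L b) < e / (2 * Suc N)"
        by metis
      have inti: "integrable (L b) (\<lambda>x. \<bar>g i x - indicator (A i) x\<bar>)" for i b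
        using int[OF g(1)] ind[OF Am(2)] by (intro integrable_abs Bochner_Integration.integrable_diff) auto
      have gc: "continuous_on Z (\<lambda>x. \<Sum>i<N. g i x)"
        by (intro continuous_intros g)
      have pointwise: "\<bar>(\<Sum>i<N. g i x) - indicator (\<Union>i. A i) x\<bar> \<le>
        (\<Sum>i<N. \<bar>g i x - indicator (A i) x\<bar>) + (indicator (\<Union>i. A i) x - (\<Sum>i<N. indicator (A i) x))" for x
      proof -
        have "(\<Sum>i<N. indicat_real (A i) x) = indicator (\<Union>i<N. A i) x"
          using union(1) by (subst indicator_UN_disjoint) (auto simp: disjoint_family_on_def)
        also have "\<dots> \<le> indicator (\<Union>i. A i) x"
          by (auto simp: indicator_def)
        finally have "(\<Sum>i<N. indicat_real (A i) x) \<le> indicator (\<Union>i. A i) x" .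
        moreover have "\<bar>(\<Sum>i<N. g i x) - (\<Sum>i<N. indicat_real (A i) x)\<bar> \<le> (\<Sum>i<N. \<bar>g i x - indicator (A i) x\<bar>)"
          unfolding sum_subtractf[symmetric] by (rule sum_abs)
        ultimately show ?thesis by linarith
      qed
      have "(\<integral>x. \<bar>(\<Sum>i<N. g i x) - indicator (\<Union>i. A i) x\<bar> \<partial>L b) < e" for b
      proof -
        have "(\<integral>x. \<bar>(\<Sum>i<N. g i x) - indicator (\<Union>i. A i) x\<bar> \<partial>L b) \<le>
          (\<integral>x. (\<Sum>i<N. \<bar>g i x - indicator (A i) x\<bar>) + (indicator (\<Union>i. A i) x - (\<Sum>i<N. indicator (A i) x)) \<partial>L b)"
          using pointwise int[OF g(1)] ind[OF Um] inti ind[OF Am(2)]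
          by (intro integral_mono integrable_abs Bochner_Integration.integrable_diff Bochner_Integration.integrable_add
              Bochner_Integration.integrable_sum) auto
        also have "\<dots> = (\<Sum>i<N. \<integral>x. \<bar>g i x - indicator (A i) x\<bar> \<partial>L b) + (measure (L b) (\<Union>i. A i) - (\<Sum>i<N. measure (L b) (A i)))"
          using inti ind[OF Am(2)] ind[OF Um] Am
          by (simp add: Bochner_Integration.integral_sum)
        also have "\<dots> < (\<Sum>i<N. e / (2 * Suc N)) + e / 2"
          using N[of b] sum_mono[of "{..<N}" "\<lambda>i. \<integral>x. \<bar>g i x - indicator (A i) x\<bar> \<partial>L b" "\<lambda>_. e / (2 * Suc N)"] g(3)
          by (smt (verit) less_imp_le)
        also have "\<dots> \<le> e"
          using \<open>e > 0\<close> by (simp add: field_simps)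
        finally show ?thesis .
      qed
      then show "\<exists>g::'a \<Rightarrow> real. continuous_on Z g \<and> (\<forall>x. 0 \<le> g x) \<and>
          (\<forall>b. (\<integral>x. \<bar>g x - indicator (\<Union>i. A i) x\<bar> \<partial>L b) < e)"
        using gc g(2) by (intro exI[of _ "\<lambda>x. \<Sum>i<N. g i x"]) (auto intro: sum_nonneg)
    qed
  qed
  then show ?thesis using \<open>e > 0\<close> by blast
qed

text \<open>A single continuous function close to the indicator of \<open>A\<close> in the L1 norms
  of both measures transfers the inequality, each measure contributing an error
  \<open>e / 2\<close>.\<close>

lemma emeasure_le_if_integral_le:
  fixes L M :: "'a::metric_space measure"
  assumes L: "finite_measure L" "sets L = sets (borel_on Z)"
    and M: "finite_measure M" "sets M = sets (borel_on Z)" and Z: "compact Z"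
    and le: "\<And>g::'a \<Rightarrow> real. continuous_on Z g \<Longrightarrow> (\<And>x. 0 \<le> g x) \<Longrightarrow> integral\<^sup>L L g \<le> integral\<^sup>L M g"
    and A: "A \<in> sets L"
  shows "emeasure L A \<le> emeasure M A"
proof -
  interpret L: finite_measure L by fact
  interpret M: finite_measure M by fact
  have A': "A \<in> sets M" "A \<in> sets (borel_on Z)" using A L(2) M(2) by auto
  have "measure L A \<le> measure M A"
  proof (rule field_le_epsilon)
    fix e :: real assume "e > 0"
    define Q where "Q b = (if b then L else M)" for b
    have "\<exists>g::'a \<Rightarrow> real. continuous_on Z g \<and> (\<forall>x. 0 \<le> g x) \<and> (\<forall>b. (\<integral>x. \<bar>g x - indicator A x\<bar> \<partial>Q b) < e / 2)"
      using L M Z A' \<open>e > 0\<close> by (intro continuous_approx_indicator) (auto simp: Q_def)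
    then obtain g :: "'a \<Rightarrow> real" where g: "continuous_on Z g" "\<And>x. 0 \<le> g x"
      and Q: "\<And>b. (\<integral>x. \<bar>g x - indicator A x\<bar> \<partial>Q b) < e / 2"
      by blast
    have intL: "integrable L g" "integrable L (indicat_real A)"
      using integrable_continuous_on_compact[OF L Z g(1)] A
      by (auto simp: integrable_indicator_iff less_top[symmetric])
    have intM: "integrable M g" "integrable M (indicat_real A)"
      using integrable_continuous_on_compact[OF M Z g(1)] A'
      by (auto simp: integrable_indicator_iff less_top[symmetric])
    have "measure L A - integral\<^sup>L L g = (\<integral>x. indicator A x - g x \<partial>L)"
      using intL A by simp
    also have "\<dots> \<le> (\<integral>x. \<bar>g x - indicator A x\<bar> \<partial>L)"
      using intL by (intro integral_mono) auto
    finally have 1: "measure L A - integral\<^sup>L L g < e / 2"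
      using Q[of True] by (simp add: Q_def)
    have "integral\<^sup>L M g - measure M A = (\<integral>x. g x - indicator A x \<partial>M)"
      using intM A' by simp
    also have "\<dots> \<le> (\<integral>x. \<bar>g x - indicator A x\<bar> \<partial>M)"
      using intM by (intro integral_mono) auto
    finally have 2: "integral\<^sup>L M g - measure M A < e / 2"
      using Q[of False] by (simp add: Q_def)
    show "measure L A \<le> measure M A + e"
      using 1 2 le[OF g] by linarith
  qed
  then show ?thesis
    by (simp add: L.emeasure_eq_measure M.emeasure_eq_measure)
qed

lemma borel_probs_eqI:
  fixes L M :: "'a::metric_space measure"
  assumes L: "L \<in> borel_probs Z" and M: "M \<in> borel_probs Z" and Z: "compact Z"
    and eq: "\<And>g::'a \<Rightarrow> real. continuous_on Z g \<Longrightarrow> integral\<^sup>L L g = integral\<^sup>L M g"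
  shows "L = M"
proof (rule measure_eqI)
  note L' = borel_probsD[OF L] and M' = borel_probsD[OF M]
  note fin = L'(1)[THEN prob_space.finite_measure] M'(1)[THEN prob_space.finite_measure]
  show "sets L = sets M" using L' M' by simp
  fix A assume "A \<in> sets L"
  then show "emeasure L A = emeasure M A"
    using emeasure_le_if_integral_le[OF fin(1) L'(2) fin(2) M'(2) Z]
      emeasure_le_if_integral_le[OF fin(2) M'(2) fin(1) L'(2) Z] eq L' M'
    by (intro antisym) auto
qed

text \<open>The proof works with convergence of integrals along sequences, while continuity of
  \<open>I\<close> is stated for topologies. This lemma translates on the side of the measures,
  \<open>sup_norm_limit_uniform\<close> on the side of the functions.\<close>

lemma weak_star_limit:
  assumes \<nu>: "\<And>n::nat. \<nu> n \<in> borel_probs Z" and \<rho>: "\<rho> \<in> borel_probs Z"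
    and conv: "\<And>g::_ \<Rightarrow> real. continuous_on Z g \<Longrightarrow> (\<lambda>n. integral\<^sup>L (\<nu> n) g) \<longlonglongrightarrow> integral\<^sup>L \<rho> g"
  shows "limitin (weak_star Z) \<nu> \<rho> sequentially"
proof -
  let ?F = "\<lambda>\<nu>. \<lambda>g\<in>{g::_ \<Rightarrow> real. continuous_on Z g}. integral\<^sup>L \<nu> g"
  let ?T = "product_topology (\<lambda>_. euclideanreal) {g::_ \<Rightarrow> real. continuous_on Z g}"
  have lim: "limitin ?T (\<lambda>n. ?F (\<nu> n)) (?F \<rho>) sequentially"
    unfolding limitin_componentwise using conv by (auto simp: PiE_iff)
  show ?thesis
    unfolding limitin_def
  proof (intro conjI allI impI)
    show "\<rho> \<in> topspace (weak_star Z)"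
      unfolding weak_star_def topspace_pullback_topology using \<rho> by (auto simp: PiE_iff)
    fix U assume "openin (weak_star Z) U \<and> \<rho> \<in> U"
    then obtain V where V: "openin ?T V" "U = ?F -` V \<inter> borel_probs Z" "?F \<rho> \<in> V"
      unfolding weak_star_def openin_pullback_topology by auto
    then have "eventually (\<lambda>n. ?F (\<nu> n) \<in> V) sequentially"
      using lim unfolding limitin_def by blast
    then show "eventually (\<lambda>n. \<nu> n \<in> U) sequentially"
      by eventually_elim (use V \<nu> in auto)
  qed
qed

lemma sup_norm_limit_uniform:
  assumes "limitin (sup_norm_topology Z) F l sequentially"
  shows "uniform_limit Z F l sequentially"
proof (cases "Z = {}")
  case False
  let ?m = "cfunspace (top_of_set Z) (euclidean_metric :: real metric)"
  have lim: "l \<in> mspace ?m" "\<And>e. e > 0 \<Longrightarrow> eventually (\<lambda>n. F n \<in> mspace ?m \<and> mdist ?m (F n) l < e) sequentially"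
    using assms unfolding sup_norm_topology_def mtopology_of_def
      Metric_space.limitin_metric[OF Metric_space_mspace_mdist] by blast+
  show ?thesis
    unfolding uniform_limit_iff
  proof (intro allI impI)
    fix e :: real assume "e > 0"
    from lim(2)[OF this] show "eventually (\<lambda>n. \<forall>x\<in>Z. dist (F n x) (l x) < e) sequentially"
    proof eventually_elim
      case (elim n)
      then have "mdist (euclidean_metric :: real metric) (F n x) (l x) \<le> mdist ?m (F n) l" if "x \<in> Z" for x
        using that lim(1) mdist_cfunspace_imp_mdist_le[of "F n" "top_of_set Z" euclidean_metric l "mdist ?m (F n) l" x]
        by simp
      then show ?case using elim by (auto intro: le_less_trans)
    qed
  qed
qed simp

section \<open>The Poincare--Miranda theorem and partitions of unity\<close>

lemma bounded_coordinates_subseq: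
  fixes u :: "nat \<Rightarrow> nat \<Rightarrow> real"
  assumes "\<And>k j. j < n \<Longrightarrow> u k j \<in> {a j..b j}"
  shows "\<exists>r x. strict_mono r \<and> (\<forall>j<n. (\<lambda>k. u (r k) j) \<longlonglongrightarrow> x j)"
  using assms
proof (induction n)
  case 0
  show ?case by (intro exI[of _ id]) (auto simp: strict_mono_def)
next
  case (Suc n)
  then obtain r x where r: "strict_mono r" "\<And>j. j < n \<Longrightarrow> (\<lambda>k. u (r k) j) \<longlonglongrightarrow> x j"
    by fastforce
  have "seq_compact {a n..b n}"
    using compact_imp_seq_compact compact_Icc by blast
  then obtain l s where s: "strict_mono s" "((\<lambda>k. u (r k) n) \<circ> s) \<longlonglongrightarrow> l"
    using Suc.prems[of n] unfolding seq_compact_def by (metis lessI)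
  have "(\<lambda>k. u (r (s k)) j) \<longlonglongrightarrow> (x(n := l)) j" if "j < Suc n" for j
    using that s(2) LIMSEQ_subseq_LIMSEQ[OF r(2) s(1), of j] by (auto simp: less_Suc_eq o_def)
  then show ?case
    using strict_mono_o[OF r(1) s(1)] by (intro exI[of _ "r \<circ> s"] exI[of _ "x(n := l)"]) (simp add: o_def)
qed

text \<open>The box lives in the first \<open>n\<close> coordinates of a sequence, so that the dimension can vary inside
  a proof.\<close>

lemma poincare_miranda:
  fixes G :: "nat \<Rightarrow> (nat \<Rightarrow> real) \<Rightarrow> real" and a b :: "nat \<Rightarrow> real" and n :: nat
  defines "Q \<equiv> {x. \<forall>j<n. x j \<in> {a j..b j}}"
  assumes ab: "\<And>i. i < n \<Longrightarrow> a i \<le> b i"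
    and cont: "\<And>i u x. i < n \<Longrightarrow> (\<And>k. u k \<in> Q) \<Longrightarrow> x \<in> Q \<Longrightarrow>
      (\<And>j. j < n \<Longrightarrow> (\<lambda>k. u k j) \<longlonglongrightarrow> x j) \<Longrightarrow> (\<lambda>k. G i (u k)) \<longlonglongrightarrow> G i x"
    and low: "\<And>i x. i < n \<Longrightarrow> x \<in> Q \<Longrightarrow> x i = a i \<Longrightarrow> G i x \<le> 0"
    and up: "\<And>i x. i < n \<Longrightarrow> x \<in> Q \<Longrightarrow> x i = b i \<Longrightarrow> G i x \<ge> 0"
  shows "\<exists>x\<in>Q. \<forall>i<n. G i x = 0"
proof -
  define E where "E p q i = a i + (b i - a i) * (real (q i) / real p)" for p :: nat and q :: "nat \<Rightarrow> nat" and i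
  have EQ: "E p q \<in> Q" if "p > 0" "\<forall>i<n. q i \<le> p" for p q
  proof -
    have "0 \<le> real (q j) / real p \<and> real (q j) / real p \<le> 1" if "j < n" for j
      using that \<open>p > 0\<close> \<open>\<forall>i<n. q i \<le> p\<close> by auto
    then have "0 \<le> (b j - a j) * (real (q j) / real p) \<and> (b j - a j) * (real (q j) / real p) \<le> (b j - a j) * 1" if "j < n" for j
      using that ab[of j] by (intro conjI mult_left_mono mult_nonneg_nonneg) auto
    then show ?thesis
      unfolding Q_def E_def by fastforce
  qed
  have "\<exists>q. (\<forall>i<n. q i < Suc p) \<and> (\<forall>i<n. \<exists>r s. (\<forall>j<n. q j \<le> r j \<and> r j \<le> q j + 1) \<and>
      (\<forall>j<n. q j \<le> s j \<and> s j \<le> q j + 1) \<and> G i (E (Suc p) r) \<le> 0 \<and> 0 \<le> G i (E (Suc p) s))" for p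
  proof -
    \<comment> \<open>Kuhn's lemma wants label 0 on the lower faces and 1 on the upper ones. The
      sign hypotheses make these forced labels agree with the sign of \<open>G i\<close>, so a cell
      showing both labels in coordinate \<open>i\<close> has vertices with
      \<open>G i \<le> 0\<close> and with \<open>G i \<ge> 0\<close>.\<close>
    define lab where "lab q i = (if q i = 0 then 0 else if q i = Suc p then 1
      else if G i (E (Suc p) q) \<le> 0 then 0 else (1::nat))" for q :: "nat \<Rightarrow> nat" and i
    obtain q where q: "\<forall>i<n. q i < Suc p"
      "\<forall>i<n. \<exists>r s. (\<forall>j<n. q j \<le> r j \<and> r j \<le> q j + 1) \<and> (\<forall>j<n. q j \<le> s j \<and> s j \<le> q j + 1) \<and> lab r i \<noteq> lab s i"
      by (rule kuhn_lemma[of "Suc p" n lab]) (auto simp: lab_def)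
    have lab0: "G i (E (Suc p) r) \<le> 0" if "lab r i = 0" "i < n" "\<forall>j<n. r j \<le> Suc p" for r i
      using that low[OF \<open>i < n\<close> EQ[of "Suc p" r]] by (auto simp: lab_def E_def split: if_splits)
    have lab1: "G i (E (Suc p) r) \<ge> 0" if "lab r i \<noteq> 0" "i < n" "\<forall>j<n. r j \<le> Suc p" for r i
      using that up[OF \<open>i < n\<close> EQ[of "Suc p" r]] by (auto simp: lab_def E_def split: if_splits)
    show ?thesis
    proof (rule exI[of _ q], intro conjI allI impI)
      fix i assume "i < n"
      then obtain r s where rs: "\<forall>j<n. q j \<le> r j \<and> r j \<le> q j + 1" "\<forall>j<n. q j \<le> s j \<and> s j \<le> q j + 1"
        "lab r i \<noteq> lab s i"
        using q(2) by blast
      have le: "\<forall>j<n. r j \<le> Suc p" "\<forall>j<n. s j \<le> Suc p"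
        using rs q(1) by fastforce+
      have lab01: "lab t i = 0 \<or> lab t i = 1" for t
        by (simp add: lab_def)
      show "\<exists>r s. (\<forall>j<n. q j \<le> r j \<and> r j \<le> q j + 1) \<and> (\<forall>j<n. q j \<le> s j \<and> s j \<le> q j + 1) \<and>
        G i (E (Suc p) r) \<le> 0 \<and> 0 \<le> G i (E (Suc p) s)"
      proof (cases "lab r i = 0")
        case True
        then show ?thesis
          using rs le lab0[of r i] lab1[of s i] \<open>i < n\<close> by (intro exI[of _ r] exI[of _ s]) auto
      next
        case False
        then have "lab s i = 0" using lab01[of r] lab01[of s] rs(3) by auto
        with False show ?thesis
          using rs le lab0[of s i] lab1[of r i] \<open>i < n\<close> by (intro exI[of _ s] exI[of _ r]) auto
      qed
    qed (use q in auto)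
  qed
  then obtain q where q: "\<And>p i. i < n \<Longrightarrow> q p i < Suc p"
    and ex: "\<And>p i. i < n \<Longrightarrow> \<exists>r s. (\<forall>j<n. q p j \<le> r j \<and> r j \<le> q p j + 1) \<and>
      (\<forall>j<n. q p j \<le> s j \<and> s j \<le> q p j + 1) \<and> G i (E (Suc p) r) \<le> 0 \<and> 0 \<le> G i (E (Suc p) s)"
    by metis
  define R where "R p i r s \<longleftrightarrow> (\<forall>j<n. q p j \<le> r j \<and> r j \<le> q p j + 1) \<and>
      (\<forall>j<n. q p j \<le> s j \<and> s j \<le> q p j + 1) \<and> G i (E (Suc p) r) \<le> 0 \<and> 0 \<le> G i (E (Suc p) s)" for p i r s
  have "\<forall>p i. \<exists>r s. i < n \<longrightarrow> R p i r s"
    using ex unfolding R_def by blast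
  then obtain r s where rs: "\<And>p i. i < n \<Longrightarrow> R p i (r p i) (s p i)"
    by metis
  then have
    r: "\<And>p i j. i < n \<Longrightarrow> j < n \<Longrightarrow> q p j \<le> r p i j \<and> r p i j \<le> q p j + 1"
      "\<And>p i. i < n \<Longrightarrow> G i (E (Suc p) (r p i)) \<le> 0" and
    s: "\<And>p i j. i < n \<Longrightarrow> j < n \<Longrightarrow> q p j \<le> s p i j \<and> s p i j \<le> q p j + 1"
      "\<And>p i. i < n \<Longrightarrow> 0 \<le> G i (E (Suc p) (s p i))"
    unfolding R_def by blast+
  have "E (Suc p) (q p) \<in> Q" for p
    using q by (intro EQ) (auto intro: less_imp_le)
  then have "\<exists>h x. strict_mono h \<and> (\<forall>j<n. (\<lambda>k. E (Suc (h k)) (q (h k)) j) \<longlonglongrightarrow> x j)"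
    by (intro bounded_coordinates_subseq[of n _ a b]) (auto simp: Q_def)
  then obtain h x where h: "strict_mono h" and x: "\<And>j. j < n \<Longrightarrow> (\<lambda>k. E (Suc (h k)) (q (h k)) j) \<longlonglongrightarrow> x j"
    by blast
  \<comment> \<open>All vertices of the chosen cell are within one grid step of its corner
    \<open>q p\<close>, so every selection of vertices has the same limit. Continuity then puts both
    signs on \<open>G i x\<close>.\<close>
  have near: "(\<lambda>k. E (Suc (h k)) (t (h k)) j) \<longlonglongrightarrow> x j"
    if t: "\<And>p. q p j \<le> t p j \<and> t p j \<le> q p j + 1" and "j < n" for t j
  proof -
    have inv: "(\<lambda>k. (b j - a j) * inverse (real (Suc (h k)))) \<longlonglongrightarrow> (b j - a j) * 0"
      using LIMSEQ_subseq_LIMSEQ[OF LIMSEQ_inverse_real_of_nat h] by (intro tendsto_mult tendsto_const) (simp add: o_def)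
    have lo: "E (Suc p) (q p) j \<le> E (Suc p) (t p) j" for p
      unfolding E_def using t[of p] ab[OF \<open>j < n\<close>]
      by (intro add_left_mono mult_left_mono divide_right_mono) auto
    have hi: "E (Suc p) (t p) j \<le> E (Suc p) (q p) j + (b j - a j) * inverse (real (Suc p))" for p
    proof -
      have "real (t p j) / real (Suc p) \<le> real (q p j) / real (Suc p) + inverse (real (Suc p))"
        using mult_right_mono[of "real (t p j)" "real (q p j) + 1" "inverse (real (Suc p))"] t[of p]
        by (simp add: divide_inverse distrib_right)
      then have "(b j - a j) * (real (t p j) / real (Suc p)) \<le> (b j - a j) * (real (q p j) / real (Suc p) + inverse (real (Suc p)))"
        using ab[OF \<open>j < n\<close>] by (intro mult_left_mono) auto
      then show ?thesis
        unfolding E_def by (simp add: algebra_simps)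
    qed
    show ?thesis
    proof (rule real_tendsto_sandwich)
      show "\<forall>\<^sub>F k in sequentially. E (Suc (h k)) (q (h k)) j \<le> E (Suc (h k)) (t (h k)) j"
        by (rule always_eventually) (use lo in blast)
      show "\<forall>\<^sub>F k in sequentially. E (Suc (h k)) (t (h k)) j \<le>
          E (Suc (h k)) (q (h k)) j + (b j - a j) * inverse (real (Suc (h k)))"
        by (rule always_eventually) (use hi in blast)
      show "(\<lambda>k. E (Suc (h k)) (q (h k)) j) \<longlonglongrightarrow> x j"
        by (rule x[OF \<open>j < n\<close>])
      show "(\<lambda>k. E (Suc (h k)) (q (h k)) j + (b j - a j) * inverse (real (Suc (h k)))) \<longlonglongrightarrow> x j"
        using tendsto_add[OF x[OF \<open>j < n\<close>] inv] by (simp only: mult_zero_right add_0_right)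
    qed
  qed
  have xQ: "x \<in> Q"
    unfolding Q_def
  proof (intro CollectI allI impI)
    fix j assume j: "j < n"
    have "E (Suc p) (q p) j \<in> {a j..b j}" for p
      using \<open>\<And>p. E (Suc p) (q p) \<in> Q\<close> j by (auto simp: Q_def)
    then show "x j \<in> {a j..b j}"
      by (rule closed_sequentially[OF closed_atLeastAtMost _ x[OF j]])
  qed
  have rQ: "E (Suc p) (t p) \<in> Q" if "\<And>p j. j < n \<Longrightarrow> q p j \<le> t p j \<and> t p j \<le> q p j + 1" for t p
  proof (rule EQ)
    show "\<forall>i<n. t p i \<le> Suc p"
    proof (intro allI impI)
      fix j assume "j < n"
      then show "t p j \<le> Suc p" using that[of j p] q[of j p] by linarith
    qed
  qed simp
  have "G i x = 0" if i: "i < n" for i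
  proof (rule antisym)
    have "(\<lambda>k. G i (E (Suc (h k)) (r (h k) i))) \<longlonglongrightarrow> G i x"
      by (rule cont[OF i _ xQ]) (use r(1) i rQ[of "\<lambda>p. r p i"] near[of _ "\<lambda>p. r p i"] in auto)
    then show "G i x \<le> 0"
      by (rule LIMSEQ_le_const2) (use r(2) i in auto)
    have "(\<lambda>k. G i (E (Suc (h k)) (s (h k) i))) \<longlonglongrightarrow> G i x"
      by (rule cont[OF i _ xQ]) (use s(1) i rQ[of "\<lambda>p. s p i"] near[of _ "\<lambda>p. s p i"] in auto)
    then show "0 \<le> G i x"
      by (rule LIMSEQ_le_const) (use s(2) i in auto)
  qed
  with xQ show ?thesis by blast
qed

lemma fine_partition_of_unity:
  fixes Z :: "'a::metric_space set"
  assumes Z: "compact Z" "Z \<noteq> {}" and "e > 0"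
  shows "\<exists>(N::nat) z \<eta>. 0 < N \<and> (\<forall>i<N. z i \<in> Z \<and> continuous_on Z (\<eta> i) \<and>
      (\<forall>x\<in>Z. 0 \<le> \<eta> i x \<and> (\<eta> i x \<noteq> 0 \<longrightarrow> dist x (z i) < e))) \<and>
      (\<forall>x\<in>Z. (\<Sum>i<N. \<eta> i x) = (1::real))"
proof -
  have "\<exists>F\<subseteq>Z. finite F \<and> Z \<subseteq> (\<Union>z\<in>F. ball z e)"
    by (rule compactE_image[OF Z(1), of Z "\<lambda>z. ball z e"]) (use \<open>e > 0\<close> in \<open>auto intro!: centre_in_ball[THEN iffD2]\<close>)
  then obtain F where F: "F \<subseteq> Z" "finite F" "Z \<subseteq> (\<Union>z\<in>F. ball z e)" by blast
  obtain z where z: "bij_betw z {..<card F} F"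
    using ex_bij_betw_nat_finite[OF F(2)] by (auto simp: atLeast0LessThan)
  let ?N = "card F"
  have zZ: "z i \<in> Z" if "i < ?N" for i
    using z that F(1) by (auto simp: bij_betw_def)
  define t where "t i x = max 0 (e - dist x (z i))" for i x
  have pos: "(\<Sum>i<?N. t i x) > 0" if x: "x \<in> Z" for x
  proof -
    obtain w where w: "w \<in> F" "dist w x < e" using F(3) x by auto
    then have "w \<in> z ` {..<?N}"
      using bij_betw_imp_surj_on[OF z] by simp
    then obtain i where "i < ?N" "w = z i" by auto
    with w have i: "i < ?N" "dist (z i) x < e" by simp_all
    then have "t i x > 0" by (simp add: t_def dist_commute)
    then show ?thesis
      using i by (intro sum_pos2[of _ i]) (auto simp: t_def)
  qed
  define \<eta> where "\<eta> i x = t i x / (\<Sum>j<?N. t j x)" for i x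
  have "z i \<in> Z \<and> continuous_on Z (\<eta> i) \<and> (\<forall>x\<in>Z. 0 \<le> \<eta> i x \<and> (\<eta> i x \<noteq> 0 \<longrightarrow> dist x (z i) < e))"
    if "i < ?N" for i
  proof (intro conjI ballI impI)
    show "z i \<in> Z" by (rule zZ[OF that])
    have tc: "continuous_on Z (t j)" for j
      unfolding t_def by (intro continuous_intros)
    show "continuous_on Z (\<eta> i)"
      unfolding \<eta>_def
    proof (intro continuous_on_divide continuous_on_sum tc ballI)
      show "(\<Sum>j<?N. t j x) \<noteq> 0" if "x \<in> Z" for x
        using pos[OF that] by simp
    qed
    fix x assume x: "x \<in> Z"
    show "0 \<le> \<eta> i x"
      unfolding \<eta>_def using pos[OF x] by (intro divide_nonneg_pos) (auto simp: t_def)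
    assume "\<eta> i x \<noteq> 0"
    then have "t i x \<noteq> 0" by (auto simp: \<eta>_def)
    then show "dist x (z i) < e" by (simp add: t_def max_def split: if_splits)
  qed
  moreover have "(\<Sum>i<?N. \<eta> i x) = 1" if "x \<in> Z" for x
    unfolding \<eta>_def sum_divide_distrib[symmetric] using pos[OF that] by simp
  moreover have "0 < ?N" using F Z(2) by (auto simp: card_gt_0_iff)
  ultimately show ?thesis by blast
qed

lemma partition_sum_close:
  fixes k :: "'a::metric_space \<Rightarrow> real" and N :: nat
  assumes "\<And>i. i < N \<Longrightarrow> 0 \<le> \<eta> i \<and> (\<eta> i \<noteq> 0 \<longrightarrow> dist x (z i) < e \<and> z i \<in> Z)" "(\<Sum>i<N. \<eta> i) = 1" "x \<in> Z"
    and k: "\<And>x x'. x \<in> Z \<Longrightarrow> x' \<in> Z \<Longrightarrow> dist x x' < e \<Longrightarrow> \<bar>k x - k x'\<bar> \<le> d"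
  shows "\<bar>(\<Sum>i<N. \<eta> i * k (z i)) - k x\<bar> \<le> d"
proof -
  have "(\<Sum>i<N. \<eta> i * k (z i)) - k x = (\<Sum>i<N. \<eta> i * (k (z i) - k x))"
    using assms(2) by (simp add: right_diff_distrib sum_subtractf sum_distrib_right[symmetric])
  also have "\<bar>\<dots>\<bar> \<le> (\<Sum>i<N. \<eta> i * d)"
  proof (rule order_trans[OF sum_abs sum_mono])
    fix i assume "i \<in> {..<N}"
    then show "\<bar>\<eta> i * (k (z i) - k x)\<bar> \<le> \<eta> i * d"
      using assms(1)[of i] k[of x "z i"] assms(3)
      by (cases "\<eta> i = 0") (auto simp: abs_mult abs_minus_commute intro!: mult_left_mono)
  qed
  also have "\<dots> = d"
    using assms(2) by (simp add: sum_distrib_right[symmetric])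
  finally show ?thesis .
qed

text \<open>Replacing the measure with density \<open>\<rho>\<close> by atoms at the
  \<open>z i\<close> moves mass by less than \<open>e\<close>. The integral of \<open>k\<close>
  therefore changes by at most the oscillation of \<open>k\<close> at that scale.\<close>

lemma partition_integral_close:
  fixes k :: "'a::metric_space \<Rightarrow> real" and N :: nat
  assumes \<nu>: "finite_measure \<nu>" "sets \<nu> = sets (borel_on Z)" and Z: "compact Z"
    and \<eta>: "\<And>i. i < N \<Longrightarrow> z i \<in> Z \<and> continuous_on Z (\<eta> i) \<and>
      (\<forall>x\<in>Z. 0 \<le> \<eta> i x \<and> (\<eta> i x \<noteq> 0 \<longrightarrow> dist x (z i) < e))" "\<And>x. x \<in> Z \<Longrightarrow> (\<Sum>i<N. \<eta> i x) = 1"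
    and k: "continuous_on Z k" "\<And>x x'. x \<in> Z \<Longrightarrow> x' \<in> Z \<Longrightarrow> dist x x' < e \<Longrightarrow> \<bar>k x - k x'\<bar> \<le> d"
    and \<rho>: "\<rho> \<in> borel_measurable \<nu>" "\<And>x. x \<in> Z \<Longrightarrow> 0 \<le> \<rho> x \<and> \<rho> x \<le> B" "integral\<^sup>L \<nu> \<rho> = 1"
  shows "\<bar>(\<Sum>i<N. (\<integral>x. \<eta> i x * \<rho> x \<partial>\<nu>) * k (z i)) - (\<integral>x. k x * \<rho> x \<partial>\<nu>)\<bar> \<le> d"
proof -
  interpret finite_measure \<nu> by fact
  have space: "space \<nu> = Z"
    using sets_eq_imp_space_eq[OF \<nu>(2)] by (simp add: space_restrict_space)
  have int: "integrable \<nu> (\<lambda>x. g x * \<rho> x)" if g: "continuous_on Z g" for g :: "'a \<Rightarrow> real"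
  proof -
    obtain A where A: "0 \<le> A" "\<And>x. x \<in> Z \<Longrightarrow> \<bar>g x\<bar> \<le> A"
      using continuous_on_compact_abs_bound[OF Z g] by metis
    have "g \<in> borel_measurable \<nu>"
      using borel_measurable_integrable[OF integrable_continuous_on_compact[OF \<nu> Z g]] .
    then show ?thesis
      using A \<rho> space by (intro integrable_const_bound[of _ "A * B"]) (auto simp: abs_mult intro!: mult_mono AE_I2)
  qed
  have "(\<Sum>i<N. (\<integral>x. \<eta> i x * \<rho> x \<partial>\<nu>) * k (z i)) - (\<integral>x. k x * \<rho> x \<partial>\<nu>) =
    (\<integral>x. (\<Sum>i<N. \<eta> i x * \<rho> x * k (z i)) - k x * \<rho> x \<partial>\<nu>)"
    using int[of "\<eta> _"] \<eta>(1) int[OF k(1)]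
    by (subst Bochner_Integration.integral_diff) (auto simp: Bochner_Integration.integral_sum)
  also have "\<dots> = (\<integral>x. ((\<Sum>i<N. \<eta> i x * k (z i)) - k x) * \<rho> x \<partial>\<nu>)"
    by (simp add: left_diff_distrib sum_distrib_right sum_distrib_left mult_ac right_diff_distrib)
  also have "\<bar>\<dots>\<bar> \<le> (\<integral>x. \<bar>((\<Sum>i<N. \<eta> i x * k (z i)) - k x) * \<rho> x\<bar> \<partial>\<nu>)"
    by (rule integral_abs_bound)
  also have "\<dots> \<le> (\<integral>x. d * \<rho> x \<partial>\<nu>)"
  proof (rule integral_mono)
    show "integrable \<nu> (\<lambda>x. \<bar>((\<Sum>i<N. \<eta> i x * k (z i)) - k x) * \<rho> x\<bar>)"
      by (intro integrable_abs int continuous_intros) (use \<eta>(1) k in auto)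
    show "integrable \<nu> (\<lambda>x. d * \<rho> x)" using int[OF continuous_on_const[of _ d]] .
    fix x assume "x \<in> space \<nu>"
    then show "\<bar>((\<Sum>i<N. \<eta> i x * k (z i)) - k x) * \<rho> x\<bar> \<le> d * \<rho> x"
      using partition_sum_close[of N "\<lambda>i. \<eta> i x" x z e Z k d] \<eta> k(2) \<rho>(2)[of x]
      unfolding space abs_mult by (intro mult_mono) auto
  qed
  also have "\<dots> = d" using \<rho>(3) by simp
  finally show ?thesis .
qed

text \<open>The atoms are fixed before \<open>k\<close> and \<open>d\<close>, so that one
  discretization serves every test function.\<close>

lemma discretize_probability:
  assumes \<mu>: "\<mu> \<in> borel_probs Z" and Z: "compact (Z :: 'a::metric_space set)" and "e > 0"
  shows "\<exists>(N::nat) z m. (\<forall>i<N. z i \<in> Z \<and> 0 < m i) \<and> (\<Sum>i<N. m i) = (1::real) \<and>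
    (\<forall>k d. continuous_on Z k \<longrightarrow> (\<forall>x\<in>Z. \<forall>x'\<in>Z. dist x x' < e \<longrightarrow> \<bar>k x - k x'\<bar> \<le> d) \<longrightarrow>
      \<bar>(\<Sum>i<N. m i * k (z i)) - integral\<^sup>L \<mu> k\<bar> \<le> d)"
proof -
  interpret prob_space \<mu> using borel_probsD[OF \<mu>] by simp
  have space: "space \<mu> = Z" using borel_probsD[OF \<mu>] by simp
  then have "Z \<noteq> {}" using not_empty by simp
  from fine_partition_of_unity[OF Z this \<open>e > 0\<close>]
  obtain N :: nat and z and \<eta> :: "nat \<Rightarrow> 'a \<Rightarrow> real" where
    "0 < N \<and> (\<forall>i<N. z i \<in> Z \<and> continuous_on Z (\<eta> i) \<and>
      (\<forall>x\<in>Z. 0 \<le> \<eta> i x \<and> (\<eta> i x \<noteq> 0 \<longrightarrow> dist x (z i) < e))) \<and>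
      (\<forall>x\<in>Z. (\<Sum>i<N. \<eta> i x) = (1::real))" by (elim exE) 
  then have \<eta>: "\<And>i. i < N \<Longrightarrow> z i \<in> Z \<and> continuous_on Z (\<eta> i) \<and>
      (\<forall>x\<in>Z. 0 \<le> \<eta> i x \<and> (\<eta> i x \<noteq> 0 \<longrightarrow> dist x (z i) < e))" "\<And>x. x \<in> Z \<Longrightarrow> (\<Sum>i<N. \<eta> i x) = (1::real)"
    by blast+
  define m where "m i = integral\<^sup>L \<mu> (\<eta> i)" for i
  have mnn: "0 \<le> m i" if "i < N" for i
    unfolding m_def using \<eta>(1)[OF that] space by (intro integral_nonneg_AE AE_I2) auto
  have "(\<Sum>i<N. m i) = (\<integral>x. (\<Sum>i<N. \<eta> i x) \<partial>\<mu>)"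
    unfolding m_def using integrable_borel_probs[OF \<mu> Z] \<eta>(1) by (subst Bochner_Integration.integral_sum) auto
  also have "\<dots> = (\<integral>x. 1 \<partial>\<mu>)"
    using \<eta>(2) space by (intro Bochner_Integration.integral_cong) auto
  finally have m1: "(\<Sum>i<N. m i) = 1" by (simp add: prob_space)
  \<comment> \<open>Atoms without mass are dropped: the lower end of the box in
    \<open>finite_equilibrium\<close> is built from the logarithm of the smallest type mass.\<close>
  define S where "S = {i. i < N \<and> 0 < m i}"
  have "finite S" by (simp add: S_def)
  then obtain h where h: "bij_betw h {..<card S} S"
    using ex_bij_betw_nat_finite by (auto simp: atLeast0LessThan)
  have sum_S: "(\<Sum>i<card S. m (h i) * k (h i)) = (\<Sum>i<N. m i * k i)" for k :: "nat \<Rightarrow> real"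
  proof -
    have "(\<Sum>i<card S. m (h i) * k (h i)) = (\<Sum>i\<in>S. m i * k i)"
      by (rule sum.reindex_bij_betw[OF h])
    also have "\<dots> = (\<Sum>i<N. m i * k i)"
      by (rule sum.mono_neutral_left) (use mnn in \<open>force simp: S_def\<close>)+
    finally show ?thesis .
  qed
  show ?thesis
  proof (intro exI[of _ "card S"] exI[of _ "z \<circ> h"] exI[of _ "m \<circ> h"] conjI allI impI)
    fix i assume "i < card S"
    then have "h i \<in> S" using h by (auto simp: bij_betw_def)
    then show "(z \<circ> h) i \<in> Z" "0 < (m \<circ> h) i"
      using \<eta> by (auto simp: S_def)
  next
    show "(\<Sum>i<card S. (m \<circ> h) i) = 1"
      using sum_S[of "\<lambda>_. 1"] m1 by simp
  next
    fix k :: "'a \<Rightarrow> real" and d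
    assume k: "continuous_on Z k" "\<forall>x\<in>Z. \<forall>x'\<in>Z. dist x x' < e \<longrightarrow> \<bar>k x - k x'\<bar> \<le> d"
    have "\<bar>(\<Sum>i<N. (\<integral>x. \<eta> i x * 1 \<partial>\<mu>) * k (z i)) - (\<integral>x. k x * 1 \<partial>\<mu>)\<bar> \<le> d"
    proof (rule partition_integral_close[OF finite_measure_axioms borel_probsD(2)[OF \<mu>] Z \<eta> k(1), where B = 1])
      show "\<bar>k x - k x'\<bar> \<le> d" if "x \<in> Z" "x' \<in> Z" "dist x x' < e" for x x'
        using k(2) that by blast
    qed (simp_all add: prob_space)
    then show "\<bar>(\<Sum>i<card S. (m \<circ> h) i * k ((z \<circ> h) i)) - integral\<^sup>L \<mu> k\<bar> \<le> d"
      using sum_S[of "\<lambda>i. k (z i)"] by (simp add: m_def)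
  qed
qed

section \<open>Logit choice\<close>

definition softmax :: "real \<Rightarrow> nat \<Rightarrow> (nat \<Rightarrow> real) \<Rightarrow> nat \<Rightarrow> real" where
  "softmax \<epsilon> N a i = exp (a i / \<epsilon>) / (\<Sum>l<N. exp (a l / \<epsilon>))"

text \<open>For \<open>a i = \<phi> i - c (x i) y\<close> this is the highest congestion that some
  type tolerates at \<open>y\<close>; it becomes the potential \<open>P\<close>.\<close>

definition peak :: "nat \<Rightarrow> (nat \<Rightarrow> real) \<Rightarrow> real" where
  "peak N a = Max (a ` {..<N})"

lemma peak_ge: "i < N \<Longrightarrow> a i \<le> peak N a"
  unfolding peak_def by (intro Max_ge) auto

lemma peak_attained:
  assumes "0 < N"
  obtains i where "i < N" "peak N a = a i"
proof -
  have "peak N a \<in> a ` {..<N}"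
    unfolding peak_def using assms by (intro Max_in) auto
  then show ?thesis using that by auto
qed

lemma peak_Suc: "0 < N \<Longrightarrow> peak (Suc N) a = max (a N) (peak N a)"
  unfolding peak_def by (simp add: lessThan_Suc lessThan_empty_iff)

lemma tendsto_peak:
  assumes "0 < N" "\<And>i. i < N \<Longrightarrow> ((\<lambda>k. u k i) \<longlongrightarrow> x i) F"
  shows "((\<lambda>k. peak N (u k)) \<longlongrightarrow> peak N x) F"
  using assms
proof (induction N)
  case (Suc N)
  show ?case
  proof (cases "N = 0")
    case True
    then show ?thesis using Suc.prems by (simp add: peak_def lessThan_Suc)
  next
    case False
    then show ?thesis using Suc by (simp add: peak_Suc tendsto_max)
  qed
qed simp

lemma borel_measurable_peak:
  assumes "0 < N" "\<And>i. i < N \<Longrightarrow> (\<lambda>y. a y i) \<in> borel_measurable M"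
  shows "(\<lambda>y. peak N (a y)) \<in> borel_measurable M"
  using assms
proof (induction N)
  case (Suc N)
  show ?case
  proof (cases "N = 0")
    case True
    then show ?thesis using Suc.prems by (simp add: peak_def lessThan_Suc)
  next
    case False
    then show ?thesis using Suc by (simp add: peak_Suc)
  qed
qed simp

lemma softmax_sum_pos: "0 < N \<Longrightarrow> 0 < (\<Sum>l<N. exp (a l / \<epsilon> :: real))" for N :: nat
  by (intro sum_pos) auto

lemma softmax_nonneg: "0 \<le> softmax \<epsilon> N a i"
  unfolding softmax_def by (intro divide_nonneg_nonneg sum_nonneg) auto

lemma sum_softmax: "0 < N \<Longrightarrow> (\<Sum>i<N. softmax \<epsilon> N a i) = 1"
  unfolding softmax_def sum_divide_distrib[symmetric] using softmax_sum_pos[of N a \<epsilon>] by simp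

lemma softmax_le_1: "i < N \<Longrightarrow> softmax \<epsilon> N a i \<le> 1"
  using sum_softmax[of N \<epsilon> a] member_le_sum[of i "{..<N}" "softmax \<epsilon> N a"] by (simp add: softmax_nonneg)

lemma softmax_le_exp:
  assumes "i < N" "l < N"
  shows "softmax \<epsilon> N a i \<le> exp ((a i - a l) / \<epsilon>)"
proof -
  have "exp (a l / \<epsilon>) \<le> (\<Sum>l<N. exp (a l / \<epsilon>))"
    using assms by (intro member_le_sum) auto
  then have "softmax \<epsilon> N a i \<le> exp (a i / \<epsilon>) / exp (a l / \<epsilon>)"
    unfolding softmax_def by (intro divide_left_mono mult_pos_pos) (auto intro: less_le_trans[of 0 "exp (a l / \<epsilon>)"])
  also have "\<dots> = exp ((a i - a l) / \<epsilon>)"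
    by (simp add: exp_diff[symmetric] diff_divide_distrib)
  finally show ?thesis .
qed

lemma softmax_ge_exp:
  assumes "i < N" "\<And>l. l < N \<Longrightarrow> a l \<le> a i + D" "\<epsilon> > 0"
  shows "exp (- D / \<epsilon>) / N \<le> softmax \<epsilon> N a i"
proof -
  have "(\<Sum>l<N. exp (a l / \<epsilon>)) \<le> (\<Sum>l<N. exp (a i / \<epsilon> + D / \<epsilon>))"
    using assms by (intro sum_mono) (simp add: add_divide_distrib[symmetric] divide_right_mono)
  also have "\<dots> = N * (exp (a i / \<epsilon>) * exp (D / \<epsilon>))"
    by (simp add: exp_add)
  finally have "exp (a i / \<epsilon>) / (N * (exp (a i / \<epsilon>) * exp (D / \<epsilon>))) \<le> softmax \<epsilon> N a i"
    unfolding softmax_def using softmax_sum_pos[of N a \<epsilon>] assms(1)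
    by (intro divide_left_mono) (auto intro!: mult_pos_pos)
  then show ?thesis
    by (simp add: exp_minus field_simps)
qed

text \<open>The bound rests on \<open>u * exp (- u) \<le> 1\<close>.\<close>

lemma softmax_gap:
  assumes "i < N" "\<epsilon> > 0"
  shows "softmax \<epsilon> N a i * (peak N a - a i) \<le> \<epsilon>"
proof -
  obtain l where l: "l < N" "peak N a = a l"
    using peak_attained[of N a] assms by auto
  define u where "u = (a l - a i) / \<epsilon>"
  have "u \<ge> 0" using peak_ge[of i N a] assms l by (simp add: u_def)
  have "softmax \<epsilon> N a i \<le> exp (- u)"
    using softmax_le_exp[OF assms(1) l(1), of \<epsilon> a] by (simp add: u_def minus_divide_left)
  then have "softmax \<epsilon> N a i * u \<le> exp (- u) * u"
    using \<open>u \<ge> 0\<close> by (rule mult_right_mono)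
  also have "\<dots> \<le> 1"
    using order_trans[OF _ exp_ge_add_one_self[of u], of u] by (simp add: exp_minus inverse_eq_divide)
  finally have "softmax \<epsilon> N a i * u * \<epsilon> \<le> 1 * \<epsilon>"
    using assms(2) by (intro mult_right_mono) auto
  then show ?thesis
    using assms(2) l by (simp add: u_def)
qed

lemma tendsto_softmax:
  assumes "i < N" "\<And>i. i < N \<Longrightarrow> ((\<lambda>k. u k i) \<longlongrightarrow> x i) F"
  shows "((\<lambda>k. softmax \<epsilon> N (u k) i) \<longlongrightarrow> softmax \<epsilon> N x i) F"
proof (cases "\<epsilon> = 0")
  case False
  have "0 < N" using assms(1) by simp
  then show ?thesis
    unfolding softmax_def using softmax_sum_pos[of N x \<epsilon>] assms False
    by (intro tendsto_intros) auto
qed (simp add: softmax_def)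

lemma borel_measurable_softmax:
  assumes "i < N" "\<And>i. i < N \<Longrightarrow> (\<lambda>y. a y i) \<in> borel_measurable M"
  shows "(\<lambda>y. softmax \<epsilon> N (a y) i) \<in> borel_measurable M"
  unfolding softmax_def using assms by (intro borel_measurable_divide borel_measurable_sum) auto

text \<open>The complementarity condition linking density and congestion: an action stays empty when
  the tolerated level \<open>s\<close> is below \<open>h 0\<close>, and otherwise it fills up until
  the level is reached. For the functions of the context below the choice is unique.\<close>

definition cutoff_inverse :: "(real \<Rightarrow> real) \<Rightarrow> real \<Rightarrow> real" where
  "cutoff_inverse h s = (SOME t. 0 \<le> t \<and> s \<le> h t \<and> (0 < t \<longrightarrow> h t = s))"

context
  fixes h :: "real \<Rightarrow> real" and \<delta> :: real
  assumes cont: "continuous_on {0..} h" and \<delta>: "\<delta> > 0"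
    and slope: "\<And>t t'. 0 \<le> t \<Longrightarrow> t \<le> t' \<Longrightarrow> \<delta> * (t' - t) \<le> h t' - h t"
begin

lemma cutoff_inverse:
  shows cutoff_inverse_nonneg: "0 \<le> cutoff_inverse h s"
    and cutoff_inverse_ge: "s \<le> h (cutoff_inverse h s)"
    and cutoff_inverse_eq: "0 < cutoff_inverse h s \<Longrightarrow> h (cutoff_inverse h s) = s"
proof -
  have "\<exists>t. 0 \<le> t \<and> s \<le> h t \<and> (0 < t \<longrightarrow> h t = s)"
  proof (cases "s \<le> h 0")
    case True
    then show ?thesis by auto
  next
    case False
    \<comment> \<open>The slope bound forces \<open>h T \<ge> s\<close> here, which gives the
      intermediate value theorem its bracket.\<close>
    define T where "T = (s - h 0) / \<delta>"
    have "0 \<le> T" using False \<delta> by (simp add: T_def)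
    moreover have "s \<le> h T" using slope[of 0 T] \<open>0 \<le> T\<close> \<delta> by (simp add: T_def)
    ultimately have "\<exists>t\<ge>0. t \<le> T \<and> h t = s"
      using False by (intro IVT' continuous_on_subset[OF cont]) auto
    then show ?thesis by force
  qed
  from someI_ex[OF this] show "0 \<le> cutoff_inverse h s" "s \<le> h (cutoff_inverse h s)"
    "0 < cutoff_inverse h s \<Longrightarrow> h (cutoff_inverse h s) = s"
    unfolding cutoff_inverse_def by blast+
qed

text \<open>A Galois connection. It describes sublevel sets of the density through
  \<open>f y a\<close> at a fixed \<open>a\<close>, and measurability in \<open>y\<close> is assumed
  precisely for such sections.\<close>

lemma cutoff_inverse_le_iff:
  assumes "0 \<le> a"
  shows "cutoff_inverse h s \<le> a \<longleftrightarrow> s \<le> h a"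
proof
  assume "cutoff_inverse h s \<le> a"
  then have "h (cutoff_inverse h s) \<le> h a"
    using slope[OF cutoff_inverse_nonneg, of s a] \<delta>
    by (smt (verit) mult_nonneg_nonneg)
  then show "s \<le> h a" using cutoff_inverse_ge[of s] by simp
next
  assume "s \<le> h a"
  show "cutoff_inverse h s \<le> a"
  proof (rule ccontr)
    assume "\<not> ?thesis"
    then have "0 < \<delta> * (cutoff_inverse h s - a)" "0 < cutoff_inverse h s"
      using assms \<delta> by auto
    then show False
      using slope[of a "cutoff_inverse h s"] cutoff_inverse_eq[of s] \<open>s \<le> h a\<close> assms
      by (smt (verit) \<open>\<not> cutoff_inverse h s \<le> a\<close>)
  qed
qed

text \<open>This is what the linear term buys: an increase of the argument by
  \<open>\<bar>s - s'\<bar> / \<delta>\<close> raises \<open>h\<close> by at least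
  \<open>\<bar>s - s'\<bar>\<close>.\<close>

lemma cutoff_inverse_lipschitz: "\<bar>cutoff_inverse h s - cutoff_inverse h s'\<bar> \<le> \<bar>s - s'\<bar> / \<delta>"
proof -
  have *: "cutoff_inverse h s' - cutoff_inverse h s \<le> \<bar>s - s'\<bar> / \<delta>" for s s'
  proof -
    let ?a = "cutoff_inverse h s + \<bar>s - s'\<bar> / \<delta>"
    have "0 \<le> \<bar>s - s'\<bar> / \<delta>" using \<delta> by simp
    then have "\<bar>s - s'\<bar> \<le> h ?a - h (cutoff_inverse h s)"
      using slope[OF cutoff_inverse_nonneg, of s ?a] \<delta> by simp
    then have "s' \<le> h ?a"
      using cutoff_inverse_ge[of s] by linarith
    then have "cutoff_inverse h s' \<le> ?a"
      using cutoff_inverse_nonneg[of s] \<delta> by (subst cutoff_inverse_le_iff) auto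
    then show ?thesis by simp
  qed
  show ?thesis
    using *[of s' s] *[of s s'] by (simp add: abs_if abs_minus_commute split: if_splits)
qed

lemma tendsto_cutoff_inverse:
  assumes "(u \<longlongrightarrow> s) F"
  shows "((\<lambda>k. cutoff_inverse h (u k)) \<longlongrightarrow> cutoff_inverse h s) F"
proof (rule Lim_null_comparison[THEN LIM_zero_cancel])
  show "\<forall>\<^sub>F k in F. norm (cutoff_inverse h (u k) - cutoff_inverse h s) \<le> \<bar>u k - s\<bar> / \<delta>"
    using cutoff_inverse_lipschitz by simp
  have "((\<lambda>k. \<bar>u k - s\<bar> / \<delta>) \<longlongrightarrow> \<bar>s - s\<bar> / \<delta>) F"
    using \<delta> assms by (intro tendsto_intros) auto
  then show "((\<lambda>k. \<bar>u k - s\<bar> / \<delta>) \<longlongrightarrow> 0) F" by simp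
qed

end

text \<open>As an image of a measure on indices, it adds up the weights of coinciding points, so
  \<open>z\<close> may fail to be injective.\<close>

definition atoms :: "'b::topological_space set \<Rightarrow> nat \<Rightarrow> (nat \<Rightarrow> 'b) \<Rightarrow> (nat \<Rightarrow> real) \<Rightarrow> 'b measure" where
  "atoms Y K z v = distr (point_measure {..<K} (\<lambda>j. ennreal (v j))) (borel_on Y) z"

lemma
  assumes z: "\<And>j. j < K \<Longrightarrow> z j \<in> Y" and v: "\<And>j. j < K \<Longrightarrow> 0 \<le> v j"
  shows atoms_in_borel_probs: "(\<Sum>j<K. v j) = 1 \<Longrightarrow> atoms Y K z v \<in> borel_probs Y"
    and integral_atoms: "continuous_on Y k \<Longrightarrow> integral\<^sup>L (atoms Y K z v) k = (\<Sum>j<K. v j * (k (z j) :: real))"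
proof -
  have m: "z \<in> measurable (point_measure {..<K} (\<lambda>j. ennreal (v j))) (borel_on Y)"
    using z by (auto simp: measurable_point_measure_eq1 space_restrict_space)
  {
    assume "(\<Sum>j<K. v j) = 1"
    then have "prob_space (point_measure {..<K} (\<lambda>j. ennreal (v j)))"
      using v by (intro prob_spaceI, simp add: space_point_measure emeasure_point_measure_finite)
        (subst sum_ennreal, auto)
    then show "atoms Y K z v \<in> borel_probs Y"
      using prob_space.prob_space_distr[OF _ m] by (simp add: borel_probs_def atoms_def)
  }
  assume "continuous_on Y k"
  then have "integral\<^sup>L (atoms Y K z v) k = (\<integral>j. k (z j) \<partial>point_measure {..<K} (\<lambda>j. ennreal (v j)))"
    unfolding atoms_def using m borel_measurable_continuous_on_restrict by (subst integral_distr) auto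
  also have "\<dots> = (\<Sum>j<K. v j *\<^sub>R k (z j))"
    using v by (intro lebesgue_integral_point_measure_finite) auto
  finally show "integral\<^sup>L (atoms Y K z v) k = (\<Sum>j<K. v j * k (z j))"
    by simp
qed

section \<open>The congestion game\<close>

locale congestion_game =
  fixes X :: "'a::euclidean_space set" and Y :: "'b::metric_space set"
    and m\<^sub>0 :: "'b measure" and \<mu> :: "'a measure"
    and c :: "'a \<Rightarrow> 'b \<Rightarrow> real" and f :: "'b \<Rightarrow> real \<Rightarrow> real"
    and I :: "'b measure \<Rightarrow> 'b \<Rightarrow> real" and \<alpha> C :: real
  assumes X: "compact X" and Y: "compact Y"
    and m0_finite: "finite_measure m\<^sub>0" and sets_m0: "sets m\<^sub>0 = sets (borel_on Y)"
    and m0_pos: "emeasure m\<^sub>0 Y > 0"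
    and \<mu>: "\<mu> \<in> borel_probs X"
    and c: "continuous_on (X \<times> Y) (\<lambda>(x, y). c x y)"
    and f_meas: "\<And>t. t \<ge> 0 \<Longrightarrow> (\<lambda>y. f y t) \<in> borel_measurable (borel_on Y)"
    and f_cont: "\<And>y. y \<in> Y \<Longrightarrow> continuous_on {0..} (f y)"
    and f_mono: "\<And>y. y \<in> Y \<Longrightarrow> mono_on {0..} (f y)"
    and \<alpha>: "\<alpha> > 0" and C: "C > 0"
    and growth: "\<And>y t. y \<in> Y \<Longrightarrow> t \<ge> 0 \<Longrightarrow>
      1 / C * (t powr \<alpha> - 1) \<le> f y t \<and> f y t \<le> C * (t powr \<alpha> + 1)"
    and I_cont: "\<And>\<nu>. \<nu> \<in> borel_probs Y \<Longrightarrow> continuous_on Y (I \<nu>)"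
    and I_weak: "continuous_map (weak_star Y) (sup_norm_topology Y) (\<lambda>\<nu>. restrict (I \<nu>) Y)"
begin

sublocale m0: finite_measure m\<^sub>0 by (rule m0_finite)

lemma space_m0: "space m\<^sub>0 = Y"
  using sets_eq_imp_space_eq[OF sets_m0] by (simp add: space_restrict_space)

lemma mass_pos: "0 < measure m\<^sub>0 Y"
  using m0_pos m0.emeasure_eq_measure[of Y] by simp

lemma X_nonempty: "X \<noteq> {}"
  using prob_space.not_empty[OF borel_probsD(1)[OF \<mu>]] borel_probsD(3)[OF \<mu>] by simp

lemma Y_nonempty: "Y \<noteq> {}"
  using m0_pos by auto

lemma measurable_m0: "continuous_on Y g \<Longrightarrow> g \<in> borel_measurable m\<^sub>0"
  using measurable_cong_sets[OF sets_m0 refl] borel_measurable_continuous_on_restrict by blast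

lemma f_measurable_m0: "t \<ge> 0 \<Longrightarrow> (\<lambda>y. f y t) \<in> borel_measurable m\<^sub>0"
  using measurable_cong_sets[OF sets_m0 refl] f_meas by blast

lemma c_cont_left: "y \<in> Y \<Longrightarrow> continuous_on X (\<lambda>x. c x y)"
  using continuous_on_compose2[OF c, of X "\<lambda>x. (x, y)"] by (simp add: image_subset_iff continuous_on_Pair)

lemma c_cont_right: "x \<in> X \<Longrightarrow> continuous_on Y (c x)"
  using continuous_on_compose2[OF c, of Y "\<lambda>y. (x, y)"] by (simp add: image_subset_iff continuous_on_Pair)

lemma c_bounded: "\<exists>A\<ge>0. \<forall>x\<in>X. \<forall>y\<in>Y. \<bar>c x y\<bar> \<le> A"
proof -
  obtain A where "0 \<le> A" "\<And>p. p \<in> X \<times> Y \<Longrightarrow> \<bar>case p of (x, y) \<Rightarrow> c x y\<bar> \<le> A"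
    using continuous_on_compact_abs_bound[OF compact_Times[OF X Y] c] by metis
  then show ?thesis by (intro exI[of _ A]) auto
qed

lemma I_limit:
  assumes "\<And>n::nat. \<sigma> n \<in> borel_probs Y" "\<rho> \<in> borel_probs Y"
    and "\<And>g::'b \<Rightarrow> real. continuous_on Y g \<Longrightarrow> (\<lambda>n. integral\<^sup>L (\<sigma> n) g) \<longlonglongrightarrow> integral\<^sup>L \<rho> g"
  shows "uniform_limit Y (\<lambda>n. I (\<sigma> n)) (I \<rho>) sequentially"
proof -
  have "limitin (sup_norm_topology Y) ((\<lambda>\<nu>. restrict (I \<nu>) Y) \<circ> \<sigma>) (restrict (I \<rho>) Y) sequentially"
    using continuous_map_limit[OF I_weak weak_star_limit[OF assms]] .
  from sup_norm_limit_uniform[OF this] show ?thesis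
    by (simp add: uniform_limit_iff)
qed

text \<open>Weak compactness in sequential form: values of \<open>I\<close> exceeding
  \<open>n\<close> along a sequence would contradict uniform convergence along a subsequence. All
  later constants are thereby uniform in the action distribution.\<close>

lemma I_bounded: "\<exists>B\<ge>0. \<forall>\<nu>\<in>borel_probs Y. \<forall>y\<in>Y. \<bar>I \<nu> y\<bar> \<le> B"
proof (rule ccontr)
  assume *: "\<not> ?thesis"
  have "\<exists>\<nu> y. \<nu> \<in> borel_probs Y \<and> y \<in> Y \<and> \<bar>I \<nu> y\<bar> > real n" for n
    using * by (metis not_le of_nat_0_le_iff)
  then obtain \<nu> y where \<nu>: "\<And>n. \<nu> n \<in> borel_probs Y" and y: "\<And>n. y n \<in> Y" "\<And>n. \<bar>I (\<nu> n) (y n)\<bar> > real n"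
    by metis
  obtain r \<rho> where r: "strict_mono r" and \<rho>: "\<rho> \<in> borel_probs Y"
    and conv: "\<And>g::'b \<Rightarrow> real. continuous_on Y g \<Longrightarrow> (\<lambda>n. integral\<^sup>L (\<nu> (r n)) g) \<longlonglongrightarrow> integral\<^sup>L \<rho> g"
    using borel_probs_weak_compact[OF Y, of \<nu>] \<nu> by blast
  have "uniform_limit Y (\<lambda>n. I (\<nu> (r n))) (I \<rho>) sequentially"
    using I_limit[of "\<lambda>n. \<nu> (r n)"] \<nu> \<rho> conv by blast
  then obtain N where N: "\<And>n z. n \<ge> N \<Longrightarrow> z \<in> Y \<Longrightarrow> dist (I (\<nu> (r n)) z) (I \<rho> z) < 1"
    unfolding uniform_limit_iff eventually_sequentially by (metis zero_less_one)
  obtain B where B: "0 \<le> B" "\<And>z. z \<in> Y \<Longrightarrow> \<bar>I \<rho> z\<bar> \<le> B"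
    using continuous_on_compact_abs_bound[OF Y I_cont[OF \<rho>]] by metis
  define n where "n = max N (nat \<lceil>B + 1\<rceil>)"
  have "\<bar>I (\<nu> (r n)) (y (r n))\<bar> < B + 1"
    using N[of n "y (r n)"] B(2)[OF y(1), of "r n"] y(1)[of "r n"] max.cobounded1[of N "nat \<lceil>B + 1\<rceil>"]
    unfolding n_def[symmetric] dist_real_def by linarith
  moreover have "B + 1 \<le> real n"
    unfolding n_def by linarith
  moreover have "real n \<le> real (r n)"
    using seq_suble[OF r] by simp
  ultimately show False
    using y(2)[of "r n"] by linarith
qed

lemma f_slope:
  assumes "y \<in> Y" "0 \<le> t" "t \<le> t'"
  shows "\<delta> * (t' - t) \<le> (f y t' + \<delta> * t') - (f y t + \<delta> * t)"
  using mono_onD[OF f_mono[OF assms(1)], of t t'] assms by (simp add: algebra_simps)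

lemma f_lower: "y \<in> Y \<Longrightarrow> 0 \<le> t \<Longrightarrow> - 1 / C \<le> f y t"
  using growth[of y t] mult_left_mono[of "- 1" "t powr \<alpha> - 1" "1 / C"] C by simp

text \<open>The lower growth bound solved for \<open>t\<close>. Through it, a bound on the
  congestion level becomes a pointwise bound on the density.\<close>

lemma powr_bound:
  assumes "y \<in> Y" "0 \<le> t" "f y t \<le> S"
  shows "t \<le> (C * S + 1) powr (1 / \<alpha>)"
proof -
  have "1 / C * (t powr \<alpha> - 1) \<le> S" using growth[of y t] assms by linarith
  then have "t powr \<alpha> \<le> C * S + 1" using C by (simp add: field_simps)
  then have "(t powr \<alpha>) powr (1 / \<alpha>) \<le> (C * S + 1) powr (1 / \<alpha>)"
    using \<alpha> by (intro powr_mono2) auto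
  then show ?thesis using \<alpha> assms(2) by (simp add: powr_powr)
qed

lemma integrable_m0:
  assumes "g \<in> borel_measurable m\<^sub>0" "\<And>y. y \<in> Y \<Longrightarrow> \<bar>g y\<bar> \<le> B"
  shows "integrable m\<^sub>0 (g :: 'b \<Rightarrow> real)"
  using assms space_m0 by (intro m0.integrable_const_bound[of _ B]) (auto intro!: AE_I2)

text \<open>The game with types \<open>x i\<close> of mass \<open>m i\<close>, where \<open>\<phi> i\<close> is the cost borne by type \<open>i\<close>, choices are
  logit choices with noise \<open>\<epsilon>\<close>, and \<open>I\<close> sees only the discretized action distribution. The density
  \<open>\<nu>\<close> is a function of \<open>\<phi>\<close> and of the weights \<open>v\<close>, so that finitely many unknowns remain.\<close>

lemma finite_equilibrium:
  fixes N K :: nat and \<epsilon> \<delta> :: real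
  assumes N: "0 < N" and x: "\<And>i. i < N \<Longrightarrow> x i \<in> X \<and> 0 < m i" and m: "(\<Sum>i<N. m i) = 1"
    and K: "0 < K" and \<eta>: "\<And>j. j < K \<Longrightarrow> z j \<in> Y \<and> continuous_on Y (\<eta> j) \<and> (\<forall>y\<in>Y. 0 \<le> \<eta> j y)"
      "\<And>y. y \<in> Y \<Longrightarrow> (\<Sum>j<K. \<eta> j y) = (1::real)"
    and \<epsilon>: "\<epsilon> > 0" and \<delta>: "\<delta> > 0"
  shows "\<exists>\<phi> v \<nu> B. (\<forall>j<K. 0 \<le> v j) \<and> (\<Sum>j<K. v j) = 1 \<and>
    \<nu> \<in> borel_measurable m\<^sub>0 \<and> (\<forall>y\<in>Y. 0 \<le> \<nu> y \<and> \<nu> y \<le> B) \<and>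
    (\<forall>j<K. v j = (\<integral>y. \<eta> j y * \<nu> y \<partial>m\<^sub>0)) \<and>
    (\<forall>i<N. (\<integral>y. softmax \<epsilon> N (\<lambda>i. \<phi> i - c (x i) y) i * \<nu> y \<partial>m\<^sub>0) = m i) \<and>
    (\<forall>y\<in>Y. peak N (\<lambda>i. \<phi> i - c (x i) y) \<le> f y (\<nu> y) + \<delta> * \<nu> y + I (atoms Y K z v) y \<and>
      (0 < \<nu> y \<longrightarrow> peak N (\<lambda>i. \<phi> i - c (x i) y) = f y (\<nu> y) + \<delta> * \<nu> y + I (atoms Y K z v) y))"
proof -

  \<comment> \<open>Constants of the box\<close>
  obtain A0 where A0: "0 \<le> A0" "\<And>x y. x \<in> X \<Longrightarrow> y \<in> Y \<Longrightarrow> \<bar>c x y\<bar> \<le> A0"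
    using c_bounded by blast
  obtain G0 where G0: "0 \<le> G0" "\<And>\<nu> y. \<nu> \<in> borel_probs Y \<Longrightarrow> y \<in> Y \<Longrightarrow> \<bar>I \<nu> y\<bar> \<le> G0"
    using I_bounded by blast
  define M0 where "M0 = measure m\<^sub>0 Y"
  have M0: "0 < M0" using mass_pos by (simp add: M0_def)
  \<comment> \<open>These constants serve the face \<open>\<phi> i = U\<close>. There type
    \<open>i\<close> has logit weight at least \<open>\<kappa>\<close> at every action, because no
    potential exceeds \<open>U\<close>, and the density is at least \<open>t0\<close>, because
    \<open>U\<close> covers \<open>A0 + G0\<close> and the largest congestion at density
    \<open>t0\<close>. The mass of type \<open>i\<close> is then at least
    \<open>\<kappa> * t0 * M0 = 1 \<ge> m i\<close>. \<open>V\<close> bounds the density over the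
    whole box.\<close>
  define \<kappa> where "\<kappa> = exp (- (2 * A0) / \<epsilon>) / N"
  have \<kappa>: "0 < \<kappa>" using N by (simp add: \<kappa>_def)
  define t0 where "t0 = 1 / (\<kappa> * M0)"
  have t0: "0 < t0" using \<kappa> M0 by (simp add: t0_def)
  define U where "U = A0 + G0 + (C * (t0 powr \<alpha> + 1) + \<delta> * t0)"
  have U: "0 \<le> U" unfolding U_def using A0 G0 C \<delta> t0 by (intro add_nonneg_nonneg mult_nonneg_nonneg) auto
  define V where "V = (C * (U + A0 + G0) + 1) powr (1 / \<alpha>)"
  have V: "0 \<le> V" by (simp add: V_def)
  define m1 where "m1 = Min (m ` {..<N})"
  have m1: "0 < m1" "\<And>i. i < N \<Longrightarrow> m1 \<le> m i"
    unfolding m1_def using N x by (auto simp: Min_gr_iff lessThan_empty_iff)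
  \<comment> \<open>These serve the face \<open>\<phi> i = - L\<close>. Where the density is
    positive, the peak is at least \<open>- 1 / C - G0\<close>, whereas type \<open>i\<close>
    tolerates at most \<open>A0 - L\<close>; its weight is at most
    \<open>exp ((D - L) / \<epsilon>)\<close>, and \<open>L\<close> brings its total mass below
    \<open>m1\<close>. The summands 1 keep the argument of the logarithm positive knowing only
    \<open>V \<ge> 0\<close>.\<close>
  define D where "D = A0 + 1 / C + G0"
  define L where "L = max 0 (D - \<epsilon> * ln (m1 / ((V + 1) * (M0 + 1))))"
  have L: "0 \<le> L" by (simp add: L_def)
  have L_small: "exp ((D - L) / \<epsilon>) * (V * M0) \<le> m1"
  proof -
    have "(D - L) / \<epsilon> \<le> ln (m1 / ((V + 1) * (M0 + 1)))"
      using \<epsilon> by (simp add: L_def field_simps max_def)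
    then have "exp ((D - L) / \<epsilon>) \<le> m1 / ((V + 1) * (M0 + 1))"
      using m1 V M0 by (subst (asm) ln_ge_iff) (auto intro!: divide_pos_pos mult_pos_pos)
    then have "exp ((D - L) / \<epsilon>) * ((V + 1) * (M0 + 1)) \<le> m1"
      using V M0 by (simp add: pos_le_divide_eq)
    moreover have "exp ((D - L) / \<epsilon>) * (V * M0) \<le> exp ((D - L) / \<epsilon>) * ((V + 1) * (M0 + 1))"
      using V M0 by (intro mult_left_mono mult_mono) auto
    ultimately show ?thesis by linarith
  qed

  \<comment> \<open>The unknowns and their equations\<close>
  define n where "n = N + K"
  define a where "a i = (if i < N then - L else 0)" for i
  define b where "b i = (if i < N then U else 1)" for i
  define Q where "Q = {u::nat \<Rightarrow> real. \<forall>j<n. u j \<in> {a j..b j}}"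
  define A where "A u y i = u i - c (x i) y" for u :: "nat \<Rightarrow> real" and y i
  define w where "w u = (\<Sum>j<K. u (N + j))" for u :: "nat \<Rightarrow> real"
  \<comment> \<open>A continuous map from nonnegative weights to the simplex: excess mass is scaled
    down, missing mass is put on index 0. Weights that already sum to 1 are left unchanged.\<close>
  define v where "v u j = u (N + j) / max 1 (w u) + (if j = 0 then 1 - w u / max 1 (w u) else 0)"
    for u :: "nat \<Rightarrow> real" and j
  define g where "g u = I (atoms Y K z (v u))" for u
  define h where "h y t = f y t + \<delta> * t" for y t
  define \<nu> where "\<nu> u y = cutoff_inverse (h y) (peak N (A u y) - g u y)" for u y
  define \<Gamma> where "\<Gamma> u i = (\<integral>y. softmax \<epsilon> N (A u y) i * \<nu> u y \<partial>m\<^sub>0)" for u i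
  define H where "H u j = (\<integral>y. \<eta> j y * \<nu> u y \<partial>m\<^sub>0)" for u j
  define T where "T u = (\<integral>y. \<nu> u y \<partial>m\<^sub>0)" for u
  \<comment> \<open>The first \<open>N\<close> equations prescribe the type masses, the others make
    the weights consistent with the density. Since \<open>H u j \<le> T u\<close>, division by
    \<open>max 1 (T u)\<close> keeps the quotient in [0, 1], which yields the face conditions for
    the weights.\<close>
  define G where "G i u = (if i < N then \<Gamma> u i - m i else u i - H u (i - N) / max 1 (T u))" for i u

  \<comment> \<open>Bounds, measurability and mass balance on the box\<close>
  have Qj: "a j \<le> u j" "u j \<le> b j" if "u \<in> Q" "j < n" for u j
    using that by (auto simp: Q_def)
  have Q\<phi>: "- L \<le> u i" "u i \<le> U" if "u \<in> Q" "i < N" for u i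
    using Qj[OF that(1), of i] that(2) by (auto simp: a_def b_def n_def)
  have Qw: "0 \<le> u (N + j)" "u (N + j) \<le> 1" if "u \<in> Q" "j < K" for u j
    using Qj[OF that(1), of "N + j"] that(2) by (auto simp: a_def b_def n_def)
  have w0: "0 \<le> w u" if "u \<in> Q" for u
    unfolding w_def using Qw[OF that] by (intro sum_nonneg) auto
  have v0: "0 \<le> v u j" if "u \<in> Q" "j < K" for u j
    unfolding v_def using Qw[OF that] w0[OF that(1)]
    by (intro add_nonneg_nonneg divide_nonneg_nonneg) auto
  have v1: "(\<Sum>j<K. v u j) = 1" for u
  proof -
    have "(\<Sum>j<K. v u j) = w u / max 1 (w u) + (\<Sum>j<K. if j = 0 then 1 - w u / max 1 (w u) else 0)"
      unfolding v_def sum.distrib sum_divide_distrib[symmetric] w_def ..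
    then show ?thesis using K by simp
  qed
  have atoms: "atoms Y K z (v u) \<in> borel_probs Y" if "u \<in> Q" for u
    using \<eta> v0[OF that] v1 by (intro atoms_in_borel_probs) auto
  have g_bound: "\<bar>g u y\<bar> \<le> G0" if "u \<in> Q" "y \<in> Y" for u y
    unfolding g_def using G0(2)[OF atoms] that by blast
  have h_props: "continuous_on {0..} (h y)" "\<And>t t'. 0 \<le> t \<Longrightarrow> t \<le> t' \<Longrightarrow> \<delta> * (t' - t) \<le> h y t' - h y t"
    if "y \<in> Y" for y
    unfolding h_def using f_slope[OF that] by (auto intro!: continuous_intros f_cont that)
  have inv_nonneg: "0 \<le> cutoff_inverse (h y) s" if "y \<in> Y" for y s
    by (rule cutoff_inverse_nonneg[OF h_props(1)[OF that] \<delta> h_props(2)[OF that]])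
  have inv_ge: "s \<le> h y (cutoff_inverse (h y) s)" if "y \<in> Y" for y s
    by (rule cutoff_inverse_ge[OF h_props(1)[OF that] \<delta> h_props(2)[OF that]])
  have inv_eq: "h y (cutoff_inverse (h y) s) = s" if "y \<in> Y" "0 < cutoff_inverse (h y) s" for y s
    by (rule cutoff_inverse_eq[OF h_props(1)[OF that(1)] \<delta> h_props(2)[OF that(1)] that(2)])
  have inv_le_iff: "cutoff_inverse (h y) s \<le> t \<longleftrightarrow> s \<le> h y t" if "y \<in> Y" "0 \<le> t" for y s t
    by (rule cutoff_inverse_le_iff[OF h_props(1)[OF that(1)] \<delta> h_props(2)[OF that(1)] that(2)])
  have inv_tendsto: "((\<lambda>k. cutoff_inverse (h y) (r k)) \<longlongrightarrow> cutoff_inverse (h y) s) F"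
    if "y \<in> Y" "(r \<longlongrightarrow> s) F" for y s and r :: "nat \<Rightarrow> real" and F
    by (rule tendsto_cutoff_inverse[OF h_props(1)[OF that(1)] \<delta> h_props(2)[OF that(1)] that(2)])
  have \<nu>0: "0 \<le> \<nu> u y" if "y \<in> Y" for u y
    unfolding \<nu>_def using inv_nonneg that by blast
  have \<nu>_ge: "peak N (A u y) - g u y \<le> h y (\<nu> u y)" if "y \<in> Y" for u y
    unfolding \<nu>_def using inv_ge that by blast
  have \<nu>_eq: "h y (\<nu> u y) = peak N (A u y) - g u y" if "y \<in> Y" "0 < \<nu> u y" for u y
    using inv_eq that unfolding \<nu>_def by blast
  have A_bound: "u i - A0 \<le> A u y i" "A u y i \<le> u i + A0" if "i < N" "y \<in> Y" for u y i
    using A0(2)[of "x i" y] x[OF that(1)] that by (auto simp: A_def abs_le_iff)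
  have \<nu>V: "\<nu> u y \<le> V" if "u \<in> Q" "y \<in> Y" for u y
  proof (cases "0 < \<nu> u y")
    case True
    obtain i where i: "i < N" "peak N (A u y) = A u y i" using peak_attained[OF N] by metis
    have "f y (\<nu> u y) \<le> h y (\<nu> u y)" using True \<delta> by (simp add: h_def)
    also have "\<dots> = A u y i - g u y" using \<nu>_eq[OF that(2) True] i by simp
    also have "\<dots> \<le> U + A0 + G0"
      using A_bound[OF i(1) that(2), of u] Q\<phi>[OF that(1) i(1)] g_bound[OF that] by linarith
    finally show ?thesis
      unfolding V_def using powr_bound[OF that(2) \<nu>0[OF that(2)]] by blast
  qed (use V in auto)
  have \<eta>1: "\<bar>\<eta> j y\<bar> \<le> 1" if "j < K" "y \<in> Y" for j y
    using member_le_sum[of j "{..<K}" "\<lambda>j. \<eta> j y"] \<eta> that by auto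
  have A_meas: "(\<lambda>y. A u y i) \<in> borel_measurable m\<^sub>0" if "i < N" for u i
    unfolding A_def using x[OF that] by (intro measurable_m0 continuous_intros c_cont_right) auto
  have g_meas: "g u \<in> borel_measurable m\<^sub>0" if "u \<in> Q" for u
    unfolding g_def by (intro measurable_m0 I_cont atoms that)
  have \<nu>_meas: "\<nu> u \<in> borel_measurable m\<^sub>0" if "u \<in> Q" for u
    unfolding borel_measurable_iff_le
  proof
    fix t
    show "{y \<in> space m\<^sub>0. \<nu> u y \<le> t} \<in> sets m\<^sub>0"
    proof (cases "0 \<le> t")
      case True
      have "{y \<in> space m\<^sub>0. \<nu> u y \<le> t} = {y \<in> space m\<^sub>0. peak N (A u y) - g u y \<le> f y t + \<delta> * t}"
        unfolding \<nu>_def space_m0 using inv_le_iff[OF _ True] by (auto simp: h_def)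
      also have "\<dots> \<in> sets m\<^sub>0"
        using borel_measurable_peak[OF N A_meas] g_meas[OF that] f_measurable_m0[OF True]
        by (intro borel_measurable_le borel_measurable_diff borel_measurable_add) auto
      finally show ?thesis .
    next
      case False
      then have "{y \<in> space m\<^sub>0. \<nu> u y \<le> t} = {}"
        using \<nu>0[of _ u] unfolding space_m0 by force
      then show ?thesis by (metis sets.empty_sets)
    qed
  qed
  have s_meas: "(\<lambda>y. softmax \<epsilon> N (A u y) i) \<in> borel_measurable m\<^sub>0" if "i < N" for u i
    using borel_measurable_softmax[OF that A_meas] .
  have s_bound: "\<bar>softmax \<epsilon> N (A u y) i\<bar> \<le> 1" if "i < N" for u y i
    using softmax_nonneg softmax_le_1[OF that] by (simp add: abs_le_iff)
  have \<eta>_meas: "\<eta> j \<in> borel_measurable m\<^sub>0" if "j < K" for j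
    using \<eta>(1)[OF that] by (intro measurable_m0) auto
  have prod_bound: "\<bar>k * \<nu> u y\<bar> \<le> V" if "u \<in> Q" "y \<in> Y" "\<bar>k\<bar> \<le> 1" for u y and k :: real
    using mult_mono[OF that(3) \<nu>V[OF that(1,2)]] \<nu>0[OF that(2), of u] by (simp add: abs_mult)
  have int_s: "integrable m\<^sub>0 (\<lambda>y. softmax \<epsilon> N (A u y) i * \<nu> u y)" if "u \<in> Q" "i < N" for u i
    using s_meas \<nu>_meas s_bound prod_bound that by (intro integrable_m0[of _ V]) auto
  have int_\<eta>: "integrable m\<^sub>0 (\<lambda>y. \<eta> j y * \<nu> u y)" if "u \<in> Q" "j < K" for u j
    using \<eta>_meas \<nu>_meas \<eta>1 prod_bound that by (intro integrable_m0[of _ V]) auto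
  have int_\<nu>: "integrable m\<^sub>0 (\<nu> u)" if "u \<in> Q" for u
    using \<nu>_meas \<nu>V \<nu>0 that by (intro integrable_m0[of _ V]) auto
  have T0: "0 \<le> T u" for u
    unfolding T_def using \<nu>0 space_m0 by (intro integral_nonneg_AE AE_I2) auto
  have H0: "0 \<le> H u j" if "j < K" for u j
    unfolding H_def using \<nu>0 \<eta>(1)[OF that] space_m0 by (intro integral_nonneg_AE AE_I2) auto
  have HT: "H u j \<le> T u" if "u \<in> Q" "j < K" for u j
    unfolding H_def T_def
  proof (rule integral_mono[OF int_\<eta>[OF that] int_\<nu>[OF that(1)]])
    fix y assume "y \<in> space m\<^sub>0"
    then show "\<eta> j y * \<nu> u y \<le> \<nu> u y"
      using \<eta>1[OF that(2), of y] \<nu>0[of y u] mult_right_mono[of "\<eta> j y" 1 "\<nu> u y"] space_m0 by auto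
  qed
  have sum\<Gamma>: "(\<Sum>i<N. \<Gamma> u i) = T u" if "u \<in> Q" for u
  proof -
    have "(\<Sum>i<N. \<Gamma> u i) = (\<integral>y. (\<Sum>i<N. softmax \<epsilon> N (A u y) i * \<nu> u y) \<partial>m\<^sub>0)"
      unfolding \<Gamma>_def using int_s[OF that] by (subst Bochner_Integration.integral_sum) auto
    also have "\<dots> = T u"
      unfolding T_def sum_distrib_right[symmetric] sum_softmax[OF N] by simp
    finally show ?thesis .
  qed
  have sumH: "(\<Sum>j<K. H u j) = T u" if "u \<in> Q" for u
  proof -
    have "(\<Sum>j<K. H u j) = (\<integral>y. (\<Sum>j<K. \<eta> j y * \<nu> u y) \<partial>m\<^sub>0)"
      unfolding H_def using int_\<eta>[OF that] by (subst Bochner_Integration.integral_sum) auto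
    also have "\<dots> = T u"
      unfolding T_def sum_distrib_right[symmetric] using \<eta>(2) space_m0
      by (intro Bochner_Integration.integral_cong) auto
    finally show ?thesis .
  qed

  \<comment> \<open>Continuity and face conditions\<close>
  have "\<exists>u\<in>Q. \<forall>i<n. G i u = 0"
  proof (rule poincare_miranda[of n a b G, folded Q_def])
    show "a i \<le> b i" for i using U L by (simp add: a_def b_def)
  next
    fix i and u :: "nat \<Rightarrow> nat \<Rightarrow> real" and x'
    assume i: "i < n" and u: "\<And>k. u k \<in> Q" and x': "x' \<in> Q" and lim: "\<And>j. j < n \<Longrightarrow> (\<lambda>k. u k j) \<longlonglongrightarrow> x' j"
    have lim\<phi>: "(\<lambda>k. A (u k) y i) \<longlonglongrightarrow> A x' y i" if "i < N" for y i
      unfolding A_def using that by (intro tendsto_intros lim) (simp add: n_def)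
    have limw: "(\<lambda>k. w (u k)) \<longlonglongrightarrow> w x'"
      unfolding w_def by (intro tendsto_intros lim) (simp add: n_def)
    have limv: "(\<lambda>k. v (u k) j) \<longlonglongrightarrow> v x' j" if "j < K" for j
    proof -
      have "(\<lambda>k. max 1 (w (u k))) \<longlonglongrightarrow> max 1 (w x')" by (intro tendsto_intros limw)
      moreover have "max 1 (w x') \<noteq> 0" by (simp add: max_def)
      ultimately show ?thesis
        unfolding v_def using that
        by (cases "j = 0") (auto intro!: tendsto_intros lim limw simp: n_def)
    qed
    \<comment> \<open>Convergent weights give weakly convergent atomic measures; continuity of
      \<open>I\<close> is thus used along finitely many numbers.\<close>
    have "uniform_limit Y (\<lambda>k. g (u k)) (g x') sequentially"
      unfolding g_def
    proof (rule I_limit)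
      fix k :: "'b \<Rightarrow> real" assume k: "continuous_on Y k"
      have eq: "integral\<^sup>L (atoms Y K z (v u)) k = (\<Sum>j<K. v u j * k (z j))" if "u \<in> Q" for u
        using \<eta>(1) v0[OF that] k by (intro integral_atoms) auto
      have "(\<lambda>n. \<Sum>j<K. v (u n) j * k (z j)) \<longlonglongrightarrow> (\<Sum>j<K. v x' j * k (z j))"
        by (intro tendsto_intros limv) auto
      then show "(\<lambda>n. integral\<^sup>L (atoms Y K z (v (u n))) k) \<longlonglongrightarrow> integral\<^sup>L (atoms Y K z (v x')) k"
        using eq u x' by simp
    qed (use atoms u x' in auto)
    then have limg: "(\<lambda>k. g (u k) y) \<longlonglongrightarrow> g x' y" if "y \<in> Y" for y
      using that by (rule tendsto_uniform_limitI)
    have lim\<nu>: "(\<lambda>k. \<nu> (u k) y) \<longlonglongrightarrow> \<nu> x' y" if "y \<in> Y" for y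
      unfolding \<nu>_def using that
      by (intro inv_tendsto tendsto_diff tendsto_peak N lim\<phi> limg) auto
    have limT: "(\<lambda>k. T (u k)) \<longlonglongrightarrow> T x'"
      unfolding T_def
    proof (rule integral_dominated_convergence[where w = "\<lambda>_. V"])
      show "AE y in m\<^sub>0. (\<lambda>k. \<nu> (u k) y) \<longlonglongrightarrow> \<nu> x' y"
        using lim\<nu> space_m0 by (intro AE_I2) auto
      show "AE y in m\<^sub>0. norm (\<nu> (u k) y) \<le> V" for k
        using \<nu>V[OF u] \<nu>0 space_m0 by (intro AE_I2) auto
    qed (use \<nu>_meas u x' in auto)
    have lim\<Gamma>: "(\<lambda>k. \<Gamma> (u k) i) \<longlonglongrightarrow> \<Gamma> x' i" if "i < N" for i
      unfolding \<Gamma>_def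
    proof (rule integral_dominated_convergence[where w = "\<lambda>_. V"])
      show "AE y in m\<^sub>0. (\<lambda>k. softmax \<epsilon> N (A (u k) y) i * \<nu> (u k) y) \<longlonglongrightarrow> softmax \<epsilon> N (A x' y) i * \<nu> x' y"
        using lim\<nu> space_m0 that lim\<phi> by (intro AE_I2 tendsto_mult tendsto_softmax) auto
      show "AE y in m\<^sub>0. norm (softmax \<epsilon> N (A (u k) y) i * \<nu> (u k) y) \<le> V" for k
        using prod_bound[OF u _ s_bound[OF that]] space_m0 by (intro AE_I2) auto
    qed (use \<nu>_meas s_meas that u x' in auto)
    have limH: "(\<lambda>k. H (u k) j) \<longlonglongrightarrow> H x' j" if "j < K" for j
      unfolding H_def
    proof (rule integral_dominated_convergence[where w = "\<lambda>_. V"])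
      show "AE y in m\<^sub>0. (\<lambda>k. \<eta> j y * \<nu> (u k) y) \<longlonglongrightarrow> \<eta> j y * \<nu> x' y"
        using lim\<nu> space_m0 by (intro AE_I2 tendsto_mult) auto
      show "AE y in m\<^sub>0. norm (\<eta> j y * \<nu> (u k) y) \<le> V" for k
        using prod_bound[OF u _ \<eta>1[OF that]] space_m0 by (intro AE_I2) auto
    qed (use \<nu>_meas \<eta>_meas that u x' in auto)
    show "(\<lambda>k. G i (u k)) \<longlonglongrightarrow> G i x'"
    proof (cases "i < N")
      case True
      then show ?thesis unfolding G_def by (simp add: tendsto_diff lim\<Gamma>)
    next
      case False
      have "max 1 (T x') \<noteq> 0" by (simp add: max_def)
      then show ?thesis
        unfolding G_def using False i by (auto intro!: tendsto_intros lim limH limT simp: n_def)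
    qed
  next
    fix i u assume i: "i < n" and u: "u \<in> Q" and ui: "u i = a i"
    show "G i u \<le> 0"
    proof (cases "i < N")
      case True
      have "\<Gamma> u i \<le> (\<integral>y. exp ((D - L) / \<epsilon>) * V \<partial>m\<^sub>0)"
        unfolding \<Gamma>_def
      proof (rule integral_mono[OF int_s[OF u True]])
        fix y assume "y \<in> space m\<^sub>0"
        then have y: "y \<in> Y" by (simp add: space_m0)
        show "softmax \<epsilon> N (A u y) i * \<nu> u y \<le> exp ((D - L) / \<epsilon>) * V"
        proof (cases "0 < \<nu> u y")
          case pos: True
          obtain l where l: "l < N" "peak N (A u y) = A u y l" using peak_attained[OF N] by metis
          have "- 1 / C \<le> h y (\<nu> u y)"
            using f_lower[OF y \<nu>0[OF y]] mult_nonneg_nonneg[OF less_imp_le[OF \<delta>] \<nu>0[OF y]]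
            unfolding h_def by (metis add_increasing2)
          then have "- 1 / C - G0 \<le> A u y l"
            using \<nu>_eq[OF y pos] l g_bound[OF u y] by linarith
          moreover have "A u y i \<le> - L + A0"
            using A_bound[OF True y, of u] ui True by (simp add: a_def)
          ultimately have "A u y i - A u y l \<le> D - L"
            by (simp add: D_def)
          then have "softmax \<epsilon> N (A u y) i \<le> exp ((D - L) / \<epsilon>)"
            using softmax_le_exp[OF True l(1), of \<epsilon> "A u y"] \<epsilon>
            by (smt (verit) divide_right_mono exp_le_cancel_iff)
          then show ?thesis
            using \<nu>V[OF u y] \<nu>0[OF y] softmax_nonneg by (intro mult_mono) auto
        next
          case False
          then have "\<nu> u y = 0" using \<nu>0[OF y, of u] by simp
          then show ?thesis using V by simp
        qed
      qed simp
      also have "\<dots> = exp ((D - L) / \<epsilon>) * (V * M0)"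
        by (simp add: space_m0 M0_def)
      also have "\<dots> \<le> m i" using L_small m1(2)[OF True] by linarith
      finally show ?thesis using True by (simp add: G_def)
    next
      case False
      then have "0 \<le> H u (i - N) / max 1 (T u)"
        using H0 i by (intro divide_nonneg_nonneg) (auto simp: n_def)
      then show ?thesis using False ui by (simp add: G_def a_def)
    qed
  next
    fix i u assume i: "i < n" and u: "u \<in> Q" and ui: "u i = b i"
    show "0 \<le> G i u"
    proof (cases "i < N")
      case True
      have "m i \<le> (\<Sum>i<N. m i)"
        using x True by (intro member_le_sum) (auto intro: less_imp_le)
      also have "\<dots> = 1" by (rule m)
      also have "1 = (\<integral>y. \<kappa> * t0 \<partial>m\<^sub>0)"
        using \<kappa> M0 by (simp add: space_m0 M0_def[symmetric] t0_def)
      also have "\<dots> \<le> \<Gamma> u i"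
        unfolding \<Gamma>_def
      proof (rule integral_mono[OF _ int_s[OF u True]])
        fix y assume "y \<in> space m\<^sub>0"
        then have y: "y \<in> Y" by (simp add: space_m0)
        have "A u y l \<le> A u y i + 2 * A0" if "l < N" for l
          using A_bound[OF that y, of u] A_bound[OF True y, of u] Q\<phi>[OF u that] ui True by (simp add: b_def)
        then have "\<kappa> \<le> softmax \<epsilon> N (A u y) i"
          unfolding \<kappa>_def by (intro softmax_ge_exp True \<epsilon>) auto
        moreover have "t0 \<le> \<nu> u y"
        proof (rule ccontr)
          assume "\<not> ?thesis"
          then have "0 < \<delta> * (t0 - \<nu> u y)" "\<nu> u y \<le> t0" using \<delta> by auto
          then have "h y (\<nu> u y) < h y t0"
            using h_props(2)[OF y \<nu>0[OF y], of u t0] by linarith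
          also have "h y t0 \<le> C * (t0 powr \<alpha> + 1) + \<delta> * t0"
            using growth[OF y, of t0] t0 by (simp add: h_def)
          also have "\<dots> = U - A0 - G0" by (simp add: U_def)
          also have "\<dots> \<le> peak N (A u y) - g u y"
            using peak_ge[OF True, of "A u y"] A_bound[OF True y, of u] ui True g_bound[OF u y] by (simp add: b_def)
          also have "\<dots> \<le> h y (\<nu> u y)" by (rule \<nu>_ge[OF y])
          finally show False by simp
        qed
        ultimately show "\<kappa> * t0 \<le> softmax \<epsilon> N (A u y) i * \<nu> u y"
          using \<kappa> t0 by (intro mult_mono) auto
      qed simp
      finally show ?thesis using True by (simp add: G_def)
    next
      case False
      then have "H u (i - N) \<le> max 1 (T u)"
        using HT[OF u, of "i - N"] i by (simp add: n_def le_max_iff_disj)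
      then have "H u (i - N) / max 1 (T u) \<le> 1"
        by (simp add: pos_divide_le_eq max_def split: if_splits)
      then show ?thesis using False ui by (simp add: G_def b_def)
    qed
  qed
  then obtain u where u: "u \<in> Q" "\<And>i. i < n \<Longrightarrow> G i u = 0"
    by blast
  have \<Gamma>m: "\<Gamma> u i = m i" if "i < N" for i
    using u(2)[of i] that by (simp add: G_def n_def)
  \<comment> \<open>The equations unlock in this order: the type masses give total mass 1, so the
    truncation in \<open>G\<close> is inactive and the weights equal \<open>H\<close>; these sum to
    1, so the normalization in \<open>v\<close> is inactive too.\<close>
  then have T1: "T u = 1"
    using sum\<Gamma>[OF u(1)] m by simp
  have uH: "u (N + j) = H u j" if "j < K" for j
    using u(2)[of "N + j"] that T1 by (simp add: G_def n_def)
  have w1: "w u = 1"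
    using sumH[OF u(1)] T1 uH by (simp add: w_def)
  have vH: "v u j = H u j" if "j < K" for j
    using uH[OF that] w1 by (simp add: v_def)
  show ?thesis
  proof (rule exI[of _ u], rule exI[of _ "v u"], rule exI[of _ "\<nu> u"], rule exI[of _ V],
      intro conjI allI impI ballI)
    fix y assume y: "y \<in> Y"
    show "peak N (\<lambda>i. u i - c (x i) y) \<le> f y (\<nu> u y) + \<delta> * \<nu> u y + I (atoms Y K z (v u)) y"
      using \<nu>_ge[OF y, of u] by (simp add: A_def[abs_def] h_def g_def)
    show "peak N (\<lambda>i. u i - c (x i) y) = f y (\<nu> u y) + \<delta> * \<nu> u y + I (atoms Y K z (v u)) y"
      if "0 < \<nu> u y"
      using \<nu>_eq[OF y that] by (simp add: A_def[abs_def] h_def g_def)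
    show "0 \<le> \<nu> u y" "\<nu> u y \<le> V" using \<nu>0 \<nu>V u y by auto
  next
    show "0 \<le> v u j" if "j < K" for j by (rule v0[OF u(1) that])
    show "(\<Sum>j<K. v u j) = 1" by (rule v1)
  qed (use v0 v1 \<nu>_meas u vH \<Gamma>m in \<open>auto simp: H_def \<Gamma>_def A_def[abs_def]\<close>)
qed

end

section \<open>Approximate equilibria\<close>

text \<open>Builds the action plan of finitely many types: type \<open>x i\<close> distributes its
  mass over the slice above \<open>x i\<close> with density \<open>s i\<close>. It is the image of a
  measure on indices times actions, so equal types simply add up.\<close>

lemma weighted_graphs_measure:
  fixes M :: "'b::metric_space measure" and x :: "nat \<Rightarrow> 'a::metric_space" and s :: "nat \<Rightarrow> 'b \<Rightarrow> real"
  assumes M: "finite_measure M" "sets M = sets (borel_on Y)" and XY: "compact X" "compact Y"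
    and x: "\<And>i. i < N \<Longrightarrow> x i \<in> X"
    and s: "\<And>i. i < N \<Longrightarrow> s i \<in> borel_measurable M" "\<And>i y. i < N \<Longrightarrow> y \<in> Y \<Longrightarrow> 0 \<le> s i y \<and> s i y \<le> B"
    and s1: "(\<Sum>i<N. integral\<^sup>L M (s i)) = 1"
  shows "\<exists>\<gamma>\<in>borel_probs (X \<times> Y). \<forall>F::'a \<times> 'b \<Rightarrow> real. continuous_on (X \<times> Y) F \<longrightarrow>
    integral\<^sup>L \<gamma> F = (\<Sum>i<N. \<integral>y. s i y * F (x i, y) \<partial>M)"
proof -
  interpret M: finite_measure M by fact
  interpret cs: finite_measure "count_space {..<N}" by (rule finite_measure_count_space) simp
  interpret P: pair_sigma_finite "count_space {..<N}" M ..
  let ?W = "count_space {..<N} \<Otimes>\<^sub>M M"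
  interpret W: finite_measure ?W
    by (rule finite_measure_pair_measure) (unfold_locales)
  have spaceM: "space M = Y"
    using sets_eq_imp_space_eq[OF M(2)] by (simp add: space_restrict_space)
  have spaceW: "space ?W = {..<N} \<times> Y"
    by (simp add: space_pair_measure spaceM)
  have measM: "g \<in> measurable M L" if "g \<in> measurable (borel_on Y) L" for g and L :: "'c measure"
    using that measurable_cong_sets[OF M(2) refl] by blast
  define \<rho> where "\<rho> = (\<lambda>(i, y::'b). s i y)"
  have \<rho>_meas: "\<rho> \<in> borel_measurable ?W"
    by (rule measurable_pair_measure_countable1) (use s in \<open>auto simp: \<rho>_def\<close>)
  have \<rho>0: "AE p in ?W. 0 \<le> \<rho> p"
    using s by (intro AE_I2) (auto simp: spaceW \<rho>_def)
  define q where "q = (\<lambda>(i, y::'b). (x i, y))"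
  have q: "q \<in> measurable ?W (borel_on (X \<times> Y))"
  proof (rule measurable_pair_measure_countable1)
    fix i assume "i \<in> {..<N}"
    then have "x i \<in> X" using x by simp
    have "(\<lambda>y. (x i, y)) \<in> borel_measurable (borel_on Y)"
      by (intro borel_measurable_continuous_on_restrict continuous_intros)
    then show "(\<lambda>y. q (i, y)) \<in> measurable M (borel_on (X \<times> Y))"
      unfolding q_def using \<open>x i \<in> X\<close> spaceM by (intro measurable_restrict_space2) (auto intro: measM)
  qed simp
  define \<gamma> where "\<gamma> = distr (density ?W \<rho>) (borel_on (X \<times> Y)) q"
  have integral: "integral\<^sup>L \<gamma> F = (\<Sum>i<N. \<integral>y. s i y * F (x i, y) \<partial>M)"
    if F: "continuous_on (X \<times> Y) F" for F :: "'a \<times> 'b \<Rightarrow> real"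
  proof -
    have Fm: "F \<in> borel_measurable (borel_on (X \<times> Y))"
      by (rule borel_measurable_continuous_on_restrict[OF F])
    obtain A where A: "0 \<le> A" "\<And>p. p \<in> X \<times> Y \<Longrightarrow> \<bar>F p\<bar> \<le> A"
      using continuous_on_compact_abs_bound[OF compact_Times[OF XY] F] by metis
    have Fq: "(\<lambda>p. F (q p)) \<in> borel_measurable ?W"
      using measurable_compose[OF q Fm] .
    have int: "integrable ?W (\<lambda>p. \<rho> p * F (q p))"
    proof (rule W.integrable_const_bound[of _ "B * A"])
      show "AE p in ?W. norm (\<rho> p * F (q p)) \<le> B * A"
      proof (rule AE_I2)
        fix p assume "p \<in> space ?W"
        then obtain i y where p: "p = (i, y)" "i < N" "y \<in> Y" by (auto simp: spaceW)
        then show "norm (\<rho> p * F (q p)) \<le> B * A"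
          using s(2)[of i y] A(2)[of "(x i, y)"] x[of i]
          unfolding real_norm_def abs_mult by (intro mult_mono) (auto simp: \<rho>_def q_def)
      qed
    qed (use \<rho>_meas Fq in auto)
    have "integral\<^sup>L \<gamma> F = (\<integral>p. \<rho> p * F (q p) \<partial>?W)"
      unfolding \<gamma>_def using q Fm Fq \<rho>_meas \<rho>0 by (simp add: integral_distr integral_density)
    also have "\<dots> = (\<integral>i. (\<integral>y. \<rho> (i, y) * F (q (i, y)) \<partial>M) \<partial>count_space {..<N})"
      by (rule P.integral_fst'[OF int, symmetric])
    also have "\<dots> = (\<Sum>i<N. \<integral>y. \<rho> (i, y) * F (q (i, y)) \<partial>M)"
      by (rule lebesgue_integral_count_space_finite) simp
    finally show ?thesis by (simp add: \<rho>_def q_def)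
  qed
  have "\<gamma> \<in> borel_probs (X \<times> Y)"
  proof -
    have Bs: "integrable M (s i)" if "i < N" for i
      using s that spaceM by (intro M.integrable_const_bound[of _ B]) (auto intro!: AE_I2)
    have "emeasure \<gamma> (space \<gamma>) = (\<integral>\<^sup>+ p. ennreal (\<rho> p) \<partial>?W)"
      using q \<rho>_meas measurable_space[OF q] unfolding \<gamma>_def
      by (subst emeasure_distr) (auto simp: emeasure_density intro!: nn_integral_cong split: split_indicator)
    also have "\<dots> = (\<integral>\<^sup>+ i. (\<integral>\<^sup>+ y. ennreal (s i y) \<partial>M) \<partial>count_space {..<N})"
      using \<rho>_meas by (subst M.nn_integral_fst[symmetric]) (auto simp: \<rho>_def)
    also have "\<dots> = (\<Sum>i<N. \<integral>\<^sup>+ y. ennreal (s i y) \<partial>M)"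
      by (rule nn_integral_count_space_finite) simp
    also have "\<dots> = (\<Sum>i<N. ennreal (integral\<^sup>L M (s i)))"
      using Bs s spaceM by (intro sum.cong refl nn_integral_eq_integral AE_I2) auto
    also have "\<dots> = 1"
      using s spaceM by (subst sum_ennreal) (auto intro!: integral_nonneg_AE AE_I2 simp: s1)
    finally have "prob_space \<gamma>" by (rule prob_spaceI)
    then show ?thesis by (simp add: borel_probs_def \<gamma>_def)
  qed
  with integral show ?thesis by blast
qed

context congestion_game begin

text \<open>\<open>P\<close> plays the role of the congestion term \<open>\<V>[\<nu>]\<close> on the support of \<open>\<nu>\<close>.\<close>

definition conjugate :: "('a \<Rightarrow> real) \<Rightarrow> ('b \<Rightarrow> real) \<Rightarrow> bool" where
  "conjugate \<phi> P \<longleftrightarrow> (\<forall>x\<in>X. \<forall>y\<in>Y. \<phi> x \<le> P y + c x y) \<and>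
    (\<forall>y\<in>Y. \<exists>x\<in>X. \<phi> x = P y + c x y) \<and> (\<forall>x\<in>X. \<exists>y\<in>Y. \<phi> x = P y + c x y)"

lemma conjugate_le: "conjugate \<phi> P \<Longrightarrow> x \<in> X \<Longrightarrow> y \<in> Y \<Longrightarrow> \<phi> x \<le> P y + c x y"
  by (simp add: conjugate_def)

text \<open>An action that is optimal for one type is a competitor for the other, so the two costs
  differ by no more than \<open>c\<close> does at that action.\<close>

lemma conjugate_left_close:
  assumes "conjugate \<phi> P" "x \<in> X" "x' \<in> X" "\<And>y. y \<in> Y \<Longrightarrow> \<bar>c x y - c x' y\<bar> \<le> d"
  shows "\<bar>\<phi> x - \<phi> x'\<bar> \<le> d"
proof -
  have *: "\<phi> x \<le> \<phi> x' + d" if t: "x \<in> X" "x' \<in> X" "\<And>y. y \<in> Y \<Longrightarrow> \<bar>c x y - c x' y\<bar> \<le> d" for x x'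
  proof -
    obtain y where "y \<in> Y" "\<phi> x' = P y + c x' y"
      using assms(1) t by (auto simp: conjugate_def)
    then show ?thesis
      using conjugate_le[OF assms(1), of x y] t(1) t(3)[of y] by linarith
  qed
  show ?thesis
    using *[OF assms(2-4)] *[OF assms(3,2)] assms(4) by (simp add: abs_minus_commute abs_le_iff)
qed

lemma conjugate_right_close:
  assumes "conjugate \<phi> P" "y \<in> Y" "y' \<in> Y" "\<And>x. x \<in> X \<Longrightarrow> \<bar>c x y - c x y'\<bar> \<le> d"
  shows "\<bar>P y - P y'\<bar> \<le> d"
proof -
  have *: "P y \<le> P y' + d" if t: "y \<in> Y" "y' \<in> Y" "\<And>x. x \<in> X \<Longrightarrow> \<bar>c x y - c x y'\<bar> \<le> d" for y y'
  proof -
    obtain x where "x \<in> X" "\<phi> x = P y + c x y"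
      using assms(1) t by (auto simp: conjugate_def)
    then show ?thesis
      using conjugate_le[OF assms(1), of x y'] t(2) t(3)[of x] by linarith
  qed
  show ?thesis
    using *[OF assms(2-4)] *[OF assms(3,2)] assms(4) by (simp add: abs_minus_commute abs_le_iff)
qed

lemma c_equicontinuous:
  assumes "d > 0"
  obtains e where "e > 0"
    "\<And>x x' y. x \<in> X \<Longrightarrow> x' \<in> X \<Longrightarrow> y \<in> Y \<Longrightarrow> dist x x' < e \<Longrightarrow> \<bar>c x y - c x' y\<bar> < d"
    "\<And>x y y'. x \<in> X \<Longrightarrow> y \<in> Y \<Longrightarrow> y' \<in> Y \<Longrightarrow> dist y y' < e \<Longrightarrow> \<bar>c x y - c x y'\<bar> < d"
proof -
  have "uniformly_continuous_on (X \<times> Y) (\<lambda>(x, y). c x y)"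
    by (intro compact_uniformly_continuous c compact_Times X Y)
  then obtain e where e: "e > 0"
    "\<And>p q. p \<in> X \<times> Y \<Longrightarrow> q \<in> X \<times> Y \<Longrightarrow> dist q p < e \<Longrightarrow> dist (case q of (x, y) \<Rightarrow> c x y) (case p of (x, y) \<Rightarrow> c x y) < d"
    using assms unfolding uniformly_continuous_on_def by metis
  show ?thesis
  proof (rule that[OF e(1)])
    show "\<bar>c x y - c x' y\<bar> < d" if "x \<in> X" "x' \<in> X" "y \<in> Y" "dist x x' < e" for x x' y
      using e(2)[of "(x', y)" "(x, y)"] that by (simp add: dist_Pair_Pair dist_real_def)
    show "\<bar>c x y - c x y'\<bar> < d" if "x \<in> X" "y \<in> Y" "y' \<in> Y" "dist y y' < e" for x y y'
      using e(2)[of "(x, y')" "(x, y)"] that by (simp add: dist_Pair_Pair dist_real_def)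
  qed
qed

lemma conjugate_continuous:
  assumes "conjugate \<phi> P"
  shows "continuous_on X \<phi>" "continuous_on Y P"
proof -
  have *: "\<exists>e>0. (\<forall>x\<in>X. \<forall>x'\<in>X. dist x x' < e \<longrightarrow> \<bar>\<phi> x - \<phi> x'\<bar> < d) \<and>
      (\<forall>y\<in>Y. \<forall>y'\<in>Y. dist y y' < e \<longrightarrow> \<bar>P y - P y'\<bar> < d)" if "d > 0" for d
  proof -
    obtain e where e: "e > 0"
      "\<And>x x' y. x \<in> X \<Longrightarrow> x' \<in> X \<Longrightarrow> y \<in> Y \<Longrightarrow> dist x x' < e \<Longrightarrow> \<bar>c x y - c x' y\<bar> < d / 2"
      "\<And>x y y'. x \<in> X \<Longrightarrow> y \<in> Y \<Longrightarrow> y' \<in> Y \<Longrightarrow> dist y y' < e \<Longrightarrow> \<bar>c x y - c x y'\<bar> < d / 2"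
      using c_equicontinuous[of "d / 2"] \<open>d > 0\<close> by (metis half_gt_zero)
    have "\<bar>\<phi> x - \<phi> x'\<bar> \<le> d / 2" if "x \<in> X" "x' \<in> X" "dist x x' < e" for x x'
      by (rule conjugate_left_close[OF assms that(1,2)]) (use e(2) that in force)
    moreover have "\<bar>P y - P y'\<bar> \<le> d / 2" if "y \<in> Y" "y' \<in> Y" "dist y y' < e" for y y'
      by (rule conjugate_right_close[OF assms that(1,2)]) (use e(3) that in force)
    moreover have "d / 2 < d" using \<open>d > 0\<close> by simp
    ultimately show ?thesis
      using e(1) by (meson le_less_trans)
  qed
  show "continuous_on X \<phi>"
    unfolding continuous_on_iff dist_real_def
  proof (intro ballI allI impI)
    fix x and d :: real assume "x \<in> X" "d > 0"
    from *[OF this(2)] this(1) show "\<exists>e>0. \<forall>x'\<in>X. dist x' x < e \<longrightarrow> \<bar>\<phi> x' - \<phi> x\<bar> < d"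
      by blast
  qed
  show "continuous_on Y P"
    unfolding continuous_on_iff dist_real_def
  proof (intro ballI allI impI)
    fix y and d :: real assume "y \<in> Y" "d > 0"
    from *[OF this(2)] this(1) show "\<exists>e>0. \<forall>y'\<in>Y. dist y' y < e \<longrightarrow> \<bar>P y' - P y\<bar> < d"
      by blast
  qed
qed

text \<open>One parameter \<open>e\<close> is at once the mesh of both discretizations, the slope
  added to \<open>f\<close> and the total optimality slack. \<open>\<nu>\<close> is the density of
  the second marginal of the plan, while \<open>\<sigma>\<close> is the nearby measure seen by
  \<open>I\<close>. Closeness is tested by functions with oscillation at most \<open>d\<close> at
  scale \<open>e\<close>, a form that passes to the limit for each fixed continuous
  function.\<close>

definition approx_equilibrium ::
  "real \<Rightarrow> ('a \<Rightarrow> real) \<Rightarrow> ('b \<Rightarrow> real) \<Rightarrow> ('b \<Rightarrow> real) \<Rightarrow> 'b measure \<Rightarrow> ('a \<times> 'b) measure \<Rightarrow> bool" where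
  "approx_equilibrium e \<phi> P \<nu> \<sigma> \<gamma> \<longleftrightarrow>
    \<gamma> \<in> borel_probs (X \<times> Y) \<and> \<sigma> \<in> borel_probs Y \<and> conjugate \<phi> P \<and>
    \<nu> \<in> borel_measurable m\<^sub>0 \<and> integrable m\<^sub>0 \<nu> \<and> (\<forall>y\<in>Y. 0 \<le> \<nu> y) \<and>
    (\<forall>k::'b \<Rightarrow> real. continuous_on Y k \<longrightarrow> (\<integral>p. k (snd p) \<partial>\<gamma>) = (\<integral>y. k y * \<nu> y \<partial>m\<^sub>0)) \<and>
    (\<forall>(k::'a \<Rightarrow> real) d. continuous_on X k \<longrightarrow> (\<forall>x\<in>X. \<forall>x'\<in>X. dist x x' < e \<longrightarrow> \<bar>k x - k x'\<bar> \<le> d) \<longrightarrow>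
      \<bar>(\<integral>p. k (fst p) \<partial>\<gamma>) - integral\<^sup>L \<mu> k\<bar> \<le> d) \<and>
    (\<forall>(k::'b \<Rightarrow> real) d. continuous_on Y k \<longrightarrow> (\<forall>y\<in>Y. \<forall>y'\<in>Y. dist y y' < e \<longrightarrow> \<bar>k y - k y'\<bar> \<le> d) \<longrightarrow>
      \<bar>integral\<^sup>L \<sigma> k - (\<integral>y. k y * \<nu> y \<partial>m\<^sub>0)\<bar> \<le> d) \<and>
    (\<integral>p. P (snd p) + c (fst p) (snd p) - \<phi> (fst p) \<partial>\<gamma>) \<le> e \<and>
    (\<forall>y\<in>Y. P y \<le> f y (\<nu> y) + e * \<nu> y + I \<sigma> y \<and>
      (0 < \<nu> y \<longrightarrow> P y = f y (\<nu> y) + e * \<nu> y + I \<sigma> y))"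

lemma approx_equilibrium_exists:
  assumes e: "e > 0"
  shows "\<exists>\<phi> P \<nu> \<sigma> \<gamma>. approx_equilibrium e \<phi> P \<nu> \<sigma> \<gamma>"
proof -
  obtain N :: nat and x m where x: "\<And>i. i < N \<Longrightarrow> x i \<in> X \<and> 0 < m i" and m: "(\<Sum>i<N. m i) = (1::real)"
    and \<mu>_close: "\<And>k d. continuous_on X k \<Longrightarrow> (\<forall>x\<in>X. \<forall>x'\<in>X. dist x x' < e \<longrightarrow> \<bar>k x - k x'\<bar> \<le> d) \<Longrightarrow>
      \<bar>(\<Sum>i<N. m i * k (x i)) - integral\<^sup>L \<mu> k\<bar> \<le> d"
    using discretize_probability[OF \<mu> X e] by blast
  have N: "0 < N" using m by (cases N) auto
  from fine_partition_of_unity[OF Y Y_nonempty e]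
  obtain K :: nat and z and \<eta> :: "nat \<Rightarrow> 'b \<Rightarrow> real" where "0 < K \<and>
      (\<forall>i<K. z i \<in> Y \<and> continuous_on Y (\<eta> i) \<and> (\<forall>x\<in>Y. 0 \<le> \<eta> i x \<and> (\<eta> i x \<noteq> 0 \<longrightarrow> dist x (z i) < e))) \<and>
      (\<forall>x\<in>Y. (\<Sum>i<K. \<eta> i x) = (1::real))" by (elim exE)
  then have K: "0 < K" and \<eta>: "\<And>i. i < K \<Longrightarrow> z i \<in> Y \<and> continuous_on Y (\<eta> i) \<and>
      (\<forall>x\<in>Y. 0 \<le> \<eta> i x \<and> (\<eta> i x \<noteq> 0 \<longrightarrow> dist x (z i) < e))" "\<And>x. x \<in> Y \<Longrightarrow> (\<Sum>i<K. \<eta> i x) = (1::real)"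
    by blast+
  \<comment> \<open>By \<open>softmax_gap\<close> each type contributes a slack of at most
    \<open>\<epsilon>\<close> times the total mass 1, and there are \<open>N\<close> types.\<close>
  define \<epsilon> where "\<epsilon> = e / N"
  have \<epsilon>: "\<epsilon> > 0" using e N by (simp add: \<epsilon>_def)
  have "\<exists>\<psi> v \<nu> B. (\<forall>j<K. 0 \<le> v j) \<and> (\<Sum>j<K. v j) = 1 \<and>
    \<nu> \<in> borel_measurable m\<^sub>0 \<and> (\<forall>y\<in>Y. 0 \<le> \<nu> y \<and> \<nu> y \<le> B) \<and>
    (\<forall>j<K. v j = (\<integral>y. \<eta> j y * \<nu> y \<partial>m\<^sub>0)) \<and>
    (\<forall>i<N. (\<integral>y. softmax \<epsilon> N (\<lambda>i. \<psi> i - c (x i) y) i * \<nu> y \<partial>m\<^sub>0) = m i) \<and>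
    (\<forall>y\<in>Y. peak N (\<lambda>i. \<psi> i - c (x i) y) \<le> f y (\<nu> y) + e * \<nu> y + I (atoms Y K z v) y \<and>
      (0 < \<nu> y \<longrightarrow> peak N (\<lambda>i. \<psi> i - c (x i) y) = f y (\<nu> y) + e * \<nu> y + I (atoms Y K z v) y))"
    by (rule finite_equilibrium[OF N x m K]) (use \<eta> \<epsilon> e in auto)
  then obtain \<psi> v \<nu> B where v0: "\<And>j. j < K \<Longrightarrow> 0 \<le> v j" and v1: "(\<Sum>j<K. v j) = 1"
    and \<nu>_meas: "\<nu> \<in> borel_measurable m\<^sub>0" and \<nu>0: "\<And>y. y \<in> Y \<Longrightarrow> 0 \<le> \<nu> y" and \<nu>B: "\<And>y. y \<in> Y \<Longrightarrow> \<nu> y \<le> B"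
    and v: "\<And>j. j < K \<Longrightarrow> v j = (\<integral>y. \<eta> j y * \<nu> y \<partial>m\<^sub>0)"
    and mi: "\<And>i. i < N \<Longrightarrow> (\<integral>y. softmax \<epsilon> N (\<lambda>i. \<psi> i - c (x i) y) i * \<nu> y \<partial>m\<^sub>0) = m i"
    and eq: "\<forall>y\<in>Y. peak N (\<lambda>i. \<psi> i - c (x i) y) \<le> f y (\<nu> y) + e * \<nu> y + I (atoms Y K z v) y \<and>
      (0 < \<nu> y \<longrightarrow> peak N (\<lambda>i. \<psi> i - c (x i) y) = f y (\<nu> y) + e * \<nu> y + I (atoms Y K z v) y)"
    by blast
  define \<sigma> where "\<sigma> = atoms Y K z v"
  define A where "A y i = \<psi> i - c (x i) y" for y i
  define P where "P y = peak N (A y)" for y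
  define s where "s i y = softmax \<epsilon> N (A y) i * \<nu> y" for i y

  have PC: "continuous_on Y P"
    unfolding P_def continuous_on_def
  proof (intro ballI tendsto_peak N)
    fix y i assume y: "y \<in> Y" and i: "i < N"
    have "continuous_on Y (c (x i))" using c_cont_right x[OF i] by blast
    then show "((\<lambda>y. A y i) \<longlongrightarrow> A y i) (at y within Y)"
      unfolding A_def using y by (intro tendsto_intros) (auto simp: continuous_on_def)
  qed
  have "\<exists>y\<in>Y. \<forall>y'\<in>Y. P y + c x y \<le> P y' + c x y'" if "x \<in> X" for x
    by (rule continuous_attains_inf[OF Y Y_nonempty]) (intro continuous_intros PC c_cont_right that)
  then obtain y1 where y1: "\<And>x. x \<in> X \<Longrightarrow> y1 x \<in> Y"
    "\<And>x y. x \<in> X \<Longrightarrow> y \<in> Y \<Longrightarrow> P (y1 x) + c x (y1 x) \<le> P y + c x y"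
    by metis
  \<comment> \<open>The numbers \<open>\<psi> i\<close> live on the sampled types only, so the
    transform of \<open>P\<close> extends them to \<open>X\<close>. It is at least
    \<open>\<psi> i\<close> at \<open>x i\<close>, with equality for every type at which some
    \<open>P y\<close> is attained; this gives the attainment clauses of
    \<open>conjugate\<close>.\<close>
  define \<phi> where "\<phi> x = P (y1 x) + c x (y1 x)" for x
  have \<phi>_ge: "\<psi> i \<le> \<phi> (x i)" if "i < N" for i
    using peak_ge[OF that, of "A (y1 (x i))"] by (simp add: \<phi>_def P_def A_def)
  have conj: "conjugate \<phi> P"
    unfolding conjugate_def
  proof (intro conjI ballI)
    fix y assume y: "y \<in> Y"
    obtain i where i: "i < N" "P y = A y i" unfolding P_def using peak_attained[OF N] by metis
    then show "\<exists>x\<in>X. \<phi> x = P y + c x y"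
      using \<phi>_ge[OF i(1)] y1(2)[of "x i" y] x[OF i(1)] y
      by (intro bexI[of _ "x i"]) (auto simp: \<phi>_def A_def)
  qed (use y1 in \<open>auto simp: \<phi>_def\<close>)

  have A_meas: "(\<lambda>y. A y i) \<in> borel_measurable m\<^sub>0" if "i < N" for i
    unfolding A_def using x[OF that] by (intro measurable_m0 continuous_intros c_cont_right) auto
  have s_meas: "s i \<in> borel_measurable m\<^sub>0" if "i < N" for i
    unfolding s_def using borel_measurable_softmax[OF that A_meas] \<nu>_meas by auto
  have s_bd: "0 \<le> s i y \<and> s i y \<le> \<nu> y" if "i < N" "y \<in> Y" for i y
    using \<nu>0[OF that(2)] softmax_nonneg[of \<epsilon> N "A y" i] softmax_le_1[OF that(1), of \<epsilon> "A y"]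
      mult_right_mono[of "softmax \<epsilon> N (A y) i" 1 "\<nu> y"] by (simp add: s_def)
  have s_mi: "integral\<^sup>L m\<^sub>0 (s i) = m i" if "i < N" for i
    using mi[OF that] by (simp add: s_def[abs_def] A_def[abs_def])
  have sum_s: "(\<Sum>i<N. s i y) = \<nu> y" for y
    unfolding s_def sum_distrib_right[symmetric] sum_softmax[OF N] by simp
  have int_\<nu>: "integrable m\<^sub>0 (\<lambda>y. k y * \<nu> y)" if k: "continuous_on Y k" for k
  proof -
    obtain A where A: "0 \<le> A" "\<And>x. x \<in> Y \<Longrightarrow> \<bar>k x\<bar> \<le> A"
      using continuous_on_compact_abs_bound[OF Y k] by metis
    show ?thesis
      using measurable_m0[OF k] \<nu>_meas A \<nu>B \<nu>0
      by (intro integrable_m0[of _ "A * B"]) (auto simp: abs_mult intro!: mult_mono)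
  qed
  have int_s: "integrable m\<^sub>0 (\<lambda>y. s i y * k y)" if i: "i < N" and k: "continuous_on Y k" for i k
  proof -
    obtain A where A: "0 \<le> A" "\<And>x. x \<in> Y \<Longrightarrow> \<bar>k x\<bar> \<le> A"
      using continuous_on_compact_abs_bound[OF Y k] by metis
    have sB: "\<bar>s i y\<bar> \<le> B" if "y \<in> Y" for y
      using s_bd[OF i that] \<nu>B[OF that] by auto
    have "\<bar>s i y * k y\<bar> \<le> B * A" if "y \<in> Y" for y
      unfolding abs_mult using sB[OF that] A that by (intro mult_mono) auto
    then show ?thesis
      using measurable_m0[OF k] s_meas[OF i] by (intro integrable_m0[of _ "B * A"]) auto
  qed
  have int\<nu>1: "integral\<^sup>L m\<^sub>0 \<nu> = 1"
  proof -
    have "(\<Sum>i<N. integral\<^sup>L m\<^sub>0 (s i)) = integral\<^sup>L m\<^sub>0 (\<lambda>y. \<Sum>i<N. s i y)"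
      using int_s[of _ "\<lambda>_. 1"] by (subst Bochner_Integration.integral_sum) auto
    then show ?thesis using s_mi m by (simp add: sum_s)
  qed
  have "\<exists>\<gamma>\<in>borel_probs (X \<times> Y). \<forall>F::'a \<times> 'b \<Rightarrow> real. continuous_on (X \<times> Y) F \<longrightarrow>
    integral\<^sup>L \<gamma> F = (\<Sum>i<N. \<integral>y. s i y * F (x i, y) \<partial>m\<^sub>0)"
  proof (rule weighted_graphs_measure[OF m0_finite sets_m0 X Y])
    show "0 \<le> s i y \<and> s i y \<le> B" if "i < N" "y \<in> Y" for i y
      using s_bd[OF that] \<nu>B[OF that(2)] by linarith
  qed (use x s_meas s_mi m in auto)
  then obtain \<gamma> where \<gamma>: "\<gamma> \<in> borel_probs (X \<times> Y)" and int\<gamma>: "\<And>F::'a \<times> 'b \<Rightarrow> real.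
    continuous_on (X \<times> Y) F \<Longrightarrow> integral\<^sup>L \<gamma> F = (\<Sum>i<N. \<integral>y. s i y * F (x i, y) \<partial>m\<^sub>0)"
    by blast
  note cts = continuous_on_compose2[OF _ continuous_on_fst[OF continuous_on_id]]
    continuous_on_compose2[OF _ continuous_on_snd[OF continuous_on_id]]
  have \<phi>C: "continuous_on X \<phi>" by (rule conjugate_continuous[OF conj])
  have cC: "continuous_on (X \<times> Y) (\<lambda>p. c (fst p) (snd p))"
    using c by (simp add: case_prod_beta)

  show ?thesis
    unfolding approx_equilibrium_def
  proof (rule exI[of _ \<phi>], rule exI[of _ P], rule exI[of _ \<nu>], rule exI[of _ \<sigma>], rule exI[of _ \<gamma>],
      intro conjI allI impI)
    show "\<sigma> \<in> borel_probs Y"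
      unfolding \<sigma>_def using \<eta> v0 v1 by (intro atoms_in_borel_probs) auto
    show "integrable m\<^sub>0 \<nu>" using int_\<nu>[of "\<lambda>_. 1"] by simp
    show "(\<integral>p. k (snd p) \<partial>\<gamma>) = (\<integral>y. k y * \<nu> y \<partial>m\<^sub>0)" if k: "continuous_on Y k" for k :: "'b \<Rightarrow> real"
    proof -
      have "continuous_on (X \<times> Y) (\<lambda>p. k (snd p))" by (rule cts(2)[OF k]) auto
      then have "(\<integral>p. k (snd p) \<partial>\<gamma>) = (\<Sum>i<N. \<integral>y. s i y * k y \<partial>m\<^sub>0)"
        using int\<gamma> by simp
      also have "\<dots> = (\<integral>y. (\<Sum>i<N. s i y * k y) \<partial>m\<^sub>0)"
        using int_s k by (subst Bochner_Integration.integral_sum) auto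
      finally show ?thesis
        unfolding sum_distrib_right[symmetric] sum_s by (simp add: mult.commute)
    qed
    show "\<bar>(\<integral>p. k (fst p) \<partial>\<gamma>) - integral\<^sup>L \<mu> k\<bar> \<le> d"
      if k: "continuous_on X k" and kd: "\<forall>x\<in>X. \<forall>x'\<in>X. dist x x' < e \<longrightarrow> \<bar>k x - k x'\<bar> \<le> d" for k :: "'a \<Rightarrow> real" and d
    proof -
      have "continuous_on (X \<times> Y) (\<lambda>p. k (fst p))" by (rule cts(1)[OF k]) auto
      then have "(\<integral>p. k (fst p) \<partial>\<gamma>) = (\<Sum>i<N. m i * k (x i))"
        using int\<gamma> s_mi by simp
      then show ?thesis using \<mu>_close[OF k kd] by simp
    qed
    show "\<bar>integral\<^sup>L \<sigma> k - (\<integral>y. k y * \<nu> y \<partial>m\<^sub>0)\<bar> \<le> d"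
      if k: "continuous_on Y k" and kd: "\<forall>y\<in>Y. \<forall>y'\<in>Y. dist y y' < e \<longrightarrow> \<bar>k y - k y'\<bar> \<le> d" for k :: "'b \<Rightarrow> real" and d
    proof -
      have "integral\<^sup>L \<sigma> k = (\<Sum>j<K. v j * k (z j))"
        unfolding \<sigma>_def using \<eta> v0 k by (intro integral_atoms) auto
      also have "\<dots> = (\<Sum>j<K. (\<integral>y. \<eta> j y * \<nu> y \<partial>m\<^sub>0) * k (z j))"
        using v by simp
      finally show ?thesis
        using partition_integral_close[OF m0_finite sets_m0 Y \<eta> k _ \<nu>_meas, of d B] kd \<nu>0 \<nu>B int\<nu>1 by simp
    qed
    show "(\<integral>p. P (snd p) + c (fst p) (snd p) - \<phi> (fst p) \<partial>\<gamma>) \<le> e"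
    proof -
      have "continuous_on (X \<times> Y) (\<lambda>p. P (snd p) + c (fst p) (snd p) - \<phi> (fst p))"
        by (intro continuous_intros cC cts(1)[OF \<phi>C] cts(2)[OF PC]) auto
      then have "(\<integral>p. P (snd p) + c (fst p) (snd p) - \<phi> (fst p) \<partial>\<gamma>) =
        (\<Sum>i<N. \<integral>y. s i y * (P y + c (x i) y - \<phi> (x i)) \<partial>m\<^sub>0)"
        using int\<gamma> by simp
      also have "\<dots> \<le> (\<Sum>i<N. \<integral>y. \<epsilon> * \<nu> y \<partial>m\<^sub>0)"
      proof (intro sum_mono integral_mono)
        fix i assume "i \<in> {..<N}"
        then have i: "i < N" by simp
        show "integrable m\<^sub>0 (\<lambda>y. s i y * (P y + c (x i) y - \<phi> (x i)))"
          using x[OF i] by (intro int_s[OF i] continuous_intros PC c_cont_right) auto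
        show "integrable m\<^sub>0 (\<lambda>y. \<epsilon> * \<nu> y)" using int_\<nu>[of "\<lambda>_. \<epsilon>"] by simp
        fix y assume "y \<in> space m\<^sub>0"
        then have y: "y \<in> Y" by (simp add: space_m0)
        have "s i y * (P y + c (x i) y - \<phi> (x i)) \<le> s i y * (P y - A y i)"
          using \<phi>_ge[OF i] s_bd[OF i y] by (intro mult_left_mono) (auto simp: A_def)
        also have "\<dots> = softmax \<epsilon> N (A y) i * (P y - A y i) * \<nu> y"
          by (simp add: s_def)
        also have "\<dots> \<le> \<epsilon> * \<nu> y"
          using softmax_gap[OF i \<epsilon>, of "A y"] \<nu>0[OF y] unfolding P_def by (intro mult_right_mono) auto
        finally show "s i y * (P y + c (x i) y - \<phi> (x i)) \<le> \<epsilon> * \<nu> y" .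
      qed
      also have "\<dots> = e" using N int\<nu>1 by (simp add: \<epsilon>_def)
      finally show ?thesis .
    qed
    show "\<forall>y\<in>Y. P y \<le> f y (\<nu> y) + e * \<nu> y + I \<sigma> y \<and> (0 < \<nu> y \<longrightarrow> P y = f y (\<nu> y) + e * \<nu> y + I \<sigma> y)"
      using eq by (simp add: P_def A_def[abs_def] \<sigma>_def)
  qed (use \<gamma> conj \<nu>_meas \<nu>0 in auto)
qed

end

section \<open>Passage to the limit\<close>

text \<open>Test the inequality on the set where \<open>g < f\<close>. Finiteness of the integral of
  \<open>g\<close> permits the subtraction of extended integrals.\<close>

lemma AE_le_if_density_le:
  assumes f: "f \<in> borel_measurable M" and g: "g \<in> borel_measurable M" and fin: "(\<integral>\<^sup>+x. g x \<partial>M) \<noteq> \<infinity>"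
    and le: "\<And>A. A \<in> sets M \<Longrightarrow> emeasure (density M f) A \<le> emeasure (density M g) A"
  shows "AE x in M. f x \<le> g x"
proof -
  define A where "A = {x \<in> space M. g x < f x}"
  have A: "A \<in> sets M"
    unfolding A_def using f g by measurable
  have finA: "(\<integral>\<^sup>+x. g x * indicator A x \<partial>M) \<noteq> \<infinity>"
  proof -
    have "(\<integral>\<^sup>+x. g x * indicator A x \<partial>M) \<le> (\<integral>\<^sup>+x. g x \<partial>M)"
      by (intro nn_integral_mono) (auto split: split_indicator)
    then show ?thesis using fin by (auto simp: top_unique)
  qed
  have "(\<integral>\<^sup>+x. f x * indicator A x - g x * indicator A x \<partial>M) =
    (\<integral>\<^sup>+x. f x * indicator A x \<partial>M) - (\<integral>\<^sup>+x. g x * indicator A x \<partial>M)"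
    using f g A finA by (intro nn_integral_diff AE_I2) (auto simp: A_def split: split_indicator)
  also have "\<dots> = 0"
    using le[OF A] f g A finA by (simp add: emeasure_density diff_eq_0_iff_ennreal less_top)
  finally have "AE x in M. f x * indicator A x - g x * indicator A x = 0"
    using f g A by (subst (asm) nn_integral_0_iff_AE) auto
  with AE_space show ?thesis
  proof eventually_elim
    case (elim x)
    show ?case
    proof (rule ccontr)
      assume "\<not> f x \<le> g x"
      then have "x \<in> A" using elim(1) by (auto simp: A_def)
      with elim(2) \<open>\<not> f x \<le> g x\<close> show False
        by (auto simp: A_def diff_eq_0_iff_ennreal)
    qed
  qed
qed

context congestion_game begin

lemma approx_equilibriumD:
  assumes "approx_equilibrium e \<phi> P \<nu> \<sigma> \<gamma>"
  shows "\<gamma> \<in> borel_probs (X \<times> Y)" "\<sigma> \<in> borel_probs Y" "conjugate \<phi> P"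
    "\<nu> \<in> borel_measurable m\<^sub>0" "integrable m\<^sub>0 \<nu>" "\<And>y. y \<in> Y \<Longrightarrow> 0 \<le> \<nu> y"
    "\<And>k::'b \<Rightarrow> real. continuous_on Y k \<Longrightarrow> (\<integral>p. k (snd p) \<partial>\<gamma>) = (\<integral>y. k y * \<nu> y \<partial>m\<^sub>0)"
    "\<And>(k::'a \<Rightarrow> real) d. continuous_on X k \<Longrightarrow> (\<And>x x'. x \<in> X \<Longrightarrow> x' \<in> X \<Longrightarrow> dist x x' < e \<Longrightarrow> \<bar>k x - k x'\<bar> \<le> d) \<Longrightarrow>
      \<bar>(\<integral>p. k (fst p) \<partial>\<gamma>) - integral\<^sup>L \<mu> k\<bar> \<le> d"
    "\<And>(k::'b \<Rightarrow> real) d. continuous_on Y k \<Longrightarrow> (\<And>y y'. y \<in> Y \<Longrightarrow> y' \<in> Y \<Longrightarrow> dist y y' < e \<Longrightarrow> \<bar>k y - k y'\<bar> \<le> d) \<Longrightarrow>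
      \<bar>integral\<^sup>L \<sigma> k - (\<integral>y. k y * \<nu> y \<partial>m\<^sub>0)\<bar> \<le> d"
    "(\<integral>p. P (snd p) + c (fst p) (snd p) - \<phi> (fst p) \<partial>\<gamma>) \<le> e"
    "\<And>y. y \<in> Y \<Longrightarrow> P y \<le> f y (\<nu> y) + e * \<nu> y + I \<sigma> y"
    "\<And>y. y \<in> Y \<Longrightarrow> 0 < \<nu> y \<Longrightarrow> P y = f y (\<nu> y) + e * \<nu> y + I \<sigma> y"
  using assms unfolding approx_equilibrium_def by blast+

text \<open>In contrast to the box of \<open>finite_equilibrium\<close>, these constants do not
  depend on \<open>e\<close>. \<open>P\<close> is bounded below at a point of positive density,
  since \<open>f \<ge> - 1 / C\<close>, and above at a point of moderate density by the upper growth
  bound; its oscillation is at most \<open>2 * A0\<close>. The lower growth bound then limits the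
  density.\<close>

lemma approx_equilibrium_bounded:
  "\<exists>R V. \<forall>e \<phi> P \<nu> \<sigma> \<gamma>. 0 < e \<longrightarrow> e \<le> 1 \<longrightarrow> approx_equilibrium e \<phi> P \<nu> \<sigma> \<gamma> \<longrightarrow>
    (\<forall>x\<in>X. \<bar>\<phi> x\<bar> \<le> R) \<and> (\<forall>y\<in>Y. \<nu> y \<le> V)"
proof -
  obtain A0 where A0: "0 \<le> A0" "\<And>x y. x \<in> X \<Longrightarrow> y \<in> Y \<Longrightarrow> \<bar>c x y\<bar> \<le> A0"
    using c_bounded by blast
  obtain G0 where G0: "0 \<le> G0" "\<And>\<nu> y. \<nu> \<in> borel_probs Y \<Longrightarrow> y \<in> Y \<Longrightarrow> \<bar>I \<nu> y\<bar> \<le> G0"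
    using I_bounded by blast
  define M0 where "M0 = measure m\<^sub>0 Y"
  have M0: "0 < M0" using mass_pos by (simp add: M0_def)
  define R where "R = 2 * A0 + 1 / C + G0 + C * ((2 / M0) powr \<alpha> + 1) + 2 / M0"
  define V where "V = (C * (R + G0) + 1) powr (1 / \<alpha>)"
  have "(\<forall>x\<in>X. \<bar>\<phi> x\<bar> \<le> R + A0) \<and> (\<forall>y\<in>Y. \<nu> y \<le> V)"
    if e: "0 < e" "e \<le> 1" and ae: "approx_equilibrium e \<phi> P \<nu> \<sigma> \<gamma>" for e \<phi> P \<nu> \<sigma> \<gamma>
  proof -
    note ae' = approx_equilibriumD[OF ae]
    have "integral\<^sup>L m\<^sub>0 \<nu> = (\<integral>p. 1 \<partial>\<gamma>)"
      using ae'(7)[of "\<lambda>_. 1"] by simp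
    then have int1: "integral\<^sup>L m\<^sub>0 \<nu> = 1"
      using prob_space.prob_space[OF borel_probsD(1)[OF ae'(1)]] by simp
    have C0: "0 \<le> 1 / C" "0 \<le> C * ((2 / M0) powr \<alpha> + 1)" using C by auto
    have "\<exists>y\<in>Y. 0 < \<nu> y"
    proof (rule ccontr)
      assume "\<not> ?thesis"
      then have "\<nu> y = 0" if "y \<in> Y" for y using ae'(6)[OF that] that by force
      then have "integral\<^sup>L m\<^sub>0 \<nu> = 0"
        using space_m0 by (intro integral_eq_zero_AE AE_I2) auto
      with int1 show False by simp
    qed
    then obtain y1 where y1: "y1 \<in> Y" "0 < \<nu> y1" by blast
    have "- 1 / C \<le> f y1 (\<nu> y1)" using f_lower[OF y1(1)] y1(2) by simp
    moreover have "0 \<le> e * \<nu> y1" using e y1(2) by simp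
    ultimately have lowP: "- 1 / C - G0 \<le> P y1"
      using ae'(12)[OF y1] G0(2)[OF ae'(2) y1(1)] by linarith
    \<comment> \<open>The mean of \<open>\<nu>\<close> is \<open>1 / M0\<close>. With twice the
      mean, plain monotonicity of the integral already yields the contradiction 2 <= 1.\<close>
    have "\<exists>y\<in>Y. \<nu> y \<le> 2 / M0"
    proof (rule ccontr)
      assume "\<not> ?thesis"
      then have "(\<integral>y. 2 / M0 \<partial>m\<^sub>0) \<le> integral\<^sup>L m\<^sub>0 \<nu>"
        using ae'(5) space_m0 by (intro integral_mono) (auto intro: less_imp_le)
      then show False using int1 M0 by (simp add: space_m0 M0_def[symmetric])
    qed
    then obtain y2 where y2: "y2 \<in> Y" "\<nu> y2 \<le> 2 / M0" by blast
    have "(\<nu> y2) powr \<alpha> \<le> (2 / M0) powr \<alpha>"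
      using y2 ae'(6)[OF y2(1)] \<alpha> by (intro powr_mono2) auto
    then have "C * (\<nu> y2 powr \<alpha> + 1) \<le> C * ((2 / M0) powr \<alpha> + 1)"
      using C by (intro mult_left_mono) auto
    then have "f y2 (\<nu> y2) \<le> C * ((2 / M0) powr \<alpha> + 1)"
      using growth[OF y2(1) ae'(6)[OF y2(1)]] by linarith
    moreover have "e * \<nu> y2 \<le> 2 / M0"
      using mult_mono[OF e(2) y2(2)] ae'(6)[OF y2(1)] e by simp
    ultimately have upP: "P y2 \<le> C * ((2 / M0) powr \<alpha> + 1) + 2 / M0 + G0"
      using ae'(11)[OF y2(1)] G0(2)[OF ae'(2) y2(1)] by linarith
    have osc: "\<bar>P y - P y'\<bar> \<le> 2 * A0" if "y \<in> Y" "y' \<in> Y" for y y'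
    proof (rule conjugate_right_close[OF ae'(3) that])
      show "\<bar>c x y - c x y'\<bar> \<le> 2 * A0" if "x \<in> X" for x
        using A0(2)[OF that \<open>y \<in> Y\<close>] A0(2)[OF that \<open>y' \<in> Y\<close>] by linarith
    qed
    have PR: "\<bar>P y\<bar> \<le> R" if "y \<in> Y" for y
      using osc[OF that y1(1)] osc[OF that y2(1)] lowP upP C0 M0 G0(1) A0(1) unfolding R_def
      by (smt (verit) divide_nonneg_nonneg minus_divide_left)
    show ?thesis
    proof (intro conjI ballI)
      fix x assume x: "x \<in> X"
      then obtain y where "y \<in> Y" "\<phi> x = P y + c x y"
        using ae'(3) unfolding conjugate_def by blast
      then show "\<bar>\<phi> x\<bar> \<le> R + A0"
        using PR[of y] A0(2)[OF x, of y] by linarith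
    next
      fix y assume y: "y \<in> Y"
      show "\<nu> y \<le> V"
      proof (cases "0 < \<nu> y")
        case True
        have "0 \<le> e * \<nu> y" using e True by simp
        then have "f y (\<nu> y) \<le> R + G0"
          using ae'(12)[OF y True] PR[OF y] G0(2)[OF ae'(2) y] by linarith
        then show ?thesis
          unfolding V_def using powr_bound[OF y ae'(6)[OF y]] by blast
      next
        case False
        then show ?thesis unfolding V_def by (meson not_less order_trans powr_ge_zero)
      qed
    qed
  qed
  then show ?thesis by blast
qed

text \<open>Convergence is claimed for plans and potentials only; of the densities just the common
  bound \<open>V\<close> is kept.\<close>

lemma approx_equilibria_converge:
  "\<exists>e \<phi> P \<nu> \<sigma> \<gamma> V \<gamma>\<^sub>0 \<phi>\<^sub>0. (\<forall>n::nat. approx_equilibrium (e n) (\<phi> n) (P n) (\<nu> n) (\<sigma> n) (\<gamma> n)) \<and>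
    (\<forall>n. 0 < e n) \<and> e \<longlonglongrightarrow> 0 \<and> (\<forall>n. \<forall>y\<in>Y. \<nu> n y \<le> V) \<and>
    \<gamma>\<^sub>0 \<in> borel_probs (X \<times> Y) \<and>
    (\<forall>F::'a \<times> 'b \<Rightarrow> real. continuous_on (X \<times> Y) F \<longrightarrow> (\<lambda>n. integral\<^sup>L (\<gamma> n) F) \<longlonglongrightarrow> integral\<^sup>L \<gamma>\<^sub>0 F) \<and>
    continuous_on X \<phi>\<^sub>0 \<and> uniform_limit X \<phi> \<phi>\<^sub>0 sequentially"
proof -
  obtain R V where RV: "\<forall>e \<phi> P \<nu> \<sigma> \<gamma>. 0 < e \<longrightarrow> e \<le> 1 \<longrightarrow> approx_equilibrium e \<phi> P \<nu> \<sigma> \<gamma> \<longrightarrow>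
    (\<forall>x\<in>X. \<bar>\<phi> x\<bar> \<le> R) \<and> (\<forall>y\<in>Y. \<nu> y \<le> V)"
    using approx_equilibrium_bounded by blast
  define e where "e n = inverse (real (Suc n))" for n
  have e: "0 < e n" "e n \<le> 1" for n
    by (auto simp: e_def inverse_le_1_iff)
  have "\<exists>\<phi> P \<nu> \<sigma> \<gamma>. approx_equilibrium (e n) \<phi> P \<nu> \<sigma> \<gamma>" for n
    by (rule approx_equilibrium_exists[OF e(1)])
  then obtain \<phi> P \<nu> \<sigma> \<gamma> where ae: "\<And>n. approx_equilibrium (e n) (\<phi> n) (P n) (\<nu> n) (\<sigma> n) (\<gamma> n)"
    by metis
  have bd: "\<And>n x. x \<in> X \<Longrightarrow> \<bar>\<phi> n x\<bar> \<le> R" "\<And>n y. y \<in> Y \<Longrightarrow> \<nu> n y \<le> V"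
    using RV ae e by blast+
  obtain r \<gamma>\<^sub>0 where r: "strict_mono r" and \<gamma>\<^sub>0: "\<gamma>\<^sub>0 \<in> borel_probs (X \<times> Y)"
    and conv: "\<forall>F::'a \<times> 'b \<Rightarrow> real. continuous_on (X \<times> Y) F \<longrightarrow> (\<lambda>n. integral\<^sup>L (\<gamma> (r n)) F) \<longlonglongrightarrow> integral\<^sup>L \<gamma>\<^sub>0 F"
    using borel_probs_weak_compact[OF compact_Times[OF X Y], of \<gamma>] approx_equilibriumD(1)[OF ae] by blast
  have equi: "\<exists>\<delta>. 0 < \<delta> \<and> (\<forall>n x'. x' \<in> X \<and> norm (x - x') < \<delta> \<longrightarrow> norm (\<phi> (r n) x - \<phi> (r n) x') < d)"
    if "x \<in> X" "0 < d" for x d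
  proof -
    obtain \<delta> where \<delta>: "\<delta> > 0"
      "\<And>x x' y. x \<in> X \<Longrightarrow> x' \<in> X \<Longrightarrow> y \<in> Y \<Longrightarrow> dist x x' < \<delta> \<Longrightarrow> \<bar>c x y - c x' y\<bar> < d / 2"
      using c_equicontinuous[of "d / 2"] \<open>0 < d\<close> by (metis half_gt_zero)
    have "norm (\<phi> (r n) x - \<phi> (r n) x') < d" if x': "x' \<in> X" "norm (x - x') < \<delta>" for n x'
    proof -
      have "\<bar>\<phi> (r n) x - \<phi> (r n) x'\<bar> \<le> d / 2"
        by (rule conjugate_left_close[OF approx_equilibriumD(3)[OF ae] \<open>x \<in> X\<close> x'(1)])
          (use \<delta>(2)[OF \<open>x \<in> X\<close> x'(1)] x'(2) in \<open>auto simp: dist_norm intro: less_imp_le\<close>)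
      then show ?thesis using \<open>0 < d\<close> by simp
    qed
    with \<delta>(1) show ?thesis by blast
  qed
  have "\<exists>\<phi>\<^sub>0 s. continuous_on X \<phi>\<^sub>0 \<and> strict_mono (s :: nat \<Rightarrow> nat) \<and>
    (\<forall>d>0. \<exists>N. \<forall>n x. n \<ge> N \<and> x \<in> X \<longrightarrow> norm (\<phi> (r (s n)) x - \<phi>\<^sub>0 x) < d)"
  proof (rule Arzela_Ascoli[OF X, of "\<lambda>n. \<phi> (r n)" R])
    show "norm (\<phi> (r n) x) \<le> R" if "x \<in> X" for n x using bd(1)[OF that] by simp
    show "\<exists>\<delta>. 0 < \<delta> \<and> (\<forall>n x'. x' \<in> X \<and> norm (x - x') < \<delta> \<longrightarrow> norm (\<phi> (r n) x - \<phi> (r n) x') < d)"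
      if "x \<in> X" "0 < d" for x d by (rule equi[OF that])
  next
    fix g and k :: "nat \<Rightarrow> nat"
    assume "continuous_on X g" "strict_mono k"
      and "\<And>d. 0 < d \<Longrightarrow> \<exists>N. \<forall>n x. n \<ge> N \<and> x \<in> X \<longrightarrow> norm (\<phi> (r (k n)) x - g x) < d"
    then show ?thesis by blast
  qed
  then obtain \<phi>\<^sub>0 and s :: "nat \<Rightarrow> nat" where \<phi>\<^sub>0: "continuous_on X \<phi>\<^sub>0" "strict_mono s"
    and unif: "\<forall>d>0. \<exists>N. \<forall>n x. n \<ge> N \<and> x \<in> X \<longrightarrow> norm (\<phi> (r (s n)) x - \<phi>\<^sub>0 x) < d"
    by blast
  have rs: "strict_mono (\<lambda>n. r (s n))"
    using strict_mono_o[OF r \<phi>\<^sub>0(2)] by (simp add: o_def)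
  have "e \<longlonglongrightarrow> 0" unfolding e_def by (rule LIMSEQ_inverse_real_of_nat)
  then have lim_e: "(\<lambda>n. e (r (s n))) \<longlonglongrightarrow> 0"
    using LIMSEQ_subseq_LIMSEQ[OF _ rs] by (simp add: o_def)
  have lim_\<gamma>: "(\<lambda>n. integral\<^sup>L (\<gamma> (r (s n))) F) \<longlonglongrightarrow> integral\<^sup>L \<gamma>\<^sub>0 F" if "continuous_on (X \<times> Y) F" for F :: "'a \<times> 'b \<Rightarrow> real"
    using LIMSEQ_subseq_LIMSEQ[OF conv[rule_format, OF that] \<phi>\<^sub>0(2)] by (simp add: o_def)
  have lim_\<phi>: "uniform_limit X (\<lambda>n. \<phi> (r (s n))) \<phi>\<^sub>0 sequentially"
    unfolding uniform_limit_iff eventually_sequentially dist_norm using unif by blast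
  show ?thesis
    by (rule exI[of _ "\<lambda>n. e (r (s n))"], rule exI[of _ "\<lambda>n. \<phi> (r (s n))"], rule exI[of _ "\<lambda>n. P (r (s n))"],
        rule exI[of _ "\<lambda>n. \<nu> (r (s n))"], rule exI[of _ "\<lambda>n. \<sigma> (r (s n))"], rule exI[of _ "\<lambda>n. \<gamma> (r (s n))"],
        rule exI[of _ V], rule exI[of _ \<gamma>\<^sub>0], rule exI[of _ \<phi>\<^sub>0])
      (use ae e lim_e bd \<gamma>\<^sub>0 lim_\<gamma> \<phi>\<^sub>0 lim_\<phi> in auto)
qed

end

text \<open>The factor \<open>ennreal a\<close> is finite, so multiplication by it is continuous on
  the extended half-line; for an infinite factor continuity would fail at 0.\<close>

lemma limsup_cmult_ennreal: "limsup (\<lambda>n. ennreal a * u n) = ennreal a * limsup u"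
  by (rule Limsup_compose_continuous_mono[where f = "\<lambda>x. ennreal a * x"])
    (auto simp: mono_def intro: ennreal_continuous_on_cmult continuous_on_id mult_left_mono)

lemma liminf_cmult_ennreal: "liminf (\<lambda>n. ennreal a * u n) = ennreal a * liminf u"
  by (rule Liminf_compose_continuous_mono[where f = "\<lambda>x. ennreal a * x"])
    (auto simp: mono_def intro: ennreal_continuous_on_cmult continuous_on_id mult_left_mono)

context congestion_game begin

text \<open>If \<open>S > f y t'\<close> for some \<open>t' > t\<close>, then eventually
  \<open>u n \<ge> t'\<close>, against the liminf; \<open>f y t' > S\<close> with
  \<open>t' < t\<close> contradicts the limsup in the same way. Continuity lets \<open>t'\<close>
  tend to \<open>t\<close>. Strictly between liminf and limsup, \<open>f y\<close> is therefore
  constant with value \<open>S\<close>, so oscillation of \<open>u\<close> does no harm.\<close>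

lemma cluster_point_solves:
  fixes u s :: "nat \<Rightarrow> real"
  assumes y: "y \<in> Y" and u0: "\<And>n. 0 \<le> u n" and d: "d \<longlonglongrightarrow> 0" and s: "s \<longlonglongrightarrow> S"
    and ge: "\<And>n. s n \<le> f y (u n) + d n" and eq: "\<And>n. 0 < u n \<Longrightarrow> s n = f y (u n) + d n"
    and t: "0 \<le> t" "liminf (\<lambda>n. ennreal (u n)) \<le> ennreal t" "ennreal t \<le> limsup (\<lambda>n. ennreal (u n))"
  shows "S \<le> f y t \<and> (0 < t \<longrightarrow> f y t = S)"
proof -
  have mono: "f y t1 \<le> f y t2" if "0 \<le> t1" "t1 \<le> t2" for t1 t2
    using mono_onD[OF f_mono[OF y], of t1 t2] that by simp
  have lim: "(\<lambda>n. s n - d n) \<longlonglongrightarrow> S"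
    using tendsto_diff[OF s d] by simp
  have up: "S \<le> f y t'" if "t < t'" for t'
  proof (rule ccontr)
    assume "\<not> ?thesis"
    then have "eventually (\<lambda>n. f y t' < s n - d n) sequentially"
      using order_tendstoD(1)[OF lim] by auto
    then have "eventually (\<lambda>n. ennreal t' \<le> ennreal (u n)) sequentially"
    proof eventually_elim
      case (elim n)
      then have "f y t' < f y (u n)" using ge[of n] by linarith
      then show ?case using mono[OF u0[of n], of t'] by (intro ennreal_leI) linarith
    qed
    then have "ennreal t' \<le> liminf (\<lambda>n. ennreal (u n))" by (rule Liminf_bounded)
    then have "ennreal t' \<le> ennreal t" using t(2) by (rule order_trans)
    then show False using that t(1) by (simp add: ennreal_le_iff2)
  qed
  have low: "f y t' \<le> S" if "0 \<le> t'" "t' < t" for t'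
  proof (rule ccontr)
    assume "\<not> ?thesis"
    then have "eventually (\<lambda>n. s n - d n < f y t') sequentially"
      using order_tendstoD(2)[OF lim] by auto
    then have "eventually (\<lambda>n. ennreal (u n) \<le> ennreal t') sequentially"
    proof eventually_elim
      case (elim n)
      show ?case
      proof (rule ennreal_leI, rule ccontr)
        assume "\<not> u n \<le> t'"
        then have "f y (u n) = s n - d n" "f y t' \<le> f y (u n)"
          using eq[of n] \<open>0 \<le> t'\<close> mono[of t' "u n"] by auto
        then show False using elim by linarith
      qed
    qed
    then have "limsup (\<lambda>n. ennreal (u n)) \<le> ennreal t'" by (rule Limsup_bounded)
    then have "ennreal t \<le> ennreal t'" using t(3) by (metis order_trans)
    then show False using that by (simp add: ennreal_le_iff2)
  qed
  have cont: "continuous (at t within {0..}) (f y)"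
    using f_cont[OF y] t(1) by (simp add: continuous_on_eq_continuous_within)
  have "S \<le> f y t"
  proof (rule tendsto_lowerbound)
    have "(\<lambda>n. t + 1 / real (Suc n)) \<longlonglongrightarrow> t + 0"
      by (intro tendsto_add tendsto_const LIMSEQ_Suc lim_1_over_n)
    then show "(\<lambda>n. f y (t + 1 / real (Suc n))) \<longlonglongrightarrow> f y t"
      using t(1) by (intro continuous_within_tendsto_compose'[OF cont]) auto
    show "\<forall>\<^sub>F n in sequentially. S \<le> f y (t + 1 / real (Suc n))"
      using up by simp
  qed simp
  moreover have "f y t \<le> S" if "0 < t"
  proof (rule tendsto_upperbound)
    \<comment> \<open>Steps proportional to \<open>t\<close> keep the sequence inside [0,
      t).\<close>
    have "(\<lambda>n. t - t * (1 / real (Suc n))) \<longlonglongrightarrow> t - t * 0"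
      by (intro tendsto_diff tendsto_mult tendsto_const LIMSEQ_Suc lim_1_over_n)
    moreover have pos: "0 \<le> t - t * (1 / real (Suc n))" for n
      using that mult_left_mono[of "1 / real (Suc n)" 1 t] by simp
    ultimately show "(\<lambda>n. f y (t - t * (1 / real (Suc n)))) \<longlonglongrightarrow> f y t"
      by (intro continuous_within_tendsto_compose'[OF cont]) auto
    show "\<forall>\<^sub>F n in sequentially. f y (t - t * (1 / real (Suc n))) \<le> S"
      using low[OF pos] that by simp
  qed simp
  ultimately show ?thesis by force
qed

theorem equilibrium_exists:
  "\<exists>\<gamma>. cournot_nash_equilibrium X Y \<mu> m\<^sub>0 (admissible Y m\<^sub>0 \<alpha>) c (externality m\<^sub>0 f I) \<gamma>"
proof -
  from approx_equilibria_converge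
  obtain e \<phi> P \<nu> \<sigma> \<gamma>s V \<gamma> \<phi>\<^sub>0 where ae: "\<And>n::nat. approx_equilibrium (e n) (\<phi> n) (P n) (\<nu> n) (\<sigma> n) (\<gamma>s n)"
    and e0: "\<And>n. 0 < e n" and e: "e \<longlonglongrightarrow> 0" and \<nu>V: "\<And>n y. y \<in> Y \<Longrightarrow> \<nu> n y \<le> V"
    and \<gamma>: "\<gamma> \<in> borel_probs (X \<times> Y)"
    and \<gamma>_lim: "\<And>F::'a \<times> 'b \<Rightarrow> real. continuous_on (X \<times> Y) F \<Longrightarrow> (\<lambda>n. integral\<^sup>L (\<gamma>s n) F) \<longlonglongrightarrow> integral\<^sup>L \<gamma> F"
    and \<phi>C: "continuous_on X \<phi>\<^sub>0" and \<phi>_lim: "uniform_limit X \<phi> \<phi>\<^sub>0 sequentially"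
    by blast
  note ae' = approx_equilibriumD[OF ae]
  have V: "0 \<le> V"
    using Y_nonempty ae'(6) \<nu>V by (meson all_not_in_conv order_trans)
  note cts = continuous_on_compose2[OF _ continuous_on_fst[OF continuous_on_id]]
    continuous_on_compose2[OF _ continuous_on_snd[OF continuous_on_id]]
  have cC: "continuous_on (X \<times> Y) (\<lambda>p. c (fst p) (snd p))"
    using c by (simp add: case_prod_beta)
  have cts1: "continuous_on (X \<times> Y) (\<lambda>p. k (fst p))" if "continuous_on X k" for k :: "'a \<Rightarrow> real"
    by (rule cts(1)[OF that]) auto
  have cts2: "continuous_on (X \<times> Y) (\<lambda>p. k (snd p))" if "continuous_on Y k" for k :: "'b \<Rightarrow> real"
    by (rule cts(2)[OF that]) auto

  \<comment> \<open>Limit potentials\<close>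
  have "\<exists>x\<in>X. \<forall>x'\<in>X. \<phi>\<^sub>0 x' - c x' y \<le> \<phi>\<^sub>0 x - c x y" if "y \<in> Y" for y
    by (rule continuous_attains_sup[OF X X_nonempty]) (intro continuous_intros \<phi>C c_cont_left that)
  then obtain x1 where x1: "\<And>y. y \<in> Y \<Longrightarrow> x1 y \<in> X"
    "\<And>x y. x \<in> X \<Longrightarrow> y \<in> Y \<Longrightarrow> \<phi>\<^sub>0 x - c x y \<le> \<phi>\<^sub>0 (x1 y) - c (x1 y) y"
    by metis
  define P\<^sub>0 where "P\<^sub>0 y = \<phi>\<^sub>0 (x1 y) - c (x1 y) y" for y
  have \<phi>P: "\<phi>\<^sub>0 x \<le> c x y + P\<^sub>0 y" if "x \<in> X" "y \<in> Y" for x y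
    using x1(2)[OF that] by (simp add: P\<^sub>0_def)
  \<comment> \<open>The transform is nonexpansive in the sup norm: compare a type attaining
    \<open>P n y\<close> with the type \<open>x1 y\<close> attaining the limit.\<close>
  have P_lim: "uniform_limit Y P P\<^sub>0 sequentially"
    unfolding uniform_limit_iff
  proof (intro allI impI)
    fix d :: real assume "d > 0"
    then have "\<forall>\<^sub>F n in sequentially. \<forall>x\<in>X. dist (\<phi> n x) (\<phi>\<^sub>0 x) < d"
      using \<phi>_lim by (simp add: uniform_limit_iff)
    then show "\<forall>\<^sub>F n in sequentially. \<forall>y\<in>Y. dist (P n y) (P\<^sub>0 y) < d"
    proof (eventually_elim, intro ballI)
      fix n y assume n: "\<forall>x\<in>X. dist (\<phi> n x) (\<phi>\<^sub>0 x) < d" and y: "y \<in> Y"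
      obtain x where x: "x \<in> X" "\<phi> n x = P n y + c x y"
        using ae'(3)[of n] y unfolding conjugate_def by blast
      have "\<bar>\<phi> n x - \<phi>\<^sub>0 x\<bar> < d" "\<bar>\<phi> n (x1 y) - \<phi>\<^sub>0 (x1 y)\<bar> < d"
        using n x(1) x1(1)[OF y] by (auto simp: dist_real_def)
      moreover have "\<phi> n (x1 y) \<le> P n y + c (x1 y) y"
        by (rule conjugate_le[OF ae'(3) x1(1)[OF y] y])
      ultimately show "dist (P n y) (P\<^sub>0 y) < d"
        using x(2) \<phi>P[OF x(1) y] unfolding dist_real_def P\<^sub>0_def by linarith
    qed
  qed
  have PC: "continuous_on Y P\<^sub>0"
    by (rule uniform_limit_theorem[OF _ P_lim]) (use conjugate_continuous(2)[OF ae'(3)] in auto)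

  \<comment> \<open>Marginals of the limit plan\<close>
  define \<nu>\<^sub>0 where "\<nu>\<^sub>0 = distr \<gamma> (borel_on Y) snd"
  interpret \<gamma>: prob_space \<gamma> using borel_probsD[OF \<gamma>] by simp
  have space_\<gamma>: "space \<gamma> = X \<times> Y" using borel_probsD[OF \<gamma>] by simp
  have marginal_meas: "fst \<in> measurable \<gamma> (borel_on X)" "snd \<in> measurable \<gamma> (borel_on Y)"
  proof -
    have "(fst :: 'a \<times> 'b \<Rightarrow> 'a) \<in> borel_measurable (borel_on (X \<times> Y))" "(snd :: 'a \<times> 'b \<Rightarrow> 'b) \<in> borel_measurable (borel_on (X \<times> Y))"
      by (intro borel_measurable_continuous_on_restrict continuous_intros)+
    then have "fst \<in> borel_measurable \<gamma>" "snd \<in> borel_measurable \<gamma>"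
      by (simp_all add: measurable_cong_sets[OF borel_probsD(2)[OF \<gamma>] refl])
    moreover have "fst \<in> space \<gamma> \<rightarrow> X" "snd \<in> space \<gamma> \<rightarrow> Y"
      by (auto simp: space_\<gamma>)
    ultimately show "fst \<in> measurable \<gamma> (borel_on X)" "snd \<in> measurable \<gamma> (borel_on Y)"
      by (simp_all only: measurable_restrict_space2)
  qed
  have \<nu>\<^sub>0: "\<nu>\<^sub>0 \<in> borel_probs Y"
    using \<gamma>.prob_space_distr[OF marginal_meas(2)] by (simp add: \<nu>\<^sub>0_def borel_probs_def)
  have int_fst: "integral\<^sup>L (distr \<gamma> (borel_on X) fst) k = (\<integral>p. k (fst p) \<partial>\<gamma>)" if "continuous_on X k" for k :: "'a \<Rightarrow> real"
    using marginal_meas(1) borel_measurable_continuous_on_restrict[OF that] by (rule integral_distr)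
  have int_snd: "integral\<^sup>L \<nu>\<^sub>0 k = (\<integral>p. k (snd p) \<partial>\<gamma>)" if "continuous_on Y k" for k :: "'b \<Rightarrow> real"
    unfolding \<nu>\<^sub>0_def using marginal_meas(2) borel_measurable_continuous_on_restrict[OF that] by (rule integral_distr)
  \<comment> \<open>For a fixed continuous function, the oscillation at the vanishing scale
    \<open>e n\<close> is eventually below any tolerance, so the approximate identities of
    \<open>approx_equilibrium\<close> become exact in the limit.\<close>
  have mesh: "\<forall>\<^sub>F n in sequentially. \<forall>z\<in>Z. \<forall>z'\<in>Z. dist z z' < e n \<longrightarrow> \<bar>k z - k z'\<bar> \<le> d"
    if Z: "compact Z" and k: "continuous_on Z k" and "0 < d" for Z :: "'c::metric_space set" and k :: "'c \<Rightarrow> real" and d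
  proof -
    obtain \<delta> where \<delta>: "\<delta> > 0" "\<And>z z'. z \<in> Z \<Longrightarrow> z' \<in> Z \<Longrightarrow> dist z' z < \<delta> \<Longrightarrow> dist (k z') (k z) < d"
      using compact_uniformly_continuous[OF k Z] \<open>0 < d\<close> unfolding uniformly_continuous_on_def by metis
    have "\<forall>\<^sub>F n in sequentially. e n < \<delta>"
      using order_tendstoD(2)[OF e \<delta>(1)] .
    then show ?thesis
    proof (eventually_elim, intro ballI impI)
      fix n z z' assume "e n < \<delta>" "z \<in> Z" "z' \<in> Z" "dist z z' < e n"
      then show "\<bar>k z - k z'\<bar> \<le> d" using \<delta>(2)[of z' z] by (simp add: dist_real_def)
    qed
  qed
  have marginal1: "distr \<gamma> (borel_on X) fst = \<mu>"
  proof (rule borel_probs_eqI[OF _ \<mu> X])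
    show "distr \<gamma> (borel_on X) fst \<in> borel_probs X"
      using \<gamma>.prob_space_distr[OF marginal_meas(1)] by (simp add: borel_probs_def)
    fix k :: "'a \<Rightarrow> real" assume k: "continuous_on X k"
    have "(\<lambda>n. \<integral>p. k (fst p) \<partial>\<gamma>s n) \<longlonglongrightarrow> integral\<^sup>L \<mu> k"
    proof (rule tendstoI)
      fix d :: real assume "d > 0"
      show "\<forall>\<^sub>F n in sequentially. dist (\<integral>p. k (fst p) \<partial>\<gamma>s n) (integral\<^sup>L \<mu> k) < d"
        using mesh[OF X k half_gt_zero[OF \<open>d > 0\<close>]]
      proof eventually_elim
        case (elim n)
        then have "\<bar>(\<integral>p. k (fst p) \<partial>\<gamma>s n) - integral\<^sup>L \<mu> k\<bar> \<le> d / 2"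
          by (intro ae'(8)[OF k]) blast
        then show ?case using \<open>d > 0\<close> by (simp add: dist_real_def)
      qed
    qed
    then show "integral\<^sup>L (distr \<gamma> (borel_on X) fst) k = integral\<^sup>L \<mu> k"
      using \<gamma>_lim[OF cts1[OF k]] int_fst[OF k] LIMSEQ_unique by metis
  qed
  have \<nu>_lim: "(\<lambda>n. \<integral>y. k y * \<nu> n y \<partial>m\<^sub>0) \<longlonglongrightarrow> integral\<^sup>L \<nu>\<^sub>0 k" if k: "continuous_on Y k" for k :: "'b \<Rightarrow> real"
    using \<gamma>_lim[OF cts2[OF k]] ae'(7)[OF k] int_snd[OF k] by simp
  have \<sigma>_lim: "(\<lambda>n. integral\<^sup>L (\<sigma> n) k) \<longlonglongrightarrow> integral\<^sup>L \<nu>\<^sub>0 k" if k: "continuous_on Y k" for k :: "'b \<Rightarrow> real"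
  proof -
    have "(\<lambda>n. integral\<^sup>L (\<sigma> n) k - (\<integral>y. k y * \<nu> n y \<partial>m\<^sub>0)) \<longlonglongrightarrow> 0"
    proof (rule tendstoI)
      fix d :: real assume "d > 0"
      show "\<forall>\<^sub>F n in sequentially. dist (integral\<^sup>L (\<sigma> n) k - (\<integral>y. k y * \<nu> n y \<partial>m\<^sub>0)) 0 < d"
        using mesh[OF Y k half_gt_zero[OF \<open>d > 0\<close>]]
      proof eventually_elim
        case (elim n)
        then have "\<bar>integral\<^sup>L (\<sigma> n) k - (\<integral>y. k y * \<nu> n y \<partial>m\<^sub>0)\<bar> \<le> d / 2"
          by (intro ae'(9)[OF k]) blast
        then show ?case using \<open>d > 0\<close> by (simp add: dist_real_def)
      qed
    qed
    from tendsto_add[OF this \<nu>_lim[OF k]] show ?thesis by simp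
  qed
  have I_lim: "uniform_limit Y (\<lambda>n. I (\<sigma> n)) (I \<nu>\<^sub>0) sequentially"
    by (rule I_limit[OF ae'(2) \<nu>\<^sub>0 \<sigma>_lim])

  \<comment> \<open>Enclosing the limit density\<close>
  define lo where "lo y = liminf (\<lambda>n. ennreal (\<nu> n y))" for y
  define hi where "hi y = limsup (\<lambda>n. ennreal (\<nu> n y))" for y
  have \<nu>_meas: "\<nu> n \<in> borel_measurable m\<^sub>0" for n by (rule ae'(4))
  have lo_meas: "lo \<in> borel_measurable m\<^sub>0" and hi_meas: "hi \<in> borel_measurable m\<^sub>0"
    unfolding lo_def hi_def using \<nu>_meas by (auto intro!: borel_measurable_liminf borel_measurable_limsup)
  have hiV: "hi y \<le> ennreal V" if "y \<in> Y" for y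
    unfolding hi_def using \<nu>V[OF that] by (intro Limsup_bounded always_eventually) (auto intro: ennreal_leI)
  have lo_hi: "lo y \<le> hi y" for y
    unfolding lo_def hi_def by (rule Liminf_le_Limsup) simp
  have finite_density: "finite_measure (density m\<^sub>0 q)" "(\<integral>\<^sup>+y. q y \<partial>m\<^sub>0) \<noteq> \<infinity>"
    if "q \<in> borel_measurable m\<^sub>0" "\<And>y. y \<in> Y \<Longrightarrow> q y \<le> ennreal V" for q
  proof -
    have "(\<integral>\<^sup>+y. q y \<partial>m\<^sub>0) \<le> (\<integral>\<^sup>+y. ennreal V \<partial>m\<^sub>0)"
      using that space_m0 by (intro nn_integral_mono) auto
    also have "\<dots> < \<infinity>"
      by (simp add: ennreal_mult_less_top m0.emeasure_eq_measure)
    finally show fin: "(\<integral>\<^sup>+y. q y \<partial>m\<^sub>0) \<noteq> \<infinity>" by simp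
    then show "finite_measure (density m\<^sub>0 q)"
      using that(1) by (intro finite_measureI) (simp add: emeasure_density nn_integral_cong[of m\<^sub>0 "\<lambda>x. q x * indicator (space m\<^sub>0) x" q])
  qed
  have loV: "lo y \<le> ennreal V" if "y \<in> Y" for y
    using lo_hi[of y] hiV[OF that] by (rule order_trans)
  have nn_lim: "(\<lambda>n. \<integral>\<^sup>+y. ennreal (k y) * ennreal (\<nu> n y) \<partial>m\<^sub>0) \<longlonglongrightarrow> (\<integral>\<^sup>+y. ennreal (k y) \<partial>\<nu>\<^sub>0)"
    if k: "continuous_on Y k" and k0: "\<And>y. 0 \<le> k y" for k :: "'b \<Rightarrow> real"
  proof -
    obtain A where A: "0 \<le> A" "\<And>x. x \<in> Y \<Longrightarrow> \<bar>k x\<bar> \<le> A"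
      using continuous_on_compact_abs_bound[OF Y k] by metis
    have "(\<integral>\<^sup>+y. ennreal (k y) * ennreal (\<nu> n y) \<partial>m\<^sub>0) = ennreal (\<integral>y. k y * \<nu> n y \<partial>m\<^sub>0)" for n
    proof -
      have "integrable m\<^sub>0 (\<lambda>y. k y * \<nu> n y)"
      proof (rule integrable_m0)
        show "\<bar>k y * \<nu> n y\<bar> \<le> A * V" if "y \<in> Y" for y
          unfolding abs_mult using A that \<nu>V[OF that, of n] ae'(6)[OF that, of n] by (intro mult_mono) auto
      qed (use measurable_m0[OF k] \<nu>_meas in auto)
      then have "(\<integral>\<^sup>+y. ennreal (k y * \<nu> n y) \<partial>m\<^sub>0) = ennreal (\<integral>y. k y * \<nu> n y \<partial>m\<^sub>0)"
        using k0 ae'(6) space_m0 by (intro nn_integral_eq_integral AE_I2) auto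
      then show ?thesis
        using k0 ae'(6) space_m0 by (simp add: ennreal_mult' cong: nn_integral_cong)
    qed
    moreover have "(\<integral>\<^sup>+y. ennreal (k y) \<partial>\<nu>\<^sub>0) = ennreal (integral\<^sup>L \<nu>\<^sub>0 k)"
      using k0 integrable_borel_probs[OF \<nu>\<^sub>0 Y k] by (intro nn_integral_eq_integral) auto
    ultimately show ?thesis using \<nu>_lim[OF k] by simp
  qed
  have kmeas: "(\<lambda>y. ennreal (k y)) \<in> borel_measurable m\<^sub>0" if "continuous_on Y k" for k
    using measurable_m0[OF that] by simp
  have sets_\<nu>\<^sub>0: "sets \<nu>\<^sub>0 = sets m\<^sub>0" using borel_probsD(2)[OF \<nu>\<^sub>0] sets_m0 by simp
  have to_real: "integral\<^sup>L L k \<le> integral\<^sup>L M k"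
    if "(\<integral>\<^sup>+y. ennreal (k y) \<partial>L) \<le> (\<integral>\<^sup>+y. ennreal (k y) \<partial>M)" "finite_measure L" "finite_measure M"
      "sets L = sets m\<^sub>0" "sets M = sets m\<^sub>0" and k: "continuous_on Y k" "\<And>y. 0 \<le> k y"
    for L M :: "'b measure" and k :: "'b \<Rightarrow> real"
  proof -
    have "integrable L k" "integrable M k"
      using that sets_m0 Y by (auto intro!: integrable_continuous_on_compact)
    then show ?thesis
      using that(1) k(2) by (simp add: nn_integral_eq_integral ennreal_le_iff2 integral_nonneg_AE)
        (smt (verit) Bochner_Integration.integral_nonneg)
  qed
  have \<nu>\<^sub>0_fin: "finite_measure \<nu>\<^sub>0"
    using borel_probsD(1)[OF \<nu>\<^sub>0] by (rule prob_space.finite_measure)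
  have \<nu>\<^sub>0_hi: "emeasure \<nu>\<^sub>0 A \<le> emeasure (density m\<^sub>0 hi) A" if "A \<in> sets m\<^sub>0" for A
  proof (rule emeasure_le_if_integral_le[OF \<nu>\<^sub>0_fin _ finite_density(1)[OF hi_meas hiV] _ Y])
    fix k :: "'b \<Rightarrow> real" assume k: "continuous_on Y k" "\<And>y. 0 \<le> k y"
    obtain B where B: "0 \<le> B" "\<And>x. x \<in> Y \<Longrightarrow> \<bar>k x\<bar> \<le> B"
      using continuous_on_compact_abs_bound[OF Y k(1)] by metis
    have "(\<integral>\<^sup>+y. ennreal (k y) \<partial>\<nu>\<^sub>0) = limsup (\<lambda>n. \<integral>\<^sup>+y. ennreal (k y) * ennreal (\<nu> n y) \<partial>m\<^sub>0)"
      using lim_imp_Limsup[OF _ nn_lim[OF k]] by simp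
    \<comment> \<open>Reverse Fatou, with domination provided by the common bound \<open>V\<close>;
      the bound by \<open>lo\<close> further down is Fatou's lemma. Comparison with continuous
      functions extends to Borel sets, and the upper bound also gives absolute continuity.\<close>
    also have "\<dots> \<le> (\<integral>\<^sup>+y. limsup (\<lambda>n. ennreal (k y) * ennreal (\<nu> n y)) \<partial>m\<^sub>0)"
    proof (rule nn_integral_limsup[where w = "\<lambda>_. ennreal B * ennreal V"])
      show "AE y in m\<^sub>0. ennreal (k y) * ennreal (\<nu> n y) \<le> ennreal B * ennreal V" for n
        using B(2) \<nu>V space_m0 by (intro AE_I2 mult_mono ennreal_leI) (auto simp: abs_le_iff)
      show "(\<integral>\<^sup>+y. ennreal B * ennreal V \<partial>m\<^sub>0) < \<infinity>"
        by (simp add: ennreal_mult_less_top m0.emeasure_eq_measure)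
    qed (use kmeas[OF k(1)] \<nu>_meas in auto)
    also have "\<dots> = (\<integral>\<^sup>+y. hi y * ennreal (k y) \<partial>m\<^sub>0)"
      unfolding hi_def by (simp add: limsup_cmult_ennreal mult.commute)
    also have "\<dots> = (\<integral>\<^sup>+y. ennreal (k y) \<partial>density m\<^sub>0 hi)"
      using hi_meas kmeas[OF k(1)] by (simp add: nn_integral_density)
    finally show "integral\<^sup>L \<nu>\<^sub>0 k \<le> integral\<^sup>L (density m\<^sub>0 hi) k"
      using \<nu>\<^sub>0_fin finite_density(1)[OF hi_meas hiV] sets_\<nu>\<^sub>0 k by (intro to_real) auto
  qed (use that sets_\<nu>\<^sub>0 sets_m0 in auto)
  have \<nu>\<^sub>0_lo: "emeasure (density m\<^sub>0 lo) A \<le> emeasure \<nu>\<^sub>0 A" if "A \<in> sets m\<^sub>0" for A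
  proof (rule emeasure_le_if_integral_le[OF finite_density(1)[OF lo_meas loV] _ \<nu>\<^sub>0_fin _ Y])
    fix k :: "'b \<Rightarrow> real" assume k: "continuous_on Y k" "\<And>y. 0 \<le> k y"
    have "(\<integral>\<^sup>+y. ennreal (k y) \<partial>density m\<^sub>0 lo) = (\<integral>\<^sup>+y. lo y * ennreal (k y) \<partial>m\<^sub>0)"
      using lo_meas kmeas[OF k(1)] by (simp add: nn_integral_density)
    also have "\<dots> = (\<integral>\<^sup>+y. liminf (\<lambda>n. ennreal (k y) * ennreal (\<nu> n y)) \<partial>m\<^sub>0)"
      unfolding lo_def by (simp add: liminf_cmult_ennreal mult.commute)
    also have "\<dots> \<le> liminf (\<lambda>n. \<integral>\<^sup>+y. ennreal (k y) * ennreal (\<nu> n y) \<partial>m\<^sub>0)"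
      by (rule nn_integral_liminf) (use kmeas[OF k(1)] \<nu>_meas in auto)
    also have "\<dots> = (\<integral>\<^sup>+y. ennreal (k y) \<partial>\<nu>\<^sub>0)"
      using lim_imp_Liminf[OF _ nn_lim[OF k]] by simp
    finally show "integral\<^sup>L (density m\<^sub>0 lo) k \<le> integral\<^sup>L \<nu>\<^sub>0 k"
      using \<nu>\<^sub>0_fin finite_density(1)[OF lo_meas loV] sets_\<nu>\<^sub>0 k by (intro to_real) auto
  qed (use that sets_\<nu>\<^sub>0 sets_m0 in auto)

  \<comment> \<open>The pointwise equation for the limit density\<close>
  have ac: "absolutely_continuous m\<^sub>0 \<nu>\<^sub>0"
    unfolding absolutely_continuous_def
  proof
    fix A assume A: "A \<in> null_sets m\<^sub>0"
    then have "emeasure (density m\<^sub>0 hi) A = 0"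
      using absolutely_continuousI_density[OF hi_meas] by (auto simp: absolutely_continuous_def)
    then show "A \<in> null_sets \<nu>\<^sub>0"
      using \<nu>\<^sub>0_hi[of A] A sets_\<nu>\<^sub>0 by (auto simp: null_sets_def)
  qed
  let ?d = "RN_deriv m\<^sub>0 \<nu>\<^sub>0"
  have density: "density m\<^sub>0 ?d = \<nu>\<^sub>0"
    by (rule m0.density_RN_deriv[OF ac sets_\<nu>\<^sub>0])
  have d_meas: "?d \<in> borel_measurable m\<^sub>0" by simp
  have "emeasure (density m\<^sub>0 ?d) (space m\<^sub>0) = (\<integral>\<^sup>+y. ?d y \<partial>m\<^sub>0)"
    by (subst emeasure_density) (auto intro!: nn_integral_cong)
  then have d_fin: "(\<integral>\<^sup>+y. ?d y \<partial>m\<^sub>0) \<noteq> \<infinity>"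
    using finite_measure.emeasure_finite[OF \<nu>\<^sub>0_fin, of "space m\<^sub>0"] density by simp
  have AE_hi: "AE y in m\<^sub>0. ?d y \<le> hi y"
    using AE_le_if_density_le[OF d_meas hi_meas finite_density(2)[OF hi_meas hiV]] \<nu>\<^sub>0_hi density by simp
  have AE_lo: "AE y in m\<^sub>0. lo y \<le> ?d y"
    using AE_le_if_density_le[OF lo_meas d_meas d_fin] \<nu>\<^sub>0_lo density by simp
  have AE_Y: "AE y in m\<^sub>0. y \<in> Y"
    using AE_space[of m\<^sub>0] by (simp add: space_m0)
  have AE_V: "AE y in m\<^sub>0. P\<^sub>0 y \<le> externality m\<^sub>0 f I \<nu>\<^sub>0 y \<and>
    (0 < ?d y \<longrightarrow> externality m\<^sub>0 f I \<nu>\<^sub>0 y = P\<^sub>0 y) \<and> density_at m\<^sub>0 \<nu>\<^sub>0 y \<le> V"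
    using AE_hi AE_lo AE_Y
  proof eventually_elim
    case (elim y)
    define t where "t = density_at m\<^sub>0 \<nu>\<^sub>0 y"
    \<comment> \<open>\<open>density_at\<close> would turn an infinite derivative into 0, so
      finiteness has to come before the passage to real values.\<close>
    have fin: "?d y < \<infinity>"
      using elim(1) hiV[OF elim(3)] by (auto simp: less_top[symmetric] top_unique dest: order_trans)
    then have t: "?d y = ennreal t" "0 \<le> t"
      by (simp_all add: t_def density_at_def)
    have "P\<^sub>0 y - I \<nu>\<^sub>0 y \<le> f y t \<and> (0 < t \<longrightarrow> f y t = P\<^sub>0 y - I \<nu>\<^sub>0 y)"
    proof (rule cluster_point_solves[OF elim(3)])
      show "(\<lambda>n. P n y - I (\<sigma> n) y) \<longlonglongrightarrow> P\<^sub>0 y - I \<nu>\<^sub>0 y"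
        by (intro tendsto_diff tendsto_uniform_limitI[OF P_lim] tendsto_uniform_limitI[OF I_lim] elim)
      show "(\<lambda>n. e n * \<nu> n y) \<longlonglongrightarrow> 0"
      proof (rule Lim_null_comparison)
        show "\<forall>\<^sub>F n in sequentially. norm (e n * \<nu> n y) \<le> e n * V"
          using e0 \<nu>V[OF elim(3)] ae'(6)[OF elim(3)] by (auto simp: abs_mult less_imp_le)
        show "(\<lambda>n. e n * V) \<longlonglongrightarrow> 0" using tendsto_mult_right[OF e, of V] by simp
      qed
      show "P n y - I (\<sigma> n) y \<le> f y (\<nu> n y) + e n * \<nu> n y" for n
        using ae'(11)[OF elim(3), of n] by linarith
      show "P n y - I (\<sigma> n) y = f y (\<nu> n y) + e n * \<nu> n y" if "0 < \<nu> n y" for n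
        using ae'(12)[OF elim(3) that] by linarith
      show "liminf (\<lambda>n. ennreal (\<nu> n y)) \<le> ennreal t"
        using elim(2) unfolding t(1) lo_def .
      show "ennreal t \<le> limsup (\<lambda>n. ennreal (\<nu> n y))"
        using elim(1) unfolding t(1) hi_def .
    qed (rule ae'(6)[OF elim(3)], rule t(2))
    moreover have "t \<le> V"
      using order_trans[OF elim(1) hiV[OF elim(3)]] V unfolding t(1) by simp
    moreover have "0 < ?d y \<longleftrightarrow> 0 < t" by (simp add: t(1))
    ultimately show ?case
      by (auto simp: externality_def t_def[symmetric])
  qed

  have adm: "\<nu>\<^sub>0 \<in> admissible Y m\<^sub>0 \<alpha>"
  proof -
    have "integrable m\<^sub>0 (\<lambda>y. density_at m\<^sub>0 \<nu>\<^sub>0 y powr (1 + \<alpha>))"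
    proof (rule m0.integrable_const_bound)
      show "AE y in m\<^sub>0. norm (density_at m\<^sub>0 \<nu>\<^sub>0 y powr (1 + \<alpha>)) \<le> V powr (1 + \<alpha>)"
        using AE_V
      proof eventually_elim
        case (elim y)
        then show ?case using \<alpha> by (auto intro!: powr_mono2 simp: density_at_def)
      qed
      show "(\<lambda>y. density_at m\<^sub>0 \<nu>\<^sub>0 y powr (1 + \<alpha>)) \<in> borel_measurable m\<^sub>0"
        unfolding density_at_def using d_meas by measurable
    qed
    then show ?thesis using \<nu>\<^sub>0 ac by (simp add: admissible_def)
  qed

  \<comment> \<open>Optimality on the support of the limit plan\<close>
  have gap: "AE p in \<gamma>. P\<^sub>0 (snd p) + c (fst p) (snd p) - \<phi>\<^sub>0 (fst p) = 0"
  proof -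
    let ?F = "\<lambda>p. P\<^sub>0 (snd p) + c (fst p) (snd p) - \<phi>\<^sub>0 (fst p)"
    let ?Fn = "\<lambda>n p. P n (snd p) + c (fst p) (snd p) - \<phi> n (fst p)"
    have FC: "continuous_on (X \<times> Y) ?F"
      by (intro continuous_intros cC cts1[OF \<phi>C] cts2[OF PC])
    have FnC: "continuous_on (X \<times> Y) (?Fn n)" for n
      using conjugate_continuous[OF ae'(3)[of n]] by (intro continuous_intros cC cts1 cts2) auto
    have "integral\<^sup>L \<gamma> ?F \<le> 0"
    proof (rule field_le_epsilon)
      fix d :: real assume "d > 0"
      \<comment> \<open>One third each for the uniform error of \<open>P\<close>, that of
        \<open>\<phi>\<close> and the slack \<open>e n\<close>.\<close>
      then have "d / 3 > 0" by simp
      have "\<forall>\<^sub>F n in sequentially. integral\<^sup>L (\<gamma>s n) ?F \<le> d"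
        using uniform_limitD[OF P_lim \<open>d / 3 > 0\<close>] uniform_limitD[OF \<phi>_lim \<open>d / 3 > 0\<close>] order_tendstoD(2)[OF e \<open>d / 3 > 0\<close>]
      proof eventually_elim
        case (elim n)
        interpret n: prob_space "\<gamma>s n" using borel_probsD[OF ae'(1)] by blast
        have "integral\<^sup>L (\<gamma>s n) ?F \<le> (\<integral>p. ?Fn n p + 2 * (d / 3) \<partial>\<gamma>s n)"
        proof (rule integral_mono)
          show "integrable (\<gamma>s n) ?F" "integrable (\<gamma>s n) (\<lambda>p. ?Fn n p + 2 * (d / 3))"
            by (intro integrable_borel_probs[OF ae'(1) compact_Times[OF X Y]] FC FnC continuous_on_add continuous_on_const)+
          fix p assume "p \<in> space (\<gamma>s n)"
          then have p: "fst p \<in> X" "snd p \<in> Y"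
            unfolding borel_probsD(3)[OF ae'(1)[of n]] by (simp_all add: mem_Times_iff)
          have "\<bar>P n (snd p) - P\<^sub>0 (snd p)\<bar> < d / 3" "\<bar>\<phi> n (fst p) - \<phi>\<^sub>0 (fst p)\<bar> < d / 3"
            using bspec[OF elim(1) p(2)] bspec[OF elim(2) p(1)] by (simp_all only: dist_real_def)
          then show "?F p \<le> ?Fn n p + 2 * (d / 3)" by linarith
        qed
        also have "\<dots> = integral\<^sup>L (\<gamma>s n) (?Fn n) + 2 * (d / 3)"
          using integrable_borel_probs[OF ae'(1) compact_Times[OF X Y] FnC, of n n]
          by (subst Bochner_Integration.integral_add) (auto simp: n.prob_space)
        also have "\<dots> \<le> d" using ae'(10)[of n] elim(3) by linarith
        finally show ?case .
      qed
      then have "integral\<^sup>L \<gamma> ?F \<le> d"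
        by (intro tendsto_upperbound[OF \<gamma>_lim[OF FC]]) auto
      then show "integral\<^sup>L \<gamma> ?F \<le> 0 + d" by simp
    qed
    moreover have F0: "AE p in \<gamma>. 0 \<le> ?F p"
      using \<phi>P space_\<gamma> by (intro AE_I2) (auto simp: algebra_simps)
    ultimately have "integral\<^sup>L \<gamma> ?F = 0"
      using integral_nonneg_AE[OF F0] by linarith
    then show ?thesis
      using integral_nonneg_eq_0_iff_AE[OF integrable_borel_probs[OF \<gamma> compact_Times[OF X Y] FC] F0] by simp
  qed
  \<comment> \<open>The equation holds where the derivative is positive, which is almost everywhere
    for the limit measure itself; the second marginal carries it over to the plan.\<close>
  have "AE y in \<nu>\<^sub>0. externality m\<^sub>0 f I \<nu>\<^sub>0 y = P\<^sub>0 y"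
  proof -
    have "AE y in density m\<^sub>0 ?d. externality m\<^sub>0 f I \<nu>\<^sub>0 y = P\<^sub>0 y"
      unfolding AE_density[OF d_meas] using AE_V by eventually_elim auto
    then show ?thesis by (simp only: density)
  qed
  then have V_snd: "AE p in \<gamma>. externality m\<^sub>0 f I \<nu>\<^sub>0 (snd p) = P\<^sub>0 (snd p)"
    unfolding \<nu>\<^sub>0_def[symmetric] by (rule AE_distrD[OF marginal_meas(2), folded \<nu>\<^sub>0_def])
  show ?thesis
    unfolding cournot_nash_equilibrium_def
  proof (intro exI[of _ \<gamma>] conjI bexI[of _ \<nu>\<^sub>0] exI[of _ \<phi>\<^sub>0] ballI)
    show "AE y in m\<^sub>0. c x y + externality m\<^sub>0 f I \<nu>\<^sub>0 y \<ge> \<phi>\<^sub>0 x" if "x \<in> X" for x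
      using AE_V AE_Y
    proof eventually_elim
      case (elim y)
      then show ?case using \<phi>P[OF that, of y] by linarith
    qed
    show "AE (x, y) in \<gamma>. c x y + externality m\<^sub>0 f I \<nu>\<^sub>0 y = \<phi>\<^sub>0 x"
      using V_snd gap by eventually_elim (auto simp: case_prod_beta)
  qed (use \<gamma> marginal1 adm \<phi>C in \<open>auto simp: \<nu>\<^sub>0_def\<close>)
qed

end

theorem theorem6p2:
  fixes \<Omega> X :: "'a::euclidean_space set"
    and Y :: "'b::metric_space set"
    and m\<^sub>0 :: "'b measure"
    and \<mu> :: "'a measure"
    and c :: "'a \<Rightarrow> 'b \<Rightarrow> real"
    and grad_c :: "'a \<Rightarrow> 'b \<Rightarrow> 'a"
    and f :: "'b \<Rightarrow> real \<Rightarrow> real"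
    and I :: "'b measure \<Rightarrow> 'b \<Rightarrow> real"
    and \<alpha> C :: real
  assumes "open \<Omega>" and "bounded \<Omega>" and "connected \<Omega>" and "negligible (frontier \<Omega>)"
    and "X = closure \<Omega>"
    and "compact Y"
    and "finite_measure m\<^sub>0" and "sets m\<^sub>0 = sets (borel_on Y)" and "emeasure m\<^sub>0 Y > 0"
    and "\<mu> \<in> borel_probs X" and "equivalent_measures \<mu> (restrict_space lborel X)"
    and "continuous_on (X \<times> Y) (\<lambda>(x, y). c x y)"
    and "\<And>x y. x \<in> X \<Longrightarrow> y \<in> Y \<Longrightarrow>
           ((\<lambda>x'. c x' y) has_derivative (\<lambda>h. grad_c x y \<bullet> h)) (at x within X)"
    and "bounded ((\<lambda>(x, y). grad_c x y) ` (X \<times> Y))"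
    and "\<And>t. t \<ge> 0 \<Longrightarrow> (\<lambda>y. f y t) \<in> borel_measurable (borel_on Y)"
    and "\<And>y. y \<in> Y \<Longrightarrow> continuous_on {0..} (f y)"
    and "\<And>y. y \<in> Y \<Longrightarrow> mono_on {0..} (f y)"
    and "\<alpha> > 0" and "C > 0"
    and "\<And>y t. y \<in> Y \<Longrightarrow> t \<ge> 0 \<Longrightarrow>
           1 / C * (t powr \<alpha> - 1) \<le> f y t \<and> f y t \<le> C * (t powr \<alpha> + 1)"
    and "\<And>\<nu>. \<nu> \<in> borel_probs Y \<Longrightarrow> continuous_on Y (I \<nu>)"
    and "continuous_map (weak_star Y) (sup_norm_topology Y) (\<lambda>\<nu>. restrict (I \<nu>) Y)"
  shows "\<exists>\<gamma>. cournot_nash_equilibrium X Y \<mu> m\<^sub>0 (admissible Y m\<^sub>0 \<alpha>) c (externality m\<^sub>0 f I) \<gamma>"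
proof -
  have "compact X"
    using assms(2,5) by (simp add: compact_closure)
  then interpret congestion_game X Y m\<^sub>0 \<mu> c f I \<alpha> C
    by (intro congestion_game.intro assms)
  show ?thesis by (rule equilibrium_exists)
qed

end
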